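(* Let $M=G/H$ be a homogeneous space of a compact connected Lie group $G$ with reductive decomposition $\mathfrak g=\mathfrak h+\mathfrak m$. Assume that the $\mathrm{Ad}_H$-module $\mathfrak m$ has a (direct sum) decomposition $$\mathfrak m=\mathfrak m_1+\cdots+\mathfrak m_k$$ into $\mathrm{Ad}_H$-invariant submodules such that either (1) $[\mathfrak m_i,\mathfrak m_j]=0$ for all $i<j$; or (2) $[\mathfrak m_i,\mathfrak m_j]=0$ for all $i<j$ with the one exception $(i,j)=(1,2)$, and in this case $[\mathfrak m_1,\mathfrak m_2]\subset\mathfrak m_2$ and for any $X\in\mathfrak m_1$, $Y\in\mathfrak m_2$ there is $W\in\mathfrak h$ such that $\mathrm{ad}_W Y=\mathrm{ad}_X Y$ and $\mathrm{ad}_W(\mathfrak m_1+\mathfrak m_3+\cdots+\mathfrak m_k)=0$. Then any metric endomorphism of the form $A=\sum_i x_i\cdot\mathbf 1_{\mathfrak m_i}$ defines a GO-metric on $M$.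
   Context: $H\subset G$ is a closed subgroup with Lie algebra $\mathfrak h$; $b=\langle\cdot,\cdot\rangle$ is a fixed $\mathrm{Ad}_G$-invariant Euclidean metric on $\mathfrak g$; $\mathfrak g=\mathfrak h+\mathfrak m$ is the $b$-orthogonal decomposition, with $\mathfrak m$ identified with $T_oM$, $o=eH$. A metric endomorphism is an $\mathrm{Ad}_H$-equivariant, $b$-symmetric, positive definite endomorphism $A$ of $\mathfrak m$; it defines the $\mathrm{Ad}_H$-invariant Euclidean metric $g(X,Y)=b(AX,Y)$ on $\mathfrak m$ and hence a $G$-invariant Riemannian metric $g^M$ on $M$. $\mathbf 1_{\mathfrak m_i}$ denotes the identity on $\mathfrak m_i$ (extended by $0$ on the other summands). The metric $g^M$ is a GO-metric if every geodesic of $(M,g^M)$ is an orbit of a one-parameter subgroup of $G$. *)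

theory Defs
  imports "HOL-Analysis.Analysis" "HOL-Algebra.Left_Coset"
begin

section \<open>Smooth manifolds\<close>

text \<open>
  Model spaces are finite-dimensional real inner product spaces. The class
  \<open>euclidean_space\<close> is avoided because it excludes dimension zero (a point), which is a
  legitimate homogeneous space. The sort \<open>heine_borel\<close> is no restriction: it holds in every
  finite-dimensional normed space.
\<close>

text \<open>Infinite differentiability on a set that is meant to be open in a finite-dimensional space.\<close>

primrec diff_on :: "nat \<Rightarrow> 'a::real_normed_vector set \<Rightarrow> ('a \<Rightarrow> 'b::real_normed_vector) \<Rightarrow> bool" where
  "diff_on 0 S f \<longleftrightarrow> continuous_on S f"
| "diff_on (Suc n) S f \<longleftrightarrow> (\<forall>x\<in>S. f differentiable (at x)) \<and>
     (\<forall>v. diff_on n S (\<lambda>x. frechet_derivative f (at x) v))"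

definition smooth_on :: "'a::real_normed_vector set \<Rightarrow> ('a \<Rightarrow> 'b::real_normed_vector) \<Rightarrow> bool" where
  "smooth_on S f \<longleftrightarrow> (\<forall>n. diff_on n S f)"

text \<open>A chart is a pair of its domain and its coordinate map; the values of the coordinate map
  outside of the domain are irrelevant.\<close>

type_synonym ('p, 'e) chart = "'p set \<times> ('p \<Rightarrow> 'e)"

definition is_chart :: "'p topology \<Rightarrow> ('p, 'e::real_normed_vector) chart \<Rightarrow> bool" where
  "is_chart T = (\<lambda>(U, \<phi>). openin T U \<and> open (\<phi> ` U) \<and>
     homeomorphic_map (subtopology T U) (top_of_set (\<phi> ` U)) \<phi>)"

definition local_rep ::
  "('p, 'e) chart \<Rightarrow> ('q, 'f) chart \<Rightarrow> ('p \<Rightarrow> 'q) \<Rightarrow> 'e \<Rightarrow> 'f" where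
  "local_rep C D F = snd D \<circ> F \<circ> inv_into (fst C) (snd C)"

definition smooth_in_charts ::
  "('p, 'e::real_normed_vector) chart \<Rightarrow> ('q, 'f::real_normed_vector) chart \<Rightarrow> ('p \<Rightarrow> 'q) \<Rightarrow> bool" where
  "smooth_in_charts C D F \<longleftrightarrow>
     smooth_on (snd C ` (fst C \<inter> F -` fst D)) (local_rep C D F)"

definition compatible :: "('p, 'e::real_normed_vector) chart \<Rightarrow> ('p, 'e) chart \<Rightarrow> bool" where
  "compatible C D \<longleftrightarrow> smooth_in_charts C D id \<and> smooth_in_charts D C id"

definition smooth_manifold ::
  "'p topology \<Rightarrow> ('p, 'e::{real_inner, heine_borel}) chart set \<Rightarrow> bool" where
  "smooth_manifold T \<A> \<longleftrightarrow>
     (\<exists>B::'e set. finite B \<and> span B = UNIV) \<and>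
     Hausdorff_space T \<and> second_countable T \<and>
     (\<forall>C\<in>\<A>. is_chart T C) \<and>
     (\<Union>C\<in>\<A>. fst C) = topspace T \<and>
     (\<forall>C\<in>\<A>. \<forall>D\<in>\<A>. compatible C D) \<and>
     (\<forall>C. is_chart T C \<and> (\<forall>D\<in>\<A>. compatible C D) \<longrightarrow> C \<in> \<A>)"

definition smooth_map ::
  "'p topology \<Rightarrow> ('p, 'e::real_normed_vector) chart set \<Rightarrow>
   'q topology \<Rightarrow> ('q, 'f::real_normed_vector) chart set \<Rightarrow> ('p \<Rightarrow> 'q) \<Rightarrow> bool" where
  "smooth_map T \<A> T' \<B> F \<longleftrightarrow>
     continuous_map T T' F \<and> (\<forall>C\<in>\<A>. \<forall>D\<in>\<B>. smooth_in_charts C D F)"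

text \<open>The differential of \<open>F\<close> at \<open>p\<close>, expressed in a chart around \<open>p\<close> and a chart around \<open>F p\<close>;
  tangent vectors are represented by their coordinates.\<close>

definition differential ::
  "('p, 'e::real_normed_vector) chart \<Rightarrow> ('q, 'f::real_normed_vector) chart \<Rightarrow>
   ('p \<Rightarrow> 'q) \<Rightarrow> 'p \<Rightarrow> 'e \<Rightarrow> 'f" where
  "differential C D F p = frechet_derivative (local_rep C D F) (at (snd C p))"

definition smooth_curve ::
  "'p topology \<Rightarrow> ('p, 'e::real_normed_vector) chart set \<Rightarrow> real set \<Rightarrow> (real \<Rightarrow> 'p) \<Rightarrow> bool" where
  "smooth_curve T \<A> I c \<longleftrightarrow>
     continuous_map (top_of_set I) T c \<and>
     (\<forall>(U, \<phi>)\<in>\<A>. smooth_on (I \<inter> c -` U) (\<phi> \<circ> c))"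

section \<open>Riemannian metrics and geodesics\<close>

definition is_inner_product :: "('e::real_vector \<Rightarrow> 'e \<Rightarrow> real) \<Rightarrow> bool" where
  "is_inner_product b \<longleftrightarrow>
     bilinear b \<and> (\<forall>X Y. b X Y = b Y X) \<and> (\<forall>X. X \<noteq> 0 \<longrightarrow> b X X > 0)"

text \<open>A Riemannian metric is given by its coordinate expressions: \<open>g C u v w\<close> is the value, at the
  point with coordinates \<open>u\<close> in the chart \<open>C\<close>, on the tangent vectors with coordinates
  \<open>v\<close> and \<open>w\<close>.\<close>

type_synonym ('p, 'e) metric_expr = "('p, 'e) chart \<Rightarrow> 'e \<Rightarrow> 'e \<Rightarrow> 'e \<Rightarrow> real"

definition preserves_metric ::
  "('p, 'e::real_normed_vector) chart set \<Rightarrow> ('p, 'e) metric_expr \<Rightarrow> ('p \<Rightarrow> 'p) \<Rightarrow> bool" where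
  "preserves_metric \<A> g F \<longleftrightarrow>
     (\<forall>C\<in>\<A>. \<forall>D\<in>\<A>. \<forall>p\<in>fst C. F p \<in> fst D \<longrightarrow>
        (\<forall>v w. g D (snd D (F p)) (differential C D F p v) (differential C D F p w)
               = g C (snd C p) v w))"

text \<open>Preservation by the identity map is the tensorial transformation law under changes of chart.\<close>

definition riemannian_metric ::
  "('p, 'e::real_normed_vector) chart set \<Rightarrow> ('p, 'e) metric_expr \<Rightarrow> bool" where
  "riemannian_metric \<A> g \<longleftrightarrow>
     (\<forall>C\<in>\<A>. (\<forall>u\<in>snd C ` fst C. is_inner_product (g C u)) \<and>
             (\<forall>v w. smooth_on (snd C ` fst C) (\<lambda>u. g C u v w))) \<and>
     preserves_metric \<A> g id"

text \<open>Christoffel symbols of the first kind of the Levi-Civita connection: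
  \<open>christoffel h u x y z\<close> is the inner product of the covariant derivative (at \<open>u\<close>, in
  direction \<open>x\<close>) of the constant vector field \<open>y\<close> with \<open>z\<close>.\<close>

definition christoffel ::
  "('e::real_normed_vector \<Rightarrow> 'e \<Rightarrow> 'e \<Rightarrow> real) \<Rightarrow> 'e \<Rightarrow> 'e \<Rightarrow> 'e \<Rightarrow> 'e \<Rightarrow> real" where
  "christoffel h u x y z =
     (frechet_derivative (\<lambda>q. h q y z) (at u) x
      + frechet_derivative (\<lambda>q. h q x z) (at u) y
      - frechet_derivative (\<lambda>q. h q x y) (at u) z) / 2"

text \<open>The geodesic equation in local coordinates, with the index lowered by the metric.\<close>

definition geodesic_on ::
  "'p topology \<Rightarrow> ('p, 'e::real_normed_vector) chart set \<Rightarrow> ('p, 'e) metric_expr \<Rightarrow>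
   real set \<Rightarrow> (real \<Rightarrow> 'p) \<Rightarrow> bool" where
  "geodesic_on T \<A> g I c \<longleftrightarrow>
     smooth_curve T \<A> I c \<and>
     (\<forall>C\<in>\<A>. \<forall>t\<in>I. c t \<in> fst C \<longrightarrow>
        (let u = snd C \<circ> c;
             u1 = vector_derivative u (at t);
             u2 = vector_derivative (\<lambda>s. vector_derivative u (at s)) (at t)
         in \<forall>w. g C (u t) u2 w + christoffel (g C) (u t) u1 u1 w = 0))"

section \<open>Lie groups\<close>

definition lie_group ::
  "'g monoid \<Rightarrow> 'g topology \<Rightarrow> ('g, 'e::{real_inner, heine_borel}) chart set \<Rightarrow> bool" where
  "lie_group G T \<A> \<longleftrightarrow>
     group G \<and> topspace T = carrier G \<and> smooth_manifold T \<A> \<and>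
     continuous_map (prod_topology T T) T (\<lambda>(x, y). x \<otimes>\<^bsub>G\<^esub> y) \<and>
     (\<forall>(U, \<phi>)\<in>\<A>. \<forall>(V, \<eta>)\<in>\<A>. \<forall>(W, \<psi>)\<in>\<A>.
        smooth_on {(\<phi> x, \<eta> y) | x y. x \<in> U \<and> y \<in> V \<and> x \<otimes>\<^bsub>G\<^esub> y \<in> W}
          (\<lambda>(u, v). \<psi> (inv_into U \<phi> u \<otimes>\<^bsub>G\<^esub> inv_into V \<eta> v))) \<and>
     smooth_map T \<A> T \<A> (\<lambda>x. inv\<^bsub>G\<^esub> x)"

definition one_parameter_subgroup ::
  "'g monoid \<Rightarrow> 'g topology \<Rightarrow> ('g, 'e::real_normed_vector) chart set \<Rightarrow> (real \<Rightarrow> 'g) \<Rightarrow> bool" where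
  "one_parameter_subgroup G T \<A> \<sigma> \<longleftrightarrow>
     smooth_curve T \<A> UNIV \<sigma> \<and> (\<forall>s t. \<sigma> (s + t) = \<sigma> s \<otimes>\<^bsub>G\<^esub> \<sigma> t)"

text \<open>From here on \<open>E\<close> is a chart around the identity. It identifies the Lie algebra of \<open>G\<close>, i.e. the
  tangent space at the identity, with the model space \<open>'e\<close>.\<close>

definition Ad :: "'g monoid \<Rightarrow> ('g, 'e::real_normed_vector) chart \<Rightarrow> 'g \<Rightarrow> 'e \<Rightarrow> 'e" where
  "Ad G E a = differential E E (\<lambda>x. a \<otimes>\<^bsub>G\<^esub> x \<otimes>\<^bsub>G\<^esub> inv\<^bsub>G\<^esub> a) \<one>\<^bsub>G\<^esub>"

text \<open>The Lie bracket \<open>[X, Y] = ad X Y\<close>, where \<open>ad\<close> is the differential of \<open>Ad\<close> at the identity.\<close>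

definition lie_bracket :: "'g monoid \<Rightarrow> ('g, 'e::real_normed_vector) chart \<Rightarrow> 'e \<Rightarrow> 'e \<Rightarrow> 'e" where
  "lie_bracket G E X Y = differential E (UNIV, id) (\<lambda>a. Ad G E a Y) \<one>\<^bsub>G\<^esub> X"

definition lie_algebra_of ::
  "'g monoid \<Rightarrow> 'g topology \<Rightarrow> ('g, 'e::real_normed_vector) chart set \<Rightarrow> ('g, 'e) chart \<Rightarrow>
   'g set \<Rightarrow> 'e set" where
  "lie_algebra_of G T \<A> E H =
     {X. \<exists>\<sigma>. one_parameter_subgroup G T \<A> \<sigma> \<and> range \<sigma> \<subseteq> H \<and>
             ((snd E \<circ> \<sigma>) has_vector_derivative X) (at 0)}"

definition orth_complement :: "('e \<Rightarrow> 'e \<Rightarrow> real) \<Rightarrow> 'e set \<Rightarrow> 'e set" where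
  "orth_complement b S = {X. \<forall>W\<in>S. b W X = 0}"

definition Ad_invariant_metric ::
  "'g monoid \<Rightarrow> ('g, 'e::real_normed_vector) chart \<Rightarrow> ('e \<Rightarrow> 'e \<Rightarrow> real) \<Rightarrow> bool" where
  "Ad_invariant_metric G E b \<longleftrightarrow> is_inner_product b \<and>
     (\<forall>a\<in>carrier G. \<forall>X Y. b (Ad G E a X) (Ad G E a Y) = b X Y)"

section \<open>Homogeneous spaces\<close>

text \<open>The manifold \<open>G/H\<close>: the set of left cosets with the smooth structure (unique, if it exists)
  for which the projection is a smooth submersion. It exists whenever \<open>H\<close> is closed.\<close>

definition coset_manifold ::
  "'g monoid \<Rightarrow> 'g topology \<Rightarrow> ('g, 'e::{real_inner, heine_borel}) chart set \<Rightarrow> 'g set \<Rightarrow>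
   'g set topology \<Rightarrow> ('g set, 'f::{real_inner, heine_borel}) chart set \<Rightarrow> bool" where
  "coset_manifold G T \<A> H TM \<B> \<longleftrightarrow>
     topspace TM = lcosets\<^bsub>G\<^esub> H \<and> smooth_manifold TM \<B> \<and>
     smooth_map T \<A> TM \<B> (\<lambda>a. a <#\<^bsub>G\<^esub> H) \<and>
     (\<forall>C\<in>\<A>. \<forall>D\<in>\<B>. \<forall>a\<in>fst C. a <#\<^bsub>G\<^esub> H \<in> fst D \<longrightarrow>
        surj (differential C D (\<lambda>x. x <#\<^bsub>G\<^esub> H) a))"

definition direct_sum_decomp :: "nat \<Rightarrow> (nat \<Rightarrow> 'e::real_vector set) \<Rightarrow> 'e set \<Rightarrow> bool" where
  "direct_sum_decomp k M V \<longleftrightarrow>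
     (\<forall>i\<in>{1..k}. subspace (M i)) \<and>
     V = {\<Sum>i=1..k. f i | f. \<forall>i\<in>{1..k}. f i \<in> M i} \<and>
     (\<forall>f. (\<forall>i\<in>{1..k}. f i \<in> M i) \<and> (\<Sum>i=1..k. f i) = 0 \<longrightarrow> (\<forall>i\<in>{1..k}. f i = 0))"

definition metric_endomorphism ::
  "'g monoid \<Rightarrow> ('g, 'e::real_normed_vector) chart \<Rightarrow> ('e \<Rightarrow> 'e \<Rightarrow> real) \<Rightarrow> 'g set \<Rightarrow> 'e set \<Rightarrow>
   ('e \<Rightarrow> 'e) \<Rightarrow> bool" where
  "metric_endomorphism G E b H \<mm> A \<longleftrightarrow>
     A ` \<mm> \<subseteq> \<mm> \<and>
     (\<forall>X\<in>\<mm>. \<forall>Y\<in>\<mm>. A (X + Y) = A X + A Y) \<and>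
     (\<forall>X\<in>\<mm>. \<forall>r. A (r *\<^sub>R X) = r *\<^sub>R A X) \<and>
     (\<forall>a\<in>H. \<forall>X\<in>\<mm>. A (Ad G E a X) = Ad G E a (A X)) \<and>
     (\<forall>X\<in>\<mm>. \<forall>Y\<in>\<mm>. b (A X) Y = b X (A Y)) \<and>
     (\<forall>X\<in>\<mm>. X \<noteq> 0 \<longrightarrow> b (A X) X > 0)"

text \<open>The \<open>G\<close>-invariant Riemannian metric on \<open>G/H\<close> whose value at the base point \<open>H\<close> is
  \<open>b (A X) Y\<close>, under the identification of \<open>\<mm>\<close> with the tangent space by the differential of the
  projection. These conditions determine \<open>g\<close> (on the domains of the charts).\<close>

definition invariant_metric_of ::
  "'g monoid \<Rightarrow> ('g, 'e::real_normed_vector) chart \<Rightarrow> ('e \<Rightarrow> 'e \<Rightarrow> real) \<Rightarrow> 'g set \<Rightarrow> 'e set \<Rightarrow>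
   ('e \<Rightarrow> 'e) \<Rightarrow> ('g set, 'f::real_normed_vector) chart set \<Rightarrow> ('g set, 'f) metric_expr \<Rightarrow> bool" where
  "invariant_metric_of G E b H \<mm> A \<B> g \<longleftrightarrow>
     riemannian_metric \<B> g \<and>
     (\<forall>a\<in>carrier G. preserves_metric \<B> g (\<lambda>p. a <#\<^bsub>G\<^esub> p)) \<and>
     (\<forall>D\<in>\<B>. H \<in> fst D \<longrightarrow>
        (let dpi = differential E D (\<lambda>x. x <#\<^bsub>G\<^esub> H) \<one>\<^bsub>G\<^esub>
         in \<forall>X\<in>\<mm>. \<forall>Y\<in>\<mm>. g D (snd D H) (dpi X) (dpi Y) = b (A X) Y))"

text \<open>Geodesics are taken on arbitrary open intervals (in particular on the whole line), and they
  are orbits as parametrized curves.\<close>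

definition GO_metric ::
  "'g monoid \<Rightarrow> 'g topology \<Rightarrow> ('g, 'e::real_normed_vector) chart set \<Rightarrow>
   'g set topology \<Rightarrow> ('g set, 'f::real_normed_vector) chart set \<Rightarrow> ('g set, 'f) metric_expr \<Rightarrow> bool" where
  "GO_metric G T \<A> TM \<B> g \<longleftrightarrow>
     (\<forall>I c. open I \<and> is_interval I \<and> geodesic_on TM \<B> g I c \<longrightarrow>
        (\<exists>\<sigma>. one_parameter_subgroup G T \<A> \<sigma> \<and>
             (\<exists>p\<in>topspace TM. \<forall>t\<in>I. c t = \<sigma> t <#\<^bsub>G\<^esub> p)))"

end

theory Submission
  imports Defs
begin

text \<open>
  By the bracket relations, every \<open>X \<in> \<mm>\<close> has some \<open>W \<in> \<hh>\<close> such that \<open>Z = X + W\<close> commutes with \<open>A X\<close>.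
  Hence \<open>A X\<close> is fixed by \<open>Ad (exp t Z)\<close>, and the momenta \<open>g(\<gamma>', Y\<^sup>*) = b(A X, Ad(exp(- t Z)) Y)\<close> of
  the orbit \<open>\<gamma> t = exp (t Z) H\<close> are constant, where \<open>Y\<^sup>*\<close> is the fundamental field of \<open>Y\<close>. As these
  fields are Killing fields and span every tangent space, Noether's argument read backwards shows that \<open>\<gamma>\<close> is a
  geodesic. Translates of such orbits realize all initial velocities, so every geodesic is one of
  them by uniqueness. The one-parameter subgroups are obtained from local solutions of the differential
  equation of a left invariant field.
\<close>

section \<open>Calculus in finite-dimensional inner product spaces\<close>

text \<open>The bracket relations act on pairs of components. For \<open>X = X1 + ... + Xk\<close>
  the terms of \<open>[X, A X]\<close> with indices \<open>i < j\<close> combine to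
  \<open>(x j - x i) [Xi, Xj]\<close>, so at most the pair (1, 2) survives. The element
  \<open>W\<close> attached to a multiple of \<open>X1\<close> cancels this remainder, because it
  sees \<open>A X\<close> only through \<open>X2\<close>. The geometry is shaped by the fact that
  metrics and the geodesic equation are given in charts, with lowered index. Uniqueness of geodesics
  is therefore obtained without solving for the acceleration, from coercivity of the metric and a
  Gronwall estimate. Noether's argument becomes a computation with a two-parameter variation: left
  translations of the orbit keep the energy constant in \<open>s\<close>, constancy of the momentum
  in \<open>t\<close> is the hypothesis, and symmetry of second derivatives removes the mixed terms.
  Differentiability of the action on the quotient descends from the group along the submersion
  \<open>proj\<close>. Velocities are compared by writing them as translates of vectors at the base
  point, where the metric is known.\<close>

lemma orthonormal_basis_exists:
  "\<exists>B::'a::{real_inner,heine_borel} set. finite B \<and>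
     (\<forall>x\<in>B. \<forall>y\<in>B. x \<bullet> y = (if x = y then 1 else 0)) \<and> (\<forall>x. x = (\<Sum>b\<in>B. (x \<bullet> b) *\<^sub>R b))"
proof -
  \<comment> \<open>Finite dimension enters here: the unit ball is totally bounded, so every unit
    vector has distance less than 1 from some point of a finite set \<open>F\<close>. A unit vector
    orthogonal to \<open>F\<close> would have distance at least 1 from each of its points by
    Pythagoras, so the orthogonalized \<open>F\<close> spans the space.\<close>
  obtain F :: "'a set" where F: "finite F" "cball 0 1 \<subseteq> (\<Union>x\<in>F. ball x 1)"
    using compact_imp_seq_compact[OF compact_cball, of "0::'a" 1] seq_compact_imp_totally_bounded
    by (metis zero_less_one)
  obtain C where C: "finite C" "span C = span F" "pairwise orthogonal C"
    using basis_orthogonal[OF F(1)] by blast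
  define B where "B = sgn ` (C - {0})"
  have B: "finite B" using C by (simp add: B_def)
  have on: "x \<bullet> y = (if x = y then 1 else 0)" if xy: "x \<in> B" "y \<in> B" for x y
  proof -
    obtain c d where cd: "x = sgn c" "y = sgn d" "c \<in> C" "d \<in> C" "c \<noteq> 0" "d \<noteq> 0"
      using xy unfolding B_def by blast
    have 1: "x \<bullet> x = 1" using cd by (simp add: dot_square_norm norm_sgn)
    show ?thesis
    proof (cases "c = d")
      case True then show ?thesis using 1 cd by simp
    next
      case False
      then have "c \<bullet> d = 0" using C(3) cd by (auto simp: pairwise_def orthogonal_def)
      then have "x \<bullet> y = 0" by (simp add: cd sgn_div_norm)
      then show ?thesis using 1 by auto
    qed
  qed
  have exp: "x = (\<Sum>b\<in>B. (x \<bullet> b) *\<^sub>R b)" for x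
  proof (rule ccontr)
    define z where "z = x - (\<Sum>b\<in>B. (x \<bullet> b) *\<^sub>R b)"
    assume "x \<noteq> (\<Sum>b\<in>B. (x \<bullet> b) *\<^sub>R b)"
    then have z: "z \<noteq> 0" by (simp add: z_def)
    have zb: "z \<bullet> b = 0" if "b \<in> B" for b
    proof -
      have "(\<Sum>c\<in>B. (x \<bullet> c) * (c \<bullet> b)) = (\<Sum>c\<in>B. if c = b then x \<bullet> c else 0)"
        by (rule sum.cong) (auto simp: on that)
      then show ?thesis using B that
        by (simp add: z_def inner_diff_left inner_sum_left)
    qed
    have zc: "z \<bullet> c = 0" if "c \<in> C" for c
    proof (cases "c = 0")
      case False
      then have "z \<bullet> sgn c = 0" using zb that by (auto simp: B_def)
      then show ?thesis using False by (simp add: sgn_div_norm)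
    qed simp
    have zF: "z \<bullet> f = 0" if "f \<in> span C" for f
      using that by (induction rule: span_induct) (auto simp: zc subspace_def inner_right_distrib)
    have "sgn z \<in> cball 0 1" by (simp add: norm_sgn)
    then obtain f where f: "f \<in> F" "dist f (sgn z) < 1" using F(2) by auto
    have "z \<bullet> f = 0" using zF C(2) f span_base by metis
    then have "sgn z \<bullet> f = 0" by (simp add: sgn_div_norm)
    then have "(norm (f - sgn z))\<^sup>2 = (norm f)\<^sup>2 + 1" using z
      by (simp add: power2_norm_eq_inner inner_diff_left inner_diff_right inner_commute)
         (simp add: dot_square_norm norm_sgn)
    then have "(norm (f - sgn z))\<^sup>2 \<ge> 1" by simp
    moreover have "(norm (f - sgn z))\<^sup>2 < 1" using f
      by (simp add: dist_norm abs_square_less_1)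
    ultimately show False by simp
  qed
  show ?thesis using B on exp by blast
qed

text \<open>Takes the role of \<open>Basis\<close>; in dimension zero it is the empty set.\<close>

definition onb :: "'a::{real_inner,heine_borel} set" where
  "onb = (SOME B. finite B \<and>
     (\<forall>x\<in>B. \<forall>y\<in>B. x \<bullet> y = (if x = y then 1 else 0)) \<and> (\<forall>x. x = (\<Sum>b\<in>B. (x \<bullet> b) *\<^sub>R b)))"

lemma finite_onb [simp]: "finite (onb :: 'a::{real_inner,heine_borel} set)"
  and inner_onb: "(x::'a) \<in> onb \<Longrightarrow> y \<in> onb \<Longrightarrow> x \<bullet> y = (if x = y then 1 else 0)"
  and onb_expansion: "(\<Sum>b\<in>onb. (z \<bullet> b) *\<^sub>R b) = (z::'a)"
proof -
  note * = someI_ex[OF orthonormal_basis_exists, folded onb_def]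
  show "finite (onb :: 'a set)" using * by blast
  show "x \<in> onb \<Longrightarrow> y \<in> onb \<Longrightarrow> x \<bullet> y = (if x = y then 1 else 0)" using * by blast
  show "(\<Sum>b\<in>onb. (z \<bullet> b) *\<^sub>R b) = (z::'a)" using * by metis
qed

lemma norm_onb: "b \<in> onb \<Longrightarrow> norm b = 1"
  using inner_onb[of b b] by (simp add: norm_eq_1)

lemma linear_onb_expansion:
  fixes f :: "'a::{real_inner,heine_borel} \<Rightarrow> 'b::real_vector"
  assumes "linear f"
  shows "(\<Sum>b\<in>onb. (z \<bullet> b) *\<^sub>R f b) = f z"
proof -
  have "f (\<Sum>b\<in>onb. (z \<bullet> b) *\<^sub>R b) = (\<Sum>b\<in>onb. (z \<bullet> b) *\<^sub>R f b)"
    using assms by (simp add: linear_sum linear_scale)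
  then show ?thesis by (simp add: onb_expansion)
qed

lemma linear_bounded_linear:
  fixes f :: "'a::{real_inner,heine_borel} \<Rightarrow> 'b::real_normed_vector"
  assumes "linear f"
  shows "bounded_linear f"
proof -
  have "bounded_linear (\<lambda>z. \<Sum>b\<in>onb. (z \<bullet> b) *\<^sub>R f b)"
    by (intro bounded_linear_sum bounded_linear_scaleR_const bounded_linear_inner_left)
  then show ?thesis by (simp add: linear_onb_expansion[OF assms])
qed

lemma onb_eqI:
  fixes x y :: "'a::{real_inner,heine_borel}"
  assumes "\<And>b. b \<in> onb \<Longrightarrow> x \<bullet> b = y \<bullet> b"
  shows "x = y"
proof -
  have "(\<Sum>b\<in>onb. (x \<bullet> b) *\<^sub>R b) = (\<Sum>b\<in>onb. (y \<bullet> b) *\<^sub>R b)"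
    by (rule sum.cong) (auto simp: assms)
  then show ?thesis by (simp add: onb_expansion)
qed

subsection \<open>Smooth functions\<close>

abbreviation fderiv :: "('a::real_normed_vector \<Rightarrow> 'b::real_normed_vector) \<Rightarrow> 'a \<Rightarrow> 'a \<Rightarrow> 'b" where
  "fderiv f x \<equiv> frechet_derivative f (at x)"

lemma diff_on_SucD:
  assumes "diff_on (Suc n) S f" "x \<in> S"
  shows "(f has_derivative fderiv f x) (at x)"
  using assms by (simp add: frechet_derivative_works)

lemma diff_on_cong:
  assumes "open S" "\<And>x. x \<in> S \<Longrightarrow> f x = g x" "diff_on n S f"
  shows "diff_on n S g"
  using assms(2,3)
proof (induction n arbitrary: f g)
  case 0
  then show ?case using continuous_on_cong by (simp add: continuous_on_eq)
next
  case (Suc n)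
  have der: "(g has_derivative fderiv f x) (at x)" if "x \<in> S" for x
    using has_derivative_transform_within_open[OF diff_on_SucD[OF Suc.prems(2) that] assms(1) that]
      Suc.prems(1) by simp
  then have "fderiv g x = fderiv f x" if "x \<in> S" for x
    using frechet_derivative_at that by metis
  then have "diff_on n S (\<lambda>x. fderiv g x v)" for v
    using Suc.IH[of "\<lambda>x. fderiv f x v" "\<lambda>x. fderiv g x v"] Suc.prems(2)
    by simp
  then show ?case using der by (auto simp: differentiable_def)
qed

text \<open>\<open>frechet_derivative\<close> is a choice, but derivatives are unique, so any
  explicit derivative \<open>f'\<close> may replace it on an open set. The closure properties below
  exhibit such an \<open>f'\<close> and recurse on it direction by direction.\<close>

lemma diff_on_SucI:
  assumes "open S" "\<And>x. x \<in> S \<Longrightarrow> (f has_derivative f' x) (at x)" "\<And>v. diff_on n S (\<lambda>x. f' x v)"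
  shows "diff_on (Suc n) S f"
proof -
  have "fderiv f x = f' x" if "x \<in> S" for x
    using frechet_derivative_at assms(2) that by metis
  then have "diff_on n S (\<lambda>x. fderiv f x v)" for v
    using diff_on_cong[OF assms(1) _ assms(3)[of v]] by simp
  then show ?thesis using assms(2) by (auto simp: differentiable_def)
qed

lemma diff_on_Suc_imp: "diff_on (Suc n) S f \<Longrightarrow> diff_on n S f"
proof (induction n arbitrary: f)
  case 0
  then have "\<forall>x\<in>S. f differentiable (at x within S)"
    by (auto intro: differentiable_at_withinI)
  then show ?case by (simp add: differentiable_imp_continuous_on differentiable_on_def)
next
  case (Suc n)
  from Suc.prems have "\<forall>x\<in>S. f differentiable (at x)"
    "\<forall>v. diff_on (Suc n) S (\<lambda>x. fderiv f x v)" by simp_all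
  with Suc.IH show ?case by simp
qed

lemma diff_on_subset: "diff_on n S f \<Longrightarrow> R \<subseteq> S \<Longrightarrow> diff_on n R f"
  by (induction n arbitrary: f) (auto intro: continuous_on_subset)

lemma diff_on_local:
  assumes "\<And>x. x \<in> S \<Longrightarrow> \<exists>N. open N \<and> x \<in> N \<and> diff_on n N f"
  shows "diff_on n S f"
  using assms
proof (induction n arbitrary: f)
  case 0
  have "isCont f x" if "x \<in> S" for x
    using 0[OF that] continuous_on_eq_continuous_at by (metis diff_on.simps(1))
  then show ?case by (simp add: continuous_at_imp_continuous_on)
next
  case (Suc n)
  have "diff_on n S (\<lambda>x. fderiv f x v)" for v
  proof (rule Suc.IH)
    fix x assume "x \<in> S"
    with Suc.prems obtain N where "open N" "x \<in> N" "diff_on (Suc n) N f" by blast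
    then show "\<exists>N. open N \<and> x \<in> N \<and> diff_on n N (\<lambda>x. fderiv f x v)"
      by auto
  qed
  moreover have "\<forall>x\<in>S. f differentiable (at x)" using Suc.prems by (meson diff_on.simps(2))
  ultimately show ?case by simp
qed

lemma diff_on_const: "diff_on n S (\<lambda>x. c)"
  by (induction n arbitrary: c) auto

lemma diff_on_linear:
  assumes "bounded_linear f" shows "diff_on n S f"
proof (cases n)
  case 0 then show ?thesis using assms by (simp add: linear_continuous_on)
next
  case (Suc m)
  have "(f has_derivative f) (at x)" for x using assms by (rule bounded_linear_imp_has_derivative)
  then have "diff_on (Suc m) UNIV f"
    by (intro diff_on_SucI[where f' = "\<lambda>x. f"] diff_on_const) auto
  then show ?thesis using diff_on_subset Suc by blast
qed

lemma diff_on_compose_linear: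
  assumes "open S" "bounded_linear L" "diff_on n S f"
  shows "diff_on n S (\<lambda>x. L (f x))"
  using assms(3)
proof (induction n arbitrary: f)
  case 0
  then show ?case using bounded_linear.continuous_on[OF assms(2)] by auto
next
  case (Suc n)
  show ?case
  proof (rule diff_on_SucI[OF assms(1)])
    show "((\<lambda>x. L (f x)) has_derivative (\<lambda>v. L (fderiv f x v))) (at x)"
      if "x \<in> S" for x
      using bounded_linear.has_derivative[OF assms(2) diff_on_SucD[OF Suc.prems that]] .
    show "diff_on n S (\<lambda>x. L (fderiv f x v))" for v
      using Suc by simp
  qed
qed

lemma diff_on_add:
  assumes "open S" "diff_on n S f" "diff_on n S g"
  shows "diff_on n S (\<lambda>x. f x + g x)"
  using assms(2,3)
proof (induction n arbitrary: f g)
  case 0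
  then show ?case by (auto intro: continuous_intros)
next
  case (Suc n)
  show ?case
  proof (rule diff_on_SucI[OF assms(1)])
    show "((\<lambda>x. f x + g x) has_derivative (\<lambda>v. fderiv f x v + fderiv g x v)) (at x)"
      if "x \<in> S" for x
      using has_derivative_add diff_on_SucD Suc.prems that by blast
    show "diff_on n S (\<lambda>x. fderiv f x v + fderiv g x v)" for v
      using Suc by simp
  qed
qed

lemma diff_on_sum:
  assumes "open S" "\<And>i. i \<in> I \<Longrightarrow> diff_on n S (f i)"
  shows "diff_on n S (\<lambda>x. \<Sum>i\<in>I. f i x)"
  using assms(2)
  by (induction I rule: infinite_finite_induct) (auto intro: diff_on_add[OF assms(1)] diff_on_const)

lemma diff_on_bilinear:
  assumes "open S" "bounded_bilinear B" "diff_on n S f" "diff_on n S g"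
  shows "diff_on n S (\<lambda>x. B (f x) (g x))"
  using assms(3,4)
proof (induction n arbitrary: f g)
  case 0
  then show ?case using bounded_bilinear.continuous_on[OF assms(2)] by auto
next
  case (Suc n)
  show ?case
  proof (rule diff_on_SucI[OF assms(1)])
    show "((\<lambda>x. B (f x) (g x)) has_derivative (\<lambda>v. B (f x) (fderiv g x v) +
        B (fderiv f x v) (g x))) (at x)" if "x \<in> S" for x
      by (rule bounded_bilinear.FDERIV[OF assms(2) diff_on_SucD[OF Suc.prems(1) that] diff_on_SucD[OF Suc.prems(2) that]])
    show "diff_on n S (\<lambda>x. B (f x) (fderiv g x v) +
        B (fderiv f x v) (g x))" for v
      using Suc.prems diff_on_Suc_imp[OF Suc.prems(1)] diff_on_Suc_imp[OF Suc.prems(2)]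
      by (intro diff_on_add[OF assms(1)] Suc.IH) auto
  qed
qed

text \<open>\<open>diff_on\<close> speaks of derivatives in constant directions, whereas the chain
  rule produces the moving direction \<open>?f' x v\<close>. Expanding it in \<open>onb\<close>
  leaves derivatives of \<open>g\<close> in constant directions with scalar coefficients, to which
  the induction hypothesis and the product rule apply.\<close>

lemma diff_on_compose:
  fixes g :: "'b::{real_inner,heine_borel} \<Rightarrow> 'c::real_normed_vector"
  assumes "open S" "open R" "diff_on n R g" "diff_on n S f" "f ` S \<subseteq> R"
  shows "diff_on n S (\<lambda>x. g (f x))"
  using assms(3,4)
proof (induction n arbitrary: g)
  case 0
  then show ?case using assms(5) by (auto intro: continuous_on_compose2)
next
  case (Suc n)
  let ?f' = "\<lambda>x. fderiv f x" and ?g' = "\<lambda>x. fderiv g x"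
  show ?case
  proof (rule diff_on_SucI[OF assms(1)])
    show "((\<lambda>x. g (f x)) has_derivative (\<lambda>v. \<Sum>b\<in>onb. (?f' x v \<bullet> b) *\<^sub>R ?g' (f x) b)) (at x)"
      if "x \<in> S" for x
    proof -
      have fx: "f x \<in> R" using assms(5) that by auto
      have lin: "linear (?g' (f x))"
        using diff_on_SucD[OF Suc.prems(1) fx] has_derivative_linear by blast
      show ?thesis
        using diff_chain_at[OF diff_on_SucD[OF Suc.prems(2) that] diff_on_SucD[OF Suc.prems(1) fx]]
        by (simp add: linear_onb_expansion[OF lin] o_def)
    qed
    show "diff_on n S (\<lambda>x. \<Sum>b\<in>onb. (?f' x v \<bullet> b) *\<^sub>R ?g' (f x) b)" for v
    proof (intro diff_on_sum assms(1) diff_on_bilinear[OF _ bounded_bilinear_scaleR])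
      fix b :: 'b
      show "diff_on n S (\<lambda>x. ?f' x v \<bullet> b)" using Suc.prems(2)
        by (intro diff_on_bilinear[OF _ bounded_bilinear_inner] assms(1) diff_on_const) simp
      show "diff_on n S (\<lambda>x. ?g' (f x) b)"
        using Suc.prems diff_on_Suc_imp[OF Suc.prems(2)] by (intro Suc.IH) auto
    qed
  qed
qed

lemma smooth_on_derivative:
  assumes "smooth_on S f" "x \<in> S"
  shows "(f has_derivative fderiv f x) (at x)"
  using assms diff_on_SucD unfolding smooth_on_def by blast

lemma smooth_on_cong:
  "open S \<Longrightarrow> (\<And>x. x \<in> S \<Longrightarrow> f x = g x) \<Longrightarrow> smooth_on S f \<Longrightarrow> smooth_on S g"
  unfolding smooth_on_def using diff_on_cong by blast

lemma smooth_on_subset: "smooth_on S f \<Longrightarrow> R \<subseteq> S \<Longrightarrow> smooth_on R f"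
  unfolding smooth_on_def using diff_on_subset by blast

lemma smooth_on_local:
  "(\<And>x. x \<in> S \<Longrightarrow> \<exists>N. open N \<and> x \<in> N \<and> smooth_on N f) \<Longrightarrow> smooth_on S f"
  unfolding smooth_on_def using diff_on_local by meson

lemma smooth_on_const: "smooth_on S (\<lambda>x. c)"
  by (simp add: smooth_on_def diff_on_const)

lemma smooth_on_linear: "bounded_linear f \<Longrightarrow> smooth_on S f"
  by (simp add: smooth_on_def diff_on_linear)

lemma smooth_on_compose_linear:
  "open S \<Longrightarrow> bounded_linear L \<Longrightarrow> smooth_on S f \<Longrightarrow> smooth_on S (\<lambda>x. L (f x))"
  by (simp add: smooth_on_def diff_on_compose_linear)

lemma smooth_on_add:
  "open S \<Longrightarrow> smooth_on S f \<Longrightarrow> smooth_on S g \<Longrightarrow> smooth_on S (\<lambda>x. f x + g x)"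
  by (simp add: smooth_on_def diff_on_add)

lemma smooth_on_sum:
  "open S \<Longrightarrow> (\<And>i. i \<in> I \<Longrightarrow> smooth_on S (f i)) \<Longrightarrow> smooth_on S (\<lambda>x. \<Sum>i\<in>I. f i x)"
  by (simp add: smooth_on_def diff_on_sum)

lemma smooth_on_bilinear:
  "open S \<Longrightarrow> bounded_bilinear B \<Longrightarrow> smooth_on S f \<Longrightarrow> smooth_on S g \<Longrightarrow> smooth_on S (\<lambda>x. B (f x) (g x))"
  by (simp add: smooth_on_def diff_on_bilinear)

lemmas smooth_on_scaleR = smooth_on_bilinear[OF _ bounded_bilinear_scaleR]
lemmas smooth_on_mult = smooth_on_bilinear[OF _ bounded_bilinear_mult]
lemmas smooth_on_inner = smooth_on_bilinear[OF _ bounded_bilinear_inner]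

lemma smooth_on_compose:
  fixes g :: "'b::{real_inner,heine_borel} \<Rightarrow> 'c::real_normed_vector"
  shows "open S \<Longrightarrow> open R \<Longrightarrow> smooth_on R g \<Longrightarrow> smooth_on S f \<Longrightarrow> f ` S \<subseteq> R
    \<Longrightarrow> smooth_on S (\<lambda>x. g (f x))"
  by (simp add: smooth_on_def diff_on_compose)

lemma smooth_on_Pair:
  assumes "open S" "smooth_on S f" "smooth_on S g"
  shows "smooth_on S (\<lambda>x. (f x, g x))"
proof -
  have "smooth_on S (\<lambda>x. (f x, 0) + (0, g x))"
    using assms
    by (intro smooth_on_add smooth_on_compose_linear[where L = "\<lambda>x. (x, 0)"]
        smooth_on_compose_linear[where L = "\<lambda>x. (0, x)"])
       (auto intro!: bounded_linear_Pair bounded_linear_ident bounded_linear_zero)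
  then show ?thesis by simp
qed

lemma smooth_on_continuous: "smooth_on S f \<Longrightarrow> continuous_on S f"
  unfolding smooth_on_def by (metis diff_on.simps(1))

text \<open>Base point and direction may both vary; the expansion of the direction in
  \<open>onb\<close> reduces this to constant directions. Smooth dependence of left invariant
  fields, of \<open>Ad\<close> and of Christoffel symbols is read off from this lemma.\<close>

lemma smooth_on_frechet_derivative:
  fixes f :: "'a::{real_inner,heine_borel} \<Rightarrow> 'b::real_normed_vector"
  assumes "open S" "open R" "smooth_on R f" "smooth_on S p" "p ` S \<subseteq> R" "smooth_on S v"
  shows "smooth_on S (\<lambda>x. fderiv f (p x) (v x))"
proof -
  have "smooth_on S (\<lambda>x. \<Sum>b\<in>onb. (v x \<bullet> b) *\<^sub>R fderiv f (p x) b)"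
  proof (intro smooth_on_sum smooth_on_scaleR assms(1) smooth_on_inner assms(6) smooth_on_const)
    fix b :: 'a
    have "smooth_on R (\<lambda>x. fderiv f x b)"
      unfolding smooth_on_def
    proof
      fix n
      have "diff_on (Suc n) R f" using assms(3) by (simp only: smooth_on_def)
      then show "diff_on n R (\<lambda>x. fderiv f x b)" by simp
    qed
    then show "smooth_on S (\<lambda>x. fderiv f (p x) b)"
      by (rule smooth_on_compose[OF assms(1,2) _ assms(4,5), where g = "\<lambda>x. fderiv f x b"])
  qed
  moreover have "(\<Sum>b\<in>onb. (v x \<bullet> b) *\<^sub>R fderiv f (p x) b) = fderiv f (p x) (v x)"
    if "x \<in> S" for x
  proof -
    have "linear (fderiv f (p x))"
      using assms(5) that by (intro has_derivative_linear[OF smooth_on_derivative[OF assms(3)]]) auto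
    then show ?thesis by (rule linear_onb_expansion)
  qed
  ultimately show ?thesis by (rule smooth_on_cong[OF assms(1), rotated])
qed

lemma smooth_on_vector_derivative:
  fixes f :: "real \<Rightarrow> 'b::real_normed_vector"
  assumes "smooth_on S f" "t \<in> S"
  shows "(f has_vector_derivative vector_derivative f (at t)) (at t)"
  using smooth_on_derivative[OF assms] differentiable_def vector_derivative_works by blast

lemma frechet_derivative_real:
  fixes f :: "real \<Rightarrow> 'b::real_normed_vector"
  assumes "(f has_vector_derivative d) (at t)"
  shows "fderiv f t v = v *\<^sub>R d"
  using frechet_derivative_at[of f "\<lambda>h. h *\<^sub>R d" t] assms unfolding has_vector_derivative_def by metis

lemma smooth_on_vector_derivative_smooth:
  fixes f :: "real \<Rightarrow> 'b::real_normed_vector"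
  assumes "open S" "smooth_on S f"
  shows "smooth_on S (\<lambda>t. vector_derivative f (at t))"
proof -
  have "smooth_on S (\<lambda>t. fderiv f t 1)"
    by (rule smooth_on_frechet_derivative[OF assms(1,1,2), where p = "\<lambda>x. x" and v = "\<lambda>_. 1"])
       (simp_all add: smooth_on_linear[OF bounded_linear_ident] smooth_on_const)
  then show ?thesis
    by (rule smooth_on_cong[OF assms(1), rotated])
       (simp add: frechet_derivative_real[OF smooth_on_vector_derivative[OF assms(2)]])
qed

lemma smooth_on_directional_derivative:
  fixes f :: "'a::{real_inner,heine_borel} \<Rightarrow> 'b::real_normed_vector"
  assumes "open S" "smooth_on S f"
  shows "smooth_on S (\<lambda>x. fderiv f x v)"
  by (rule smooth_on_frechet_derivative[OF assms(1,1,2), where p = "\<lambda>x. x" and v = "\<lambda>_. v"])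
     (simp_all add: smooth_on_linear[OF bounded_linear_ident] smooth_on_const)

text \<open>The sum over \<open>onb\<close> dominates the operator norm and is continuous in the
  point, so a strict bound at \<open>x0\<close> persists on a small ball, where the mean value
  inequality applies. The constant stays explicit because the local inverse further on needs the
  contraction factor 1/2.\<close>

lemma smooth_on_Lipschitz_bound:
  fixes f :: "'a::{real_inner,heine_borel} \<Rightarrow> 'b::real_normed_vector"
  assumes "open S" "smooth_on S f" "x0 \<in> S" "(\<Sum>b\<in>onb. norm (fderiv f x0 b)) < L"
  obtains r where "r > 0" "cball x0 r \<subseteq> S"
    "\<And>x y. x \<in> cball x0 r \<Longrightarrow> y \<in> cball x0 r \<Longrightarrow> norm (f x - f y) \<le> L * norm (x - y)"
proof -
  let ?K = "\<lambda>x. \<Sum>b\<in>onb. norm (fderiv f x b)"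
  have "continuous_on S ?K"
    by (intro continuous_intros smooth_on_continuous[OF smooth_on_directional_derivative[OF assms(1,2)]])
  then have "open (S \<inter> ?K -` {..<L})"
    by (rule continuous_open_preimage[OF _ assms(1) open_lessThan])
  moreover have "x0 \<in> S \<inter> ?K -` {..<L}" using assms(3,4) by simp
  ultimately obtain r where r: "r > 0" "cball x0 r \<subseteq> S \<inter> ?K -` {..<L}"
    using open_contains_cball by blast
  have L: "L \<ge> 0" using assms(4) sum_nonneg[of onb "\<lambda>b. norm (fderiv f x0 b)"] by simp
  have on: "onorm (fderiv f x) \<le> L" if x: "x \<in> cball x0 r" for x
  proof (rule onorm_bound[OF L])
    fix v
    have "linear (fderiv f x)"
      using r x by (intro has_derivative_linear[OF smooth_on_derivative[OF assms(2)]]) auto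
    then have "norm (fderiv f x v) = norm (\<Sum>b\<in>onb. (v \<bullet> b) *\<^sub>R fderiv f x b)"
      by (simp add: linear_onb_expansion)
    also have "\<dots> \<le> (\<Sum>b\<in>onb. norm v * norm (fderiv f x b))"
    proof (rule sum_norm_le)
      fix b :: 'a assume b: "b \<in> onb"
      have "\<bar>v \<bullet> b\<bar> \<le> norm v" using Cauchy_Schwarz_ineq2[of v b] norm_onb[OF b] by simp
      then show "norm ((v \<bullet> b) *\<^sub>R fderiv f x b) \<le> norm v * norm (fderiv f x b)"
        by (simp add: mult_right_mono)
    qed
    also have "\<dots> = ?K x * norm v" by (simp add: sum_distrib_left mult.commute)
    also have "\<dots> \<le> L * norm v" using r x by (intro mult_right_mono) auto
    finally show "norm (fderiv f x v) \<le> L * norm v" .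
  qed
  show ?thesis
  proof (rule that[OF r(1)])
    show "cball x0 r \<subseteq> S" using r by auto
    fix x y assume "x \<in> cball x0 r" "y \<in> cball x0 r"
    then show "norm (f x - f y) \<le> L * norm (x - y)"
      using r by (intro differentiable_bound[OF convex_cball has_derivative_at_withinI[OF smooth_on_derivative[OF assms(2)]] on]) auto
  qed
qed

lemma smooth_on_Lipschitz:
  fixes f :: "'a::{real_inner,heine_borel} \<Rightarrow> 'b::real_normed_vector"
  assumes "open S" "smooth_on S f" "x0 \<in> S"
  obtains r L where "r > 0" "cball x0 r \<subseteq> S" "L > 0"
    "\<And>x y. x \<in> cball x0 r \<Longrightarrow> y \<in> cball x0 r \<Longrightarrow> norm (f x - f y) \<le> L * norm (x - y)"
proof -
  define K where "K = (\<Sum>b\<in>onb. norm (fderiv f x0 b))"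
  have "K \<ge> 0" unfolding K_def by (intro sum_nonneg) simp
  then show ?thesis
    using smooth_on_Lipschitz_bound[OF assms, of "K + 1", folded K_def] that[of _ "K + 1"] by auto
qed

subsection \<open>Ordinary differential equations\<close>

lemma vector_derivative_bound:
  fixes w :: "real \<Rightarrow> 'a::real_normed_vector"
  assumes "convex J" "\<And>t. t \<in> J \<Longrightarrow> (w has_vector_derivative w' t) (at t within J)"
    "\<And>t. t \<in> J \<Longrightarrow> norm (w' t) \<le> K" "s \<in> J" "t \<in> J"
  shows "norm (w s - w t) \<le> K * \<bar>s - t\<bar>"
proof -
  have "0 \<le> K" using assms(3,4) norm_ge_zero order_trans by blast
  then have "norm (w s - w t) \<le> K * norm (s - t)"
    using assms by (intro differentiable_bound[where f' = "\<lambda>t h. h *\<^sub>R w' t"] onorm_bound)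
      (auto simp: has_vector_derivative_def mult.commute[of K] mult_left_mono)
  then show ?thesis by simp
qed

text \<open>The squared norm times \<open>exp (- 2 * L * t)\<close> is nonincreasing, and times
  \<open>exp (2 * L * t)\<close> it is nondecreasing. As it vanishes at \<open>t0\<close>, the first
  gives a nonpositive value to the right of \<open>t0\<close>, the second to the left.\<close>

lemma gronwall_zero:
  fixes w :: "real \<Rightarrow> 'a::real_inner"
  assumes "convex J" "t0 \<in> J" "w t0 = 0"
    and der: "\<And>t. t \<in> J \<Longrightarrow> (w has_vector_derivative w' t) (at t)"
    and le: "\<And>t. t \<in> J \<Longrightarrow> norm (w' t) \<le> L * norm (w t)"
    and "t \<in> J"
  shows "w t = 0"
proof -
  have dd: "((\<lambda>s. (w s \<bullet> w s) * exp (c * s)) has_real_derivative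
      (2 * (w s \<bullet> w' s) + c * (w s \<bullet> w s)) * exp (c * s)) (at s)" if "s \<in> J" for s c
    unfolding has_real_derivative_iff_has_vector_derivative
    by (rule has_vector_derivative_eq_rhs,
        rule has_vector_derivative_mult[OF bounded_bilinear.has_vector_derivative[OF bounded_bilinear_inner der der]
          , where g="\<lambda>s. exp (c * s)" and g' = "exp (c * s) * c"])
       (auto simp: that algebra_simps inner_commute has_real_derivative_iff_has_vector_derivative[symmetric]
         intro!: derivative_eq_intros)
  have ws: "\<bar>w s \<bullet> w' s\<bar> \<le> L * (w s \<bullet> w s)" if "s \<in> J" for s
  proof -
    have "\<bar>w s \<bullet> w' s\<bar> \<le> norm (w s) * norm (w' s)" by (rule Cauchy_Schwarz_ineq2)
    also have "\<dots> \<le> norm (w s) * (L * norm (w s))" using le[OF that] by (intro mult_left_mono) auto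
    finally show ?thesis by (simp add: dot_square_norm power2_eq_square mult_ac)
  qed
  have seg: "s \<in> J" if "min t0 t \<le> s" "s \<le> max t0 t" for s
  proof -
    have "is_interval J" using \<open>convex J\<close> is_interval_convex_1 by blast
    moreover have "min t0 t \<in> J" "max t0 t \<in> J" using assms(2,6) by (auto simp: min_def max_def)
    ultimately show ?thesis using that by (rule mem_is_interval_1_I)
  qed
  have "(w t \<bullet> w t) \<le> 0"
  proof (cases "t0 \<le> t")
    case True
    have "(w t \<bullet> w t) * exp (- 2 * L * t) \<le> (w t0 \<bullet> w t0) * exp (- 2 * L * t0)"
    proof (rule DERIV_nonpos_imp_nonincreasing[OF True])
      fix s assume "t0 \<le> s" "s \<le> t"
      then have s: "s \<in> J" using seg True by simp
      have "(2 * (w s \<bullet> w' s) + (- 2 * L) * (w s \<bullet> w s)) * exp (- 2 * L * s) \<le> 0"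
        using ws[OF s] by (intro mult_nonpos_nonneg) auto
      then show "\<exists>y. ((\<lambda>s. (w s \<bullet> w s) * exp (- 2 * L * s)) has_real_derivative y) (at s) \<and> y \<le> 0"
        using dd[OF s, of "- 2 * L"] by blast
    qed
    then show ?thesis using assms(3) by (simp add: mult_le_0_iff)
  next
    case False
    have "(w t \<bullet> w t) * exp (2 * L * t) \<le> (w t0 \<bullet> w t0) * exp (2 * L * t0)"
    proof (rule DERIV_nonneg_imp_nondecreasing[where f = "\<lambda>s. (w s \<bullet> w s) * exp (2 * L * s)"])
      fix s assume "t \<le> s" "s \<le> t0"
      then have s: "s \<in> J" using seg False by simp
      have "(2 * (w s \<bullet> w' s) + (2 * L) * (w s \<bullet> w s)) * exp (2 * L * s) \<ge> 0"
        using ws[OF s] by (intro mult_nonneg_nonneg) auto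
      then show "\<exists>y. ((\<lambda>s. (w s \<bullet> w s) * exp (2 * L * s)) has_real_derivative y) (at s) \<and> 0 \<le> y"
        using dd[OF s, of "2 * L"] by blast
    qed (use False in simp)
    then show ?thesis using assms(3) by (simp add: mult_le_0_iff)
  qed
  then show ?thesis by (metis antisym inner_eq_zero_iff inner_ge_zero)
qed

lemma antiderivative_exists:
  fixes f :: "real \<Rightarrow> 'a::{real_inner,heine_borel}"
  assumes "continuous_on {a..b} f"
  obtains g where "\<And>x. x \<in> {a..b} \<Longrightarrow> (g has_vector_derivative f x) (at x within {a..b})"
proof -
  have "\<exists>g. \<forall>x\<in>{a..b}. (g has_vector_derivative (f x \<bullet> c)) (at x within {a..b})" for c
  proof -
    have "continuous_on {a..b} (\<lambda>x. f x \<bullet> c)" using assms by (intro continuous_intros)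
    then show ?thesis using antiderivative_continuous by metis
  qed
  then obtain G where G: "\<And>c x. x \<in> {a..b} \<Longrightarrow> (G c has_vector_derivative (f x \<bullet> c)) (at x within {a..b})"
    by metis
  have "((\<lambda>x. \<Sum>c\<in>onb. G c x *\<^sub>R c) has_vector_derivative f x) (at x within {a..b})" if "x \<in> {a..b}" for x
  proof -
    have "((\<lambda>x. \<Sum>c\<in>onb. G c x *\<^sub>R c) has_vector_derivative (\<Sum>c\<in>onb. (f x \<bullet> c) *\<^sub>R c)) (at x within {a..b})"
      by (intro has_vector_derivative_sum bounded_linear.has_vector_derivative[OF bounded_linear_scaleR_left] G that)
    then show ?thesis by (simp add: onb_expansion)
  qed
  then show ?thesis using that by blast
qed

text \<open>Picard iteration through the Banach fixed point theorem; the integral operator is an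
  antiderivative of \<open>f (u t)\<close> normalized to the value \<open>x0\<close> at 0.\<close>

lemma ode_exists:
  fixes f :: "'a::{real_inner,heine_borel} \<Rightarrow> 'a"
  assumes "open S" "smooth_on S f" "x0 \<in> S"
  obtains \<epsilon> u where "\<epsilon> > 0" "u 0 = x0"
    "\<And>t. \<bar>t\<bar> < \<epsilon> \<Longrightarrow> u t \<in> S \<and> (u has_vector_derivative f (u t)) (at t)"
proof -
  obtain r L where r: "r > 0" "cball x0 r \<subseteq> S" and L: "L > 0"
    and lip: "\<And>x y. x \<in> cball x0 r \<Longrightarrow> y \<in> cball x0 r \<Longrightarrow> norm (f x - f y) \<le> L * norm (x - y)"
    using smooth_on_Lipschitz[OF assms] by metis
  \<comment> \<open>\<open>M\<close> bounds \<open>f\<close> on the ball. In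
    \<open>\<epsilon>\<close>, the entry \<open>r / M\<close> keeps the iterates in the ball, and
    \<open>1 / (2 * L)\<close> makes the Picard operator a contraction with factor 1/2.\<close>
  define M where "M = norm (f x0) + L * r + 1"
  have M: "M > 0" using r L by (simp add: M_def add_nonneg_pos)
  have fM: "norm (f x) \<le> M" if "x \<in> cball x0 r" for x
  proof -
    have "norm (f x - f x0) \<le> L * norm (x - x0)" using lip that r by simp
    also have "\<dots> \<le> L * r" using that L by (intro mult_left_mono) (auto simp: dist_norm norm_minus_commute)
    finally show ?thesis unfolding M_def using norm_triangle_ineq2[of "f x" "f x0"] by linarith
  qed
  define \<epsilon> where "\<epsilon> = min (r / M) (1 / (2 * L))"
  have e: "\<epsilon> > 0" "M * \<epsilon> \<le> r" "L * \<epsilon> \<le> 1 / 2"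
    using r L M by (auto simp: \<epsilon>_def min_def field_simps)
  let ?J = "{-\<epsilon>..\<epsilon>}"
  \<comment> \<open>Functions on \<open>?J\<close> are continued constantly beyond its ends, so that
    the iterates are bounded continuous functions on the whole line and the fixed point is sought in
    a complete space of those.\<close>
  define clip where "clip t = max (-\<epsilon>) (min \<epsilon> t)" for t
  have clip: "clip t \<in> ?J" "t \<in> ?J \<Longrightarrow> clip t = t" for t using e by (auto simp: clip_def)
  have clipc: "continuous_on UNIV clip" unfolding clip_def by (intro continuous_intros)
  define X where "X = PiC UNIV (\<lambda>_::real. cball x0 r)"
  have Xiff: "u \<in> X \<longleftrightarrow> (\<forall>t. u t \<in> cball x0 r)" for u by (auto simp: X_def mem_PiC_iff)
  have X: "complete X" unfolding X_def complete_eq_closed by (intro closed_PiC) simp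
  have "const_bcontfun x0 \<in> X" using r by (simp add: Xiff const_bcontfun.rep_eq)
  then have X0: "X \<noteq> {}" by auto
  have "\<exists>v\<in>X. v 0 = x0 \<and> (\<forall>t\<in>?J. (v has_vector_derivative f (u t)) (at t within ?J)) \<and> (\<forall>t. v t = v (clip t))"
    if u: "u \<in> X" for u
  proof -
    have uc: "u t \<in> cball x0 r" for t using u Xiff by blast
    have "continuous_on ?J (\<lambda>t. f (u t))"
    proof (rule continuous_on_compose2[OF smooth_on_continuous[OF assms(2)]])
      show "apply_bcontfun u ` ?J \<subseteq> S" using uc r by blast
    qed simp
    then obtain g0 where g0: "\<And>t. t \<in> ?J \<Longrightarrow> (g0 has_vector_derivative f (u t)) (at t within ?J)"
      using antiderivative_exists by blast
    define g where "g t = g0 t - g0 0 + x0" for t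
    have g: "(g has_vector_derivative f (u t)) (at t within ?J)" if "t \<in> ?J" for t
      unfolding g_def using g0[OF that] by (auto intro!: derivative_eq_intros)
    have g0: "g 0 = x0" by (simp add: g_def)
    have gr: "g t \<in> cball x0 r" if "t \<in> ?J" for t
    proof -
      have "norm (g t - g 0) \<le> M * \<bar>t - 0\<bar>"
        using e that by (intro vector_derivative_bound[OF convex_closed_interval[of "-\<epsilon>" \<epsilon>] g] fM uc) auto
      also have "\<dots> \<le> M * \<epsilon>" using M that by (intro mult_left_mono) auto
      finally show ?thesis using e g0 by (simp add: dist_norm norm_minus_commute)
    qed
    have gc: "continuous_on ?J g"
      using g by (meson continuous_on_eq_continuous_within has_vector_derivative_continuous)
    have "(\<lambda>t. g (clip t)) \<in> bcontfun"
    proof -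
      have "continuous_on UNIV (\<lambda>t. g (clip t))"
        by (rule continuous_on_compose2[OF gc clipc]) (use clip in auto)
      moreover have "range (\<lambda>t. g (clip t)) \<subseteq> cball x0 r" using gr clip by blast
      then have "bounded (range (\<lambda>t. g (clip t)))" using bounded_cball bounded_subset by blast
      ultimately show ?thesis by (simp add: bcontfun_def)
    qed
    then obtain v where v: "(\<lambda>t. g (clip t)) = apply_bcontfun v" by (rule bcontfunE)
    have v': "v t = g (clip t)" for t using fun_cong[OF v] by simp
    have "(v has_vector_derivative f (u t)) (at t within ?J)" if "t \<in> ?J" for t
      using g[OF that] by (rule has_vector_derivative_transform[OF that, rotated]) (simp add: v' clip)
    then show ?thesis using gr clip e by (intro bexI[of _ v]) (auto simp: v' Xiff g0)
  qed
  then obtain P where P: "\<And>u. u \<in> X \<Longrightarrow> P u \<in> X" "\<And>u. u \<in> X \<Longrightarrow> P u 0 = x0"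
    "\<And>u t. u \<in> X \<Longrightarrow> t \<in> ?J \<Longrightarrow> (P u has_vector_derivative f (u t)) (at t within ?J)"
    "\<And>u t. u \<in> X \<Longrightarrow> P u t = P u (clip t)" by metis
  have "dist (P u) (P v) \<le> (1/2) * dist u v" if uv: "u \<in> X" "v \<in> X" for u v
  proof (rule dist_bound)
    fix t
    have "norm ((P u (clip t) - P v (clip t)) - (P u 0 - P v 0)) \<le> (L * dist u v) * \<bar>clip t - 0\<bar>"
    proof (rule vector_derivative_bound[OF convex_closed_interval[of "-\<epsilon>" \<epsilon>]])
      fix s assume s: "s \<in> ?J"
      show "((\<lambda>s. P u s - P v s) has_vector_derivative f (u s) - f (v s)) (at s within ?J)"
        by (intro has_vector_derivative_diff P uv s)
      have "norm (f (u s) - f (v s)) \<le> L * norm (u s - v s)"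
        using uv Xiff by (intro lip) blast+
      also have "\<dots> \<le> L * dist u v"
        using L dist_bounded[of u s v] by (intro mult_left_mono) (auto simp: dist_norm)
      finally show "norm (f (u s) - f (v s)) \<le> L * dist u v" .
    qed (use clip e in auto)
    then have "dist (P u t) (P v t) \<le> (L * dist u v) * \<bar>clip t\<bar>"
      using P(2,4) uv by (metis (no_types, lifting) diff_zero dist_norm cancel_comm_monoid_add_class.diff_cancel)
    also have "\<dots> \<le> (L * dist u v) * \<epsilon>"
      using L clip[of t] by (intro mult_left_mono) auto
    also have "\<dots> = (L * \<epsilon>) * dist u v" by simp
    also have "\<dots> \<le> (1/2) * dist u v" using e by (intro mult_right_mono) auto
    finally show "dist (P u t) (P v t) \<le> (1/2) * dist u v" .
  qed
  then obtain u where u: "u \<in> X" "P u = u"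
    using Banach_fix[OF X X0, of "1/2" P] P(1) by auto
  show ?thesis
  proof (rule that[OF e(1)])
    show "u 0 = x0" using P(2)[OF u(1)] u(2) by simp
    fix t :: real assume t: "\<bar>t\<bar> < \<epsilon>"
    have "(u has_vector_derivative f (u t)) (at t within ?J)"
      using P(3)[OF u(1), of t] t u(2) by (simp add: abs_less_iff)
    moreover have "at t within ?J = at t" using t by (intro at_within_interior) auto
    ultimately show "u t \<in> S \<and> (u has_vector_derivative f (u t)) (at t)"
      using u(1) r by (auto simp: Xiff)
  qed
qed

text \<open>Bootstrapping: the derivative \<open>f (u t)\<close> is differentiable as often as
  \<open>u\<close> itself, so each order yields the next.\<close>

lemma ode_solution_smooth:
  fixes f :: "'a::{real_inner,heine_borel} \<Rightarrow> 'a" and u :: "real \<Rightarrow> 'a"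
  assumes "open J" "open S" "smooth_on S f" "u ` J \<subseteq> S"
    and der: "\<And>t. t \<in> J \<Longrightarrow> (u has_vector_derivative f (u t)) (at t)"
  shows "smooth_on J u"
  unfolding smooth_on_def
proof
  fix n show "diff_on n J u"
  proof (induction n)
    case 0
    have "isCont u t" if "t \<in> J" for t using der[OF that] has_vector_derivative_continuous by blast
    then show ?case by (simp add: continuous_at_imp_continuous_on)
  next
    case (Suc n)
    show ?case
    proof (rule diff_on_SucI[OF assms(1)])
      show "(u has_derivative (\<lambda>h. h *\<^sub>R f (u t))) (at t)" if "t \<in> J" for t
        using der[OF that] by (simp add: has_vector_derivative_def)
      have "diff_on n J (\<lambda>t. f (u t))"
        using assms(3) by (intro diff_on_compose[OF assms(1,2) _ Suc assms(4)]) (simp add: smooth_on_def)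
      then show "diff_on n J (\<lambda>t. v *\<^sub>R f (u t))" for v
        by (intro diff_on_bilinear[OF assms(1) bounded_bilinear_scaleR] diff_on_const)
    qed
  qed
qed

subsection \<open>Symmetry of second derivatives\<close>

text \<open>The mean value theorem is applied in direction \<open>v\<close> to the difference of
  \<open>f\<close> along two parallel segments, and then in direction \<open>w\<close> to the
  derivative so obtained. The second difference on the left is symmetric in \<open>v\<close> and
  \<open>w\<close>, the right side is not; symmetry of second derivatives comes from this.\<close>

lemma second_difference:
  fixes f :: "'a::{real_inner,heine_borel} \<Rightarrow> real"
  assumes "open N" "smooth_on N f" "h > 0"
    and N: "\<And>s t. 0 \<le> s \<Longrightarrow> s \<le> h \<Longrightarrow> 0 \<le> t \<Longrightarrow> t \<le> h \<Longrightarrow> p + s *\<^sub>R v + t *\<^sub>R w \<in> N"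
  shows "\<exists>\<xi> \<eta>. 0 < \<xi> \<and> \<xi> < h \<and> 0 < \<eta> \<and> \<eta> < h \<and>
    f (p + h *\<^sub>R v + h *\<^sub>R w) - f (p + h *\<^sub>R w) - f (p + h *\<^sub>R v) + f p =
    h * (h * fderiv (\<lambda>x. fderiv f x v) (p + \<xi> *\<^sub>R v + \<eta> *\<^sub>R w) w)"
proof -
  define fv where "fv x = fderiv f x v" for x
  have fv: "smooth_on N fv" unfolding fv_def by (rule smooth_on_directional_derivative[OF assms(1,2)])
  have d: "((\<lambda>s. g (q + s *\<^sub>R z)) has_real_derivative fderiv g (q + s *\<^sub>R z) z) (at s)"
    if "smooth_on N g" "q + s *\<^sub>R z \<in> N" for g :: "'a \<Rightarrow> real" and q z s
  proof -
    have 1: "((\<lambda>s. q + s *\<^sub>R z) has_derivative (\<lambda>h. h *\<^sub>R z)) (at s)"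
      by (auto intro!: derivative_eq_intros)
    note 2 = smooth_on_derivative[OF that]
    have "((\<lambda>s. g (q + s *\<^sub>R z)) has_derivative (\<lambda>h. fderiv g (q + s *\<^sub>R z) (h *\<^sub>R z))) (at s)"
      using diff_chain_at[OF 1 2] by (simp add: o_def)
    then show ?thesis
      using linear_scale[OF has_derivative_linear[OF 2]]
      by (simp add: has_field_derivative_def mult_commute_abs)
  qed
  let ?g = "\<lambda>s. f ((p + h *\<^sub>R w) + s *\<^sub>R v) - f (p + s *\<^sub>R v)"
  have gN: "(p + h *\<^sub>R w) + s *\<^sub>R v \<in> N" "p + s *\<^sub>R v \<in> N" if "0 \<le> s" "s \<le> h" for s
    using N[of s h] N[of s 0] that assms(3) by (auto simp: add_ac)
  obtain \<xi> where xi: "0 < \<xi>" "\<xi> < h" "?g h - ?g 0 = (h - 0) * (fv ((p + h *\<^sub>R w) + \<xi> *\<^sub>R v) - fv (p + \<xi> *\<^sub>R v))"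
    using MVT2[of 0 h ?g "\<lambda>s. fv ((p + h *\<^sub>R w) + s *\<^sub>R v) - fv (p + s *\<^sub>R v)"] assms(3)
      DERIV_diff[OF d d, OF assms(2) gN(1) assms(2) gN(2)] unfolding fv_def by blast
  let ?k = "\<lambda>t. fv ((p + \<xi> *\<^sub>R v) + t *\<^sub>R w)"
  obtain \<eta> where eta: "0 < \<eta>" "\<eta> < h" "?k h - ?k 0 = (h - 0) * fderiv fv ((p + \<xi> *\<^sub>R v) + \<eta> *\<^sub>R w) w"
    using MVT2[of 0 h ?k "\<lambda>t. fderiv fv ((p + \<xi> *\<^sub>R v) + t *\<^sub>R w) w"] assms(3)
      d[OF fv N] xi by (metis less_imp_le)
  show ?thesis
    using xi eta unfolding fv_def[abs_def]
    by (intro exI[of _ \<xi>] exI[of _ \<eta>]) (simp add: add_ac)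
qed

lemma second_derivative_symmetric_real:
  fixes f :: "'a::{real_inner,heine_borel} \<Rightarrow> real"
  assumes "open N" "smooth_on N f" "p \<in> N"
  shows "fderiv (\<lambda>x. fderiv f x v) p w =
         fderiv (\<lambda>x. fderiv f x w) p v"
proof -
  define D where "D v w x = fderiv (\<lambda>x. fderiv f x v) x w" for v w x
  obtain \<rho> where \<rho>: "\<rho> > 0" "ball p \<rho> \<subseteq> N" using assms open_contains_ball by blast
  \<comment> \<open>Small enough that the parallelogram at \<open>p\<close> spanned by
    \<open>\<delta>\<close> times \<open>v\<close> and \<open>\<delta>\<close> times
    \<open>w\<close> lies in the ball; the summand 1 keeps the denominator positive for
    \<open>v = w = 0\<close>.\<close>
  define \<delta> where "\<delta> = \<rho> / (norm v + norm w + 1)"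
  have \<delta>: "\<delta> > 0" using \<rho> by (auto simp: \<delta>_def intro!: divide_pos_pos add_nonneg_pos)
  have "\<delta> * (norm v + norm w) < \<delta> * (norm v + norm w + 1)" using \<delta> by simp
  also have "\<dots> = \<rho>" using add_nonneg_pos[of "norm v + norm w" 1] by (simp add: \<delta>_def)
  finally have \<delta>\<rho>: "\<delta> * (norm v + norm w) < \<rho>" .
  have inN: "p + s *\<^sub>R v + t *\<^sub>R w \<in> N" if "0 \<le> s" "s \<le> \<delta>" "0 \<le> t" "t \<le> \<delta>" for s t
  proof -
    have "norm (s *\<^sub>R v + t *\<^sub>R w) \<le> s * norm v + t * norm w"
      using norm_triangle_ineq[of "s *\<^sub>R v" "t *\<^sub>R w"] that by simp
    also have "\<dots> \<le> \<delta> * norm v + \<delta> * norm w" using that by (intro add_mono mult_right_mono) auto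
    also have "\<dots> < \<rho>" using \<delta>\<rho> by (simp add: algebra_simps)
    finally have "norm (s *\<^sub>R v + t *\<^sub>R w) < \<rho>" .
    then have "p + (s *\<^sub>R v + t *\<^sub>R w) \<in> ball p \<rho>" by (metis add_diff_cancel_left' dist_commute dist_norm mem_ball)
    then show ?thesis using \<rho> by (auto simp: add.assoc)
  qed
  define h where "h n = \<delta> / real (Suc n)" for n
  have h: "h n > 0" "h n \<le> \<delta>" for n using \<delta> by (auto simp: h_def field_simps)
  have h0: "h \<longlonglongrightarrow> 0" unfolding h_def
    by (rule LIMSEQ_Suc) (rule lim_const_over_n)
  have "\<exists>\<xi> \<eta>. 0 < \<xi> \<and> \<xi> < h n \<and> 0 < \<eta> \<and> \<eta> < h n \<and>
    f (p + h n *\<^sub>R v + h n *\<^sub>R w) - f (p + h n *\<^sub>R w) - f (p + h n *\<^sub>R v) + f p =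
    h n * (h n * D v w (p + \<xi> *\<^sub>R v + \<eta> *\<^sub>R w))" for n
    unfolding D_def using h[of n] by (intro second_difference[OF assms(1,2)] inN) auto
  then obtain \<xi> \<eta> where 1: "\<And>n. 0 < \<xi> n \<and> \<xi> n < h n \<and> 0 < \<eta> n \<and> \<eta> n < h n"
    "\<And>n. f (p + h n *\<^sub>R v + h n *\<^sub>R w) - f (p + h n *\<^sub>R w) - f (p + h n *\<^sub>R v) + f p =
    h n * (h n * D v w (p + \<xi> n *\<^sub>R v + \<eta> n *\<^sub>R w))" by metis
  have "\<exists>\<xi> \<eta>. 0 < \<xi> \<and> \<xi> < h n \<and> 0 < \<eta> \<and> \<eta> < h n \<and>
    f (p + h n *\<^sub>R w + h n *\<^sub>R v) - f (p + h n *\<^sub>R v) - f (p + h n *\<^sub>R w) + f p =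
    h n * (h n * D w v (p + \<xi> *\<^sub>R w + \<eta> *\<^sub>R v))" for n
  proof (unfold D_def, rule second_difference[OF assms(1,2) h(1)])
    fix s t assume "0 \<le> s" "s \<le> h n" "0 \<le> t" "t \<le> h n"
    then show "p + s *\<^sub>R w + t *\<^sub>R v \<in> N" using inN[of t s] h(2)[of n] by (simp add: add_ac)
  qed
  then obtain \<xi>' \<eta>' where 2: "\<And>n. 0 < \<xi>' n \<and> \<xi>' n < h n \<and> 0 < \<eta>' n \<and> \<eta>' n < h n"
    "\<And>n. f (p + h n *\<^sub>R w + h n *\<^sub>R v) - f (p + h n *\<^sub>R v) - f (p + h n *\<^sub>R w) + f p =
    h n * (h n * D w v (p + \<xi>' n *\<^sub>R w + \<eta>' n *\<^sub>R v))" by metis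
  \<comment> \<open>One second difference, evaluated in both orders: the two mixed derivatives agree
    at intermediate points which both tend to \<open>p\<close>.\<close>
  have eq: "D v w (p + \<xi> n *\<^sub>R v + \<eta> n *\<^sub>R w) = D w v (p + \<xi>' n *\<^sub>R w + \<eta>' n *\<^sub>R v)" for n
  proof -
    have "f (p + h n *\<^sub>R v + h n *\<^sub>R w) - f (p + h n *\<^sub>R w) - f (p + h n *\<^sub>R v) + f p =
      f (p + h n *\<^sub>R w + h n *\<^sub>R v) - f (p + h n *\<^sub>R v) - f (p + h n *\<^sub>R w) + f p"
      by (simp add: add_ac)
    then have "h n * (h n * D v w (p + \<xi> n *\<^sub>R v + \<eta> n *\<^sub>R w)) = h n * (h n * D w v (p + \<xi>' n *\<^sub>R w + \<eta>' n *\<^sub>R v))"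
      using 1(2)[of n] 2(2)[of n] by simp
    then show ?thesis using h(1)[of n] by simp
  qed
  have lim: "(\<lambda>n. D a c (p + \<alpha> n *\<^sub>R a + \<beta> n *\<^sub>R c)) \<longlonglongrightarrow> D a c p"
    if *: "\<And>n. 0 < \<alpha> n \<and> \<alpha> n < h n \<and> 0 < \<beta> n \<and> \<beta> n < h n" for \<alpha> \<beta> a c
  proof -
    have "\<alpha> \<longlonglongrightarrow> 0" "\<beta> \<longlonglongrightarrow> 0"
      using * by (auto intro!: tendsto_sandwich[OF _ _ tendsto_const h0] always_eventually less_imp_le)
    then have "(\<lambda>n. p + \<alpha> n *\<^sub>R a + \<beta> n *\<^sub>R c) \<longlonglongrightarrow> p + 0 *\<^sub>R a + 0 *\<^sub>R c"
      by (intro tendsto_intros)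
    then have l: "(\<lambda>n. p + \<alpha> n *\<^sub>R a + \<beta> n *\<^sub>R c) \<longlonglongrightarrow> p" by simp
    have "smooth_on N (D a c)" unfolding D_def
      by (intro smooth_on_directional_derivative assms)
    then have "isCont (D a c) p"
      using smooth_on_continuous continuous_on_eq_continuous_at assms by blast
    then show ?thesis using l isCont_tendsto_compose by blast
  qed
  have "D v w p = D w v p"
    using LIMSEQ_unique[OF lim[of \<xi> \<eta>] lim[of \<xi>' \<eta>', of w v, folded eq]] 1(1) 2(1) by blast
  then show ?thesis by (simp add: D_def)
qed

lemma second_derivative_symmetric:
  fixes f :: "'a::{real_inner,heine_borel} \<Rightarrow> 'b::{real_inner,heine_borel}"
  assumes "open N" "smooth_on N f" "p \<in> N"
  shows "fderiv (\<lambda>x. fderiv f x v) p w =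
         fderiv (\<lambda>x. fderiv f x w) p v"
proof (rule onb_eqI)
  fix b :: 'b
  have inner: "fderiv (\<lambda>x. g x \<bullet> b) x z = fderiv g x z \<bullet> b"
    if "smooth_on N g" "x \<in> N" for g x z
    using frechet_derivative_at[OF has_derivative_inner_left[OF smooth_on_derivative[OF that], of b]] by metis
  have 2: "fderiv (\<lambda>x. fderiv (\<lambda>x. f x \<bullet> b) x y) p z =
    fderiv (\<lambda>x. fderiv f x y) p z \<bullet> b" for y z
  proof -
    have "((\<lambda>x. fderiv f x y \<bullet> b) has_derivative
      (\<lambda>z. fderiv (\<lambda>x. fderiv f x y) p z \<bullet> b)) (at p)"
      by (intro has_derivative_inner_left smooth_on_derivative[of N] smooth_on_directional_derivative assms)
    then have "((\<lambda>x. fderiv (\<lambda>x. f x \<bullet> b) x y) has_derivative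
      (\<lambda>z. fderiv (\<lambda>x. fderiv f x y) p z \<bullet> b)) (at p)"
      using assms(1,3) by (rule has_derivative_transform_within_open) (simp add: inner[OF assms(2)])
    then show ?thesis using frechet_derivative_at by metis
  qed
  have "smooth_on N (\<lambda>x. f x \<bullet> b)"
    by (intro smooth_on_inner assms smooth_on_const)
  from second_derivative_symmetric_real[OF assms(1) this assms(3), of v w]
  show "fderiv (\<lambda>x. fderiv f x v) p w \<bullet> b =
         fderiv (\<lambda>x. fderiv f x w) p v \<bullet> b"
    by (simp only: 2)
qed

subsection \<open>Descent of differentiability along submersions\<close>

text \<open>The difference \<open>k\<close> of \<open>h\<close> and the identity has derivative 0 at
  0, hence contracts near 0, and \<open>h z = y\<close> says that \<open>z\<close> is a fixed point
  of \<open>z \<mapsto> y - k z\<close>. The section \<open>s\<close> is differentiated at the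
  single point \<open>h 0\<close>, where the estimate
  \<open>norm (s y) \<le> 2 * norm (y - h 0)\<close> gives its continuity.\<close>

lemma smooth_local_inverse:
  fixes h :: "'b::{real_inner,heine_borel} \<Rightarrow> 'b"
  assumes "open S" "smooth_on S h" "0 \<in> S" "(h has_derivative (\<lambda>x. x)) (at 0)"
  obtains s W where "open W" "h 0 \<in> W" "\<And>y. y \<in> W \<Longrightarrow> s y \<in> S \<and> h (s y) = y" "s (h 0) = 0"
    "(s has_derivative (\<lambda>x. x)) (at (h 0))"
proof -
  define k where "k z = h z + (-1) *\<^sub>R z" for z
  have ks: "smooth_on S k" unfolding k_def
    by (intro smooth_on_add assms smooth_on_linear bounded_linear_scaleR_right)
  have "(k has_derivative (\<lambda>x. 0)) (at 0)"
    unfolding k_def using assms(4) by (auto intro!: derivative_eq_intros)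
  then have "fderiv k 0 = (\<lambda>x. 0)" using frechet_derivative_at by metis
  then have "(\<Sum>b\<in>onb. norm (fderiv k 0 b)) < 1/2" by simp
  from smooth_on_Lipschitz_bound[OF assms(1) ks assms(3) this]
  obtain r where r: "r > 0" "cball 0 r \<subseteq> S"
    and lip: "\<And>x y. x \<in> cball 0 r \<Longrightarrow> y \<in> cball 0 r \<Longrightarrow> norm (k x - k y) \<le> 1/2 * norm (x - y)" by metis
  \<comment> \<open>For \<open>norm (y - h 0) \<le> r / 2\<close> the map
    \<open>z \<mapsto> y - k z\<close> preserves \<open>cball 0 r\<close>, since \<open>k\<close>
    contributes at most half of \<open>norm z\<close>.\<close>
  define W where "W = ball (h 0) (r/2)"
  have k0: "k 0 = h 0" by (simp add: k_def)
  have "\<exists>z\<in>cball 0 r. h z = y" if y: "y \<in> W" for y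
  proof -
    have "\<exists>!z\<in>cball 0 r. y - k z = z"
    proof (rule Banach_fix[where c="1/2"])
      show "(\<lambda>z. y - k z) ` cball 0 r \<subseteq> cball 0 r"
      proof clarify
        fix z :: 'b assume z: "z \<in> cball 0 r"
        have "norm (y - k z) \<le> norm (y - h 0) + norm (k 0 - k z)"
          using norm_triangle_ineq[of "y - h 0" "k 0 - k z"] by (simp add: k0)
        also have "norm (k 0 - k z) \<le> 1/2 * norm (0 - z)" using lip[of 0 z] z r by simp
        also have "norm (y - h 0) \<le> r/2" using y by (simp add: W_def dist_norm norm_minus_commute)
        finally show "y - k z \<in> cball 0 r" using z by simp
      qed
      fix x z :: 'b assume "x \<in> cball 0 r" "z \<in> cball 0 r"
      then show "dist (y - k x) (y - k z) \<le> 1/2 * dist x z"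
        using lip[of z x] by (simp add: dist_norm norm_minus_commute)
    qed (use r in \<open>auto simp: complete_eq_closed\<close>)
    then obtain z where "z \<in> cball 0 r" "y - k z = z" by blast
    then show ?thesis by (intro bexI[of _ z]) (auto simp: k_def algebra_simps)
  qed
  then obtain s where s: "\<And>y. y \<in> W \<Longrightarrow> s y \<in> cball 0 r" "\<And>y. y \<in> W \<Longrightarrow> h (s y) = y" by metis
  have W: "open W" "h 0 \<in> W" using r by (auto simp: W_def)
  have bound: "norm (s y) \<le> 2 * norm (y - h 0)" if "y \<in> W" for y
  proof -
    have "s y = (y - h 0) + (k 0 - k (s y))" using s(2)[OF that] by (simp add: k_def)
    then have "norm (s y) \<le> norm (y - h 0) + norm (k 0 - k (s y))" by (metis norm_triangle_ineq)
    moreover have "norm (k 0 - k (s y)) \<le> 1/2 * norm (0 - s y)"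
      using lip[of 0 "s y"] s(1)[OF that] r by simp
    ultimately show ?thesis by simp
  qed
  have s0: "s (h 0) = 0" using bound[OF W(2)] by simp
  have "continuous (at (h 0)) s"
    unfolding isCont_def s0
  proof (rule Lim_null_comparison)
    show "\<forall>\<^sub>F y in at (h 0). norm (s y) \<le> 2 * norm (y - h 0)"
      using bound W eventually_at_in_open'[of W "h 0"] by (auto elim: eventually_mono)
    have "((\<lambda>y. 2 * norm (y - h 0)) \<longlongrightarrow> 2 * norm (h 0 - h 0)) (at (h 0))" by (intro tendsto_intros)
    then show "((\<lambda>y. 2 * norm (y - h 0)) \<longlongrightarrow> 0) (at (h 0))" by simp
  qed
  moreover have "(h has_derivative (\<lambda>x. x)) (at (s (h 0)))" using assms(4) s0 by simp
  moreover have "(\<lambda>x::'b. x) \<circ> (\<lambda>x. x) = id" by auto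
  ultimately have "(s has_derivative (\<lambda>x. x)) (at (h 0))"
    using has_derivative_inverse_basic[of h "\<lambda>x. x" s "h 0" "\<lambda>x. x" W] bounded_linear_ident W s(2) by blast
  then show ?thesis using that[of W s] W s s0 r by blast
qed

text \<open>A linear right inverse \<open>R\<close> of the derivative turns
  \<open>z \<mapsto> \<rho> (x0 + R z)\<close> into a map with identity derivative at 0. Its local
  inverse gives a section of \<open>\<rho>\<close> through \<open>x0\<close>, and along it
  \<open>F\<close> is recovered from the composite of \<open>F\<close> with
  \<open>\<rho>\<close>.\<close>

lemma differentiable_descent:
  fixes \<rho> :: "'a::{real_inner,heine_borel} \<Rightarrow> 'b::{real_inner,heine_borel}"
    and F :: "'b \<Rightarrow> 'c::real_normed_vector"
  assumes "open S" "smooth_on S \<rho>" "x0 \<in> S" "surj (fderiv \<rho> x0)"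
    and "(\<lambda>x. F (\<rho> x)) differentiable (at x0)"
  shows "F differentiable (at (\<rho> x0))"
proof -
  let ?A = "fderiv \<rho> x0"
  have lA: "linear ?A" using has_derivative_linear[OF smooth_on_derivative[OF assms(2,3)]] .
  obtain c where c: "\<And>b. ?A (c b) = b" using assms(4) by (metis surjD)
  define R where "R z = (\<Sum>b\<in>onb. (z \<bullet> b) *\<^sub>R c b)" for z
  have R: "bounded_linear R" unfolding R_def
    by (intro bounded_linear_sum bounded_linear_scaleR_const bounded_linear_inner_left)
  have AR: "?A (R z) = z" for z
    using lA by (simp add: R_def linear_sum linear_scale c onb_expansion)
  have R0: "R 0 = 0" using linear_simps(3)[OF R] .
  define Q where "Q = {z. x0 + R z \<in> S}"
  have contR: "continuous_on UNIV (\<lambda>z. x0 + R z)"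
    using R by (intro continuous_intros linear_continuous_on)
  have Q: "open Q" "0 \<in> Q" using open_vimage[OF assms(1) contR] assms(3) R0
    by (auto simp: Q_def vimage_def)
  have smR: "smooth_on Q (\<lambda>z. x0 + R z)"
    by (intro smooth_on_add Q smooth_on_const smooth_on_linear R)
  have h: "smooth_on Q (\<lambda>z. \<rho> (x0 + R z))"
    by (rule smooth_on_compose[OF Q(1) assms(1,2) smR]) (auto simp: Q_def)
  have dR: "((\<lambda>z. x0 + R z) has_derivative R) (at 0)"
    using bounded_linear_imp_has_derivative[OF R] by (auto intro!: derivative_eq_intros)
  have "((\<lambda>z. \<rho> (x0 + R z)) has_derivative (\<lambda>z. ?A (R z))) (at 0)"
    using diff_chain_at[OF dR, of \<rho> ?A] smooth_on_derivative[OF assms(2,3)] by (simp add: R0 o_def)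
  then have "((\<lambda>z. \<rho> (x0 + R z)) has_derivative (\<lambda>z. z)) (at 0)" by (simp add: AR)
  from smooth_local_inverse[OF Q(1) h Q(2) this]
  obtain s W where sW: "open W" "\<rho> x0 \<in> W" "\<And>y. y \<in> W \<Longrightarrow> \<rho> (x0 + R (s y)) = y" "s (\<rho> x0) = 0"
    "(s has_derivative (\<lambda>x. x)) (at (\<rho> x0))" unfolding R0 add_0_right by metis
  obtain D where D: "((\<lambda>x. F (\<rho> x)) has_derivative D) (at x0)"
    using assms(5) by (auto simp: differentiable_def)
  have "((\<lambda>y. x0 + R (s y)) has_derivative (\<lambda>y. R y)) (at (\<rho> x0))"
    using diff_chain_at[OF sW(5), of "\<lambda>z. x0 + R z" R] dR by (simp add: sW(4) o_def)
  then have "((\<lambda>y. F (\<rho> (x0 + R (s y)))) has_derivative (\<lambda>y. D (R y))) (at (\<rho> x0))"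
    using diff_chain_at[of "\<lambda>y. x0 + R (s y)" R "\<rho> x0" "\<lambda>x. F (\<rho> x)" D] D
    by (simp add: sW(4) R0 o_def)
  then have "(F has_derivative (\<lambda>y. D (R y))) (at (\<rho> x0))"
    using sW(1,2) by (rule has_derivative_transform_within_open) (simp add: sW(3))
  then show ?thesis by (auto simp: differentiable_def)
qed

section \<open>The geodesic equation in a chart\<close>

lemma partial_derivatives:
  fixes U :: "real \<times> real \<Rightarrow> 'b::real_normed_vector"
  assumes "smooth_on N U" "(s0, t0) \<in> N"
  shows "((\<lambda>s. U (s, t0)) has_vector_derivative fderiv U (s0, t0) (1, 0)) (at s0)"
    and "((\<lambda>t. U (s0, t)) has_vector_derivative fderiv U (s0, t0) (0, 1)) (at t0)"
proof -
  note d = has_derivative_at_withinI[OF smooth_on_derivative[OF assms]]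
  have "((\<lambda>s. (s, t0)) has_vector_derivative (1, 0)) (at s0)"
    by (intro has_vector_derivative_Pair has_vector_derivative_id has_vector_derivative_const)
  from vector_derivative_diff_chain_within[OF this d]
  show "((\<lambda>s. U (s, t0)) has_vector_derivative fderiv U (s0, t0) (1, 0)) (at s0)"
    by (simp add: o_def)
  have "((\<lambda>t. (s0, t)) has_vector_derivative (0, 1)) (at t0)"
    by (intro has_vector_derivative_Pair has_vector_derivative_id has_vector_derivative_const)
  from vector_derivative_diff_chain_within[OF this d]
  show "((\<lambda>t. U (s0, t)) has_vector_derivative fderiv U (s0, t0) (0, 1)) (at t0)"
    by (simp add: o_def)
qed

locale local_metric =
  fixes S :: "'f::{real_inner,heine_borel} set" and h :: "'f \<Rightarrow> 'f \<Rightarrow> 'f \<Rightarrow> real"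
  assumes open_S: "open S"
    and inner_h: "\<And>u. u \<in> S \<Longrightarrow> is_inner_product (h u)"
    and smooth_h: "\<And>v w. smooth_on S (\<lambda>u. h u v w)"
begin

lemma h_linear1: "u \<in> S \<Longrightarrow> linear (\<lambda>v. h u v w)"
  and h_linear2: "u \<in> S \<Longrightarrow> linear (\<lambda>w. h u v w)"
  and h_sym: "u \<in> S \<Longrightarrow> h u v w = h u w v"
  and h_pos: "u \<in> S \<Longrightarrow> v \<noteq> 0 \<Longrightarrow> h u v v > 0"
  using inner_h[of u] unfolding is_inner_product_def bilinear_def by auto

lemma h_expansion:
  assumes "u \<in> S"
  shows "(\<Sum>b\<in>onb. \<Sum>c\<in>onb. (v \<bullet> b) * ((w \<bullet> c) * h u b c)) = h u v w"
proof -
  have "(\<Sum>c\<in>onb. (w \<bullet> c) * h u b c) = h u b w" for b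
    using linear_onb_expansion[OF h_linear2[OF assms], where z=w] by simp
  then have "(\<Sum>b\<in>onb. \<Sum>c\<in>onb. (v \<bullet> b) * ((w \<bullet> c) * h u b c)) = (\<Sum>b\<in>onb. (v \<bullet> b) * h u b w)"
    by (simp add: sum_distrib_left[symmetric])
  then show ?thesis using linear_onb_expansion[OF h_linear1[OF assms], where z=v] by simp
qed

lemma smooth_on_metric:
  assumes "open R" "smooth_on R p" "p ` R \<subseteq> S" "smooth_on R v" "smooth_on R w"
  shows "smooth_on R (\<lambda>x. h (p x) (v x) (w x))"
proof -
  have "smooth_on R (\<lambda>x. h (p x) b c)" for b c
    by (rule smooth_on_compose[OF assms(1) open_S smooth_h assms(2,3)])
  then have "smooth_on R (\<lambda>x. \<Sum>b\<in>onb. \<Sum>c\<in>onb. (v x \<bullet> b) * ((w x \<bullet> c) * h (p x) b c))"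
    by (intro smooth_on_sum smooth_on_mult smooth_on_inner smooth_on_const assms)
  then show ?thesis
    by (rule smooth_on_cong[OF assms(1), rotated]) (use assms(3) h_expansion in auto)
qed

text \<open>As one function of the point and both vectors the metric has an ordinary derivative.
  This yields the product rule along curves and the smooth dependence of Christoffel symbols on all
  arguments.\<close>

definition total :: "'f \<times> 'f \<times> 'f \<Rightarrow> real" where "total = (\<lambda>(u, v, w). h u v w)"

lemma open_total: "open (S \<times> (UNIV :: ('f \<times> 'f) set))"
  by (simp add: open_S open_Times)

lemma smooth_total: "smooth_on (S \<times> UNIV) total"
proof -
  have "smooth_on (S \<times> UNIV) (\<lambda>x::'f\<times>'f\<times>'f. h (fst x) (fst (snd x)) (snd (snd x)))"
    by (rule smooth_on_metric[OF open_total])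
      (auto intro!: smooth_on_linear bounded_linear_fst bounded_linear_snd
        bounded_linear_compose[OF bounded_linear_fst] bounded_linear_compose[OF bounded_linear_snd])
  then show ?thesis by (simp add: total_def case_prod_beta')
qed

lemma total_derivative:
  assumes "u \<in> S"
  shows "(total has_derivative (\<lambda>(u', v', w'). fderiv (\<lambda>q. h q v w) u u' + h u v' w + h u v w'))
    (at (u, v, w))"
proof -
  let ?D = "fderiv total (u, v, w)"
  have D: "(total has_derivative ?D) (at (u, v, w))"
    using smooth_on_derivative[OF smooth_total] assms by auto
  have lin: "linear ?D" using has_derivative_linear[OF D] .
  have 1: "?D (u', 0, 0) = fderiv (\<lambda>q. h q v w) u u'" for u'
  proof -
    have "((\<lambda>q. (q, v, w)) has_derivative (\<lambda>u'. (u', 0, 0))) (at u)"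
      by (auto intro!: derivative_eq_intros simp: zero_prod_def)
    from diff_chain_at[OF this D] show ?thesis
      using frechet_derivative_at[of "\<lambda>q. h q v w"] by (auto simp: o_def total_def dest!: fun_cong[of _ _ u'])
  qed
  have 2: "?D (0, v', 0) = h u v' w" for v'
  proof -
    have "((\<lambda>q. (u, q, w)) has_derivative (\<lambda>u'. (0, u', 0))) (at v)"
      by (auto intro!: derivative_eq_intros simp: zero_prod_def)
    from diff_chain_at[OF this D] have a: "((\<lambda>q. h u q w) has_derivative (\<lambda>v'. ?D (0, v', 0))) (at v)"
      by (simp add: o_def total_def)
    have "((\<lambda>q. h u q w) has_derivative (\<lambda>q. h u q w)) (at v)"
      by (intro bounded_linear_imp_has_derivative linear_bounded_linear h_linear1 assms)
    from has_derivative_unique[OF a this] show ?thesis by metis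
  qed
  have 3: "?D (0, 0, w') = h u v w'" for w'
  proof -
    have "((\<lambda>q. (u, v, q)) has_derivative (\<lambda>u'. (0, 0, u'))) (at w)"
      by (auto intro!: derivative_eq_intros simp: zero_prod_def)
    from diff_chain_at[OF this D] have a: "((\<lambda>q. h u v q) has_derivative (\<lambda>v'. ?D (0, 0, v'))) (at w)"
      by (simp add: o_def total_def)
    have "((\<lambda>q. h u v q) has_derivative (\<lambda>q. h u v q)) (at w)"
      by (intro bounded_linear_imp_has_derivative linear_bounded_linear h_linear2 assms)
    from has_derivative_unique[OF a this] show ?thesis by metis
  qed
  have "?D = (\<lambda>(u', v', w'). fderiv (\<lambda>q. h q v w) u u' + h u v' w + h u v w')"
  proof (rule ext, clarify)
    fix u' v' w' :: 'f
    have "(u', v', w') = (u', 0, 0) + ((0, v', 0) + (0, 0, w'))" by simp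
    then have "?D (u', v', w') = ?D (u', 0, 0) + (?D (0, v', 0) + ?D (0, 0, w'))"
      using linear_add[OF lin] by metis
    then show "?D (u', v', w') = fderiv (\<lambda>q. h q v w) u u' + h u v' w + h u v w'"
      by (simp add: 1 2 3)
  qed
  with D show ?thesis by simp
qed

lemma metric_has_vector_derivative:
  assumes "(u has_vector_derivative u') (at t)" "(v has_vector_derivative v') (at t)"
    "(w has_vector_derivative w') (at t)" "u t \<in> S"
  shows "((\<lambda>t. h (u t) (v t) (w t)) has_vector_derivative
    fderiv (\<lambda>q. h q (v t) (w t)) (u t) u' + h (u t) v' (w t) + h (u t) (v t) w') (at t)"
proof -
  have "((\<lambda>t. (u t, v t, w t)) has_vector_derivative (u', v', w')) (at t)"
    using assms by (intro has_vector_derivative_Pair)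
  from vector_derivative_diff_chain_within[OF this
      has_derivative_at_withinI[OF total_derivative[OF assms(4), of "v t" "w t"]]]
  show ?thesis by (simp add: o_def total_def)
qed

text \<open>With equal velocity arguments two of the three terms coincide; this is the case that
  occurs in the geodesic equation.\<close>

lemma christoffel_diagonal:
  assumes "u \<in> S"
  shows "christoffel h u x x z = fderiv (\<lambda>q. h q x z) u x
     - fderiv (\<lambda>q. h q x x) u z / 2"
  unfolding christoffel_def by simp

text \<open>Subtracting the derivative of the energy in the direction of the variation from that of the momentum
  in the direction of the curve leaves the geodesic equation, by symmetry of second derivatives.\<close>

lemma noether:
  fixes U :: "real \<times> real \<Rightarrow> 'f"
  defines "Us \<equiv> \<lambda>p. fderiv U p (1, 0)" and "Ut \<equiv> \<lambda>p. fderiv U p (0, 1)"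
  assumes N: "open N" "smooth_on N U" "U ` N \<subseteq> S" "(s0, t0) \<in> N"
    and energy: "\<And>s. (s, t0) \<in> N \<Longrightarrow> h (U (s, t0)) (Ut (s, t0)) (Ut (s, t0)) = E0"
    and momentum: "\<And>t. (s0, t) \<in> N \<Longrightarrow> h (U (s0, t)) (Ut (s0, t)) (Us (s0, t)) = K"
  shows "h (U (s0, t0)) (fderiv Ut (s0, t0) (0, 1)) (Us (s0, t0))
    + christoffel h (U (s0, t0)) (Ut (s0, t0)) (Ut (s0, t0)) (Us (s0, t0)) = 0"
proof -
  let ?p = "(s0, t0)"
  have p: "U ?p \<in> S" using N by auto
  have smt: "smooth_on N Ut" and sms: "smooth_on N Us"
    unfolding Ut_def Us_def by (rule smooth_on_directional_derivative[OF N(1,2)])+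
  note ds = partial_derivatives(1)[OF _ N(4)] and dt = partial_derivatives(2)[OF _ N(4)]
  let ?Uts = "fderiv Ut ?p (1, 0)" and ?Utt = "fderiv Ut ?p (0, 1)"
    and ?Ust = "fderiv Us ?p (0, 1)"
  have sym: "?Uts = ?Ust"
    unfolding Ut_def Us_def by (rule second_derivative_symmetric[OF N(1,2,4)])
  have near: "open {s. (s, t0) \<in> N}" "open {t. (s0, t) \<in> N}"
    by (auto intro!: open_vimage[OF N(1), unfolded vimage_def] continuous_intros)
  have "((\<lambda>s. h (U (s, t0)) (Ut (s, t0)) (Ut (s, t0))) has_vector_derivative
      fderiv (\<lambda>q. h q (Ut ?p) (Ut ?p)) (U ?p) (Us ?p) + h (U ?p) ?Uts (Ut ?p) + h (U ?p) (Ut ?p) ?Uts) (at s0)"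
    using metric_has_vector_derivative[OF ds[OF N(2)] ds[OF smt] ds[OF smt]] p by (simp add: Us_def)
  from has_vector_derivative_transform_within_open[OF this near(1), of "\<lambda>s. E0"] N(4) energy
  have e: "fderiv (\<lambda>q. h q (Ut ?p) (Ut ?p)) (U ?p) (Us ?p) + 2 * h (U ?p) ?Uts (Ut ?p) = 0"
    using vector_derivative_unique_at[OF _ has_vector_derivative_const] h_sym[OF p, of ?Uts] by fastforce
  have "((\<lambda>t. h (U (s0, t)) (Ut (s0, t)) (Us (s0, t))) has_vector_derivative
      fderiv (\<lambda>q. h q (Ut ?p) (Us ?p)) (U ?p) (Ut ?p) + h (U ?p) ?Utt (Us ?p) + h (U ?p) (Ut ?p) ?Ust) (at t0)"
    using metric_has_vector_derivative[OF dt[OF N(2)] dt[OF smt] dt[OF sms]] p by (simp add: Ut_def)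
  from has_vector_derivative_transform_within_open[OF this near(2), of "\<lambda>t. K"] N(4) momentum
  have m: "fderiv (\<lambda>q. h q (Ut ?p) (Us ?p)) (U ?p) (Ut ?p) + h (U ?p) ?Utt (Us ?p) + h (U ?p) (Ut ?p) ?Ust = 0"
    using vector_derivative_unique_at[OF _ has_vector_derivative_const] by fastforce
  \<comment> \<open>Take \<open>m\<close> minus half of \<open>e\<close>: the derivatives of the
    metric form the diagonal Christoffel symbol, and the terms with mixed derivatives cancel by
    \<open>sym\<close> and the symmetry of \<open>h\<close>.\<close>
  show ?thesis
    using e m h_sym[OF p, of ?Ust "Ut ?p"] unfolding christoffel_diagonal[OF p] sym by linarith
qed

text \<open>The constant is the minimum of \<open>h u w w\<close> over the compact product of a
  closed ball and the unit sphere; homogeneity extends the bound to all \<open>w\<close>.\<close>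

lemma coercive:
  assumes "u0 \<in> S"
  obtains c r where "c > 0" "r > 0" "cball u0 r \<subseteq> S"
    "\<And>u w. u \<in> cball u0 r \<Longrightarrow> c * (norm w)\<^sup>2 \<le> h u w w"
proof -
  obtain r where r: "r > 0" "cball u0 r \<subseteq> S" using open_S assms open_contains_cball by blast
  have "\<exists>c>0. \<forall>u\<in>cball u0 r. \<forall>w. c * (norm w)\<^sup>2 \<le> h u w w"
  proof (cases "sphere (0::'f) 1 = {}")
    \<comment> \<open>Dimension zero: the sphere is empty and provides no minimum, but every
      \<open>w\<close> is 0.\<close>
    case True
    have "w = 0" for w :: 'f
    proof (rule ccontr)
      assume "w \<noteq> 0" then have "sgn w \<in> sphere 0 1" by (simp add: norm_sgn)
      with True show False by blast
    qed
    then have w0: "w = 0" for w :: 'f by blast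
    have "h u 0 0 = 0" if "u \<in> cball u0 r" for u
      using linear_0[OF h_linear1, of u] r that by blast
    then show ?thesis by (intro exI[of _ 1]) (use w0 in \<open>auto, metis norm_zero order_refl zero_power2\<close>)
  next
    case False
    let ?K = "cball u0 r \<times> sphere (0::'f) 1"
    have "smooth_on (S \<times> UNIV) (\<lambda>x::'f\<times>'f. h (fst x) (snd x) (snd x))"
      by (rule smooth_on_metric) (auto intro!: open_Times open_S smooth_on_linear bounded_linear_fst bounded_linear_snd)
    then have cont: "continuous_on ?K (\<lambda>x. h (fst x) (snd x) (snd x))"
      using r by (intro continuous_on_subset[OF smooth_on_continuous]) auto
    have "sphere (0::'f) 1 = cball 0 1 \<inter> {x. norm x = 1}" by auto
    moreover have "closed {x::'f. norm x = 1}" by (intro closed_Collect_eq continuous_intros)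
    ultimately have "compact (sphere (0::'f) 1)" by (simp add: compact_Int_closed)
    then have cK: "compact ?K" by (intro compact_Times compact_cball)
    obtain z where "z \<in> sphere (0::'f) 1" using False by blast
    then have "(u0, z) \<in> ?K" using r by simp
    then have ne: "?K \<noteq> {}" by blast
    obtain q where q: "q \<in> ?K" "\<And>y. y \<in> ?K \<Longrightarrow> h (fst q) (snd q) (snd q) \<le> h (fst y) (snd y) (snd y)"
      using continuous_attains_inf[OF cK ne cont] by blast
    define c where "c = h (fst q) (snd q) (snd q)"
    have "snd q \<noteq> 0" "fst q \<in> S" using q(1) r by auto
    then have c: "c > 0" unfolding c_def by (rule h_pos[rotated])
    have "c * (norm w)\<^sup>2 \<le> h u w w" if u: "u \<in> cball u0 r" for u w
    proof (cases "w = 0")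
      case True
      then show ?thesis using linear_0[OF h_linear1, of u] r u by auto
    next
      case False
      have "c \<le> h u (sgn w) (sgn w)"
        unfolding c_def using q(2)[of "(u, sgn w)"] u False by (auto simp: norm_sgn)
      then have "c * (norm w)\<^sup>2 \<le> h u (sgn w) (sgn w) * (norm w)\<^sup>2" by (rule mult_right_mono) simp
      also have "\<dots> = h u (norm w *\<^sub>R sgn w) (norm w *\<^sub>R sgn w)"
        using linear_scale[OF h_linear1, of u] linear_scale[OF h_linear2, of u] r u
        by (auto simp: power2_eq_square)
      also have "norm w *\<^sub>R sgn w = w" using False by (simp add: sgn_div_norm)
      finally show ?thesis .
    qed
    then show ?thesis using c by blast
  qed
  then show ?thesis using that r by blast
qed

text \<open>The left side of the geodesic equation as a vector in \<open>onb\<close> coordinates.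
  Keeping the acceleration \<open>a\<close> as an independent variable gives a smooth function
  without inverting the metric.\<close>

definition spray_defect :: "'f \<times> 'f \<times> 'f \<Rightarrow> 'f" where
  "spray_defect = (\<lambda>(u, v, a). \<Sum>b\<in>onb. (h u a b + christoffel h u v v b) *\<^sub>R b)"

lemma smooth_spray_defect: "smooth_on (S \<times> UNIV) spray_defect"
proof -
  let ?O = "S \<times> (UNIV :: ('f \<times> 'f) set)"
  have fs: "smooth_on ?O (fst :: 'f\<times>'f\<times>'f \<Rightarrow> _)" "smooth_on ?O (\<lambda>x. fst (snd x))" "smooth_on ?O (\<lambda>x. snd (snd x))"
    by (auto intro!: smooth_on_linear bounded_linear_fst bounded_linear_snd
        bounded_linear_compose[OF bounded_linear_fst] bounded_linear_compose[OF bounded_linear_snd])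
  \<comment> \<open>Derivatives in the base point become derivatives of \<open>total\<close>, so
    that \<open>y\<close> and \<open>z\<close> may vary together with the point.\<close>
  have partial: "fderiv (\<lambda>q. h q y z) u x = fderiv total (u, y, z) (x, 0, 0)"
    if "u \<in> S" for u x y z
    using linear_0[OF h_linear1[OF that]] linear_0[OF h_linear2[OF that]]
    by (simp add: frechet_derivative_at[OF total_derivative[OF that, of y z], symmetric])
  have sp: "smooth_on ?O (\<lambda>x. fderiv total (fst x, y x, z x) (v x, 0, 0))"
    if "smooth_on ?O y" "smooth_on ?O z" "smooth_on ?O v" for y z v :: "'f \<times> 'f \<times> 'f \<Rightarrow> 'f"
    by (rule smooth_on_frechet_derivative[OF open_total open_total smooth_total])
       (auto intro!: smooth_on_Pair open_total that fs smooth_on_const)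
  have "smooth_on ?O (\<lambda>x. \<Sum>b\<in>onb. (h (fst x) (snd (snd x)) b +
     (fderiv total (fst x, fst (snd x), b) (fst (snd x), 0, 0)
     + (-1/2) *\<^sub>R fderiv total (fst x, fst (snd x), fst (snd x)) (b, 0, 0))) *\<^sub>R b)"
    by (intro smooth_on_sum smooth_on_scaleR smooth_on_add smooth_on_const open_total sp fs smooth_on_metric)
       auto
  then show ?thesis
    by (rule smooth_on_cong[OF open_total, rotated])
       (auto simp: spray_defect_def christoffel_diagonal partial)
qed

text \<open>Both curves are tested with the same acceleration \<open>a2\<close>. By the geodesic
  equations, the metric at \<open>u1\<close> applied to \<open>a1 - a2\<close> is the difference of
  \<open>spray_defect\<close> at \<open>(u2, v2, a2)\<close> and \<open>(u1, v1, a2)\<close>, which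
  is Lipschitz. Coercivity then bounds \<open>a1 - a2\<close> by \<open>L / c\<close> times the
  distance of the pairs of position and velocity, and \<open>gronwall_zero\<close> applies to the
  difference of these pairs.\<close>

lemma geodesic_unique_local:
  assumes J: "open J" "t0 \<in> J" "u1 ` J \<subseteq> S" "u2 ` J \<subseteq> S"
    and der: "\<And>t. t \<in> J \<Longrightarrow> (u1 has_vector_derivative v1 t) (at t)" "\<And>t. t \<in> J \<Longrightarrow> (v1 has_vector_derivative a1 t) (at t)"
      "\<And>t. t \<in> J \<Longrightarrow> (u2 has_vector_derivative v2 t) (at t)" "\<And>t. t \<in> J \<Longrightarrow> (v2 has_vector_derivative a2 t) (at t)"
    and a2: "isCont a2 t0"
    and geo1: "\<And>t w. t \<in> J \<Longrightarrow> h (u1 t) (a1 t) w + christoffel h (u1 t) (v1 t) (v1 t) w = 0"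
    and geo2: "\<And>t w. t \<in> J \<Longrightarrow> h (u2 t) (a2 t) w + christoffel h (u2 t) (v2 t) (v2 t) w = 0"
    and init: "u1 t0 = u2 t0" "v1 t0 = v2 t0"
  obtains \<delta> where "\<delta> > 0" "\<And>t. \<bar>t - t0\<bar> < \<delta> \<Longrightarrow> u1 t = u2 t"
proof -
  let ?x0 = "(u2 t0, v2 t0, a2 t0)"
  have u0: "u2 t0 \<in> S" using J by auto
  obtain r L where r: "r > 0" and L: "L > 0"
    and lip: "\<And>x y. x \<in> cball ?x0 r \<Longrightarrow> y \<in> cball ?x0 r \<Longrightarrow> norm (spray_defect x - spray_defect y) \<le> L * norm (x - y)"
    using smooth_on_Lipschitz[OF open_total smooth_spray_defect, of ?x0] u0 by (metis SigmaI UNIV_I)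
  obtain c r' where c: "c > 0" and r': "r' > 0" "cball (u2 t0) r' \<subseteq> S"
    and co: "\<And>u w. u \<in> cball (u2 t0) r' \<Longrightarrow> c * (norm w)\<^sup>2 \<le> h u w w"
    using coercive[OF u0] by metis
  have "isCont (\<lambda>t. (u1 t, v1 t, a2 t)) t0" "isCont (\<lambda>t. (u2 t, v2 t, a2 t)) t0" "isCont u1 t0"
    using der J(2) a2 has_vector_derivative_continuous by (auto intro!: continuous_intros) blast+
  then have "((\<lambda>t. (u1 t, v1 t, a2 t)) \<longlongrightarrow> ?x0) (at t0)" "((\<lambda>t. (u2 t, v2 t, a2 t)) \<longlongrightarrow> ?x0) (at t0)"
    "(u1 \<longlongrightarrow> u2 t0) (at t0)" unfolding isCont_def by (simp_all add: init)
  from this[THEN topological_tendstoD, OF open_ball]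
  have "\<forall>\<^sub>F t in at t0. (u1 t, v1 t, a2 t) \<in> ball ?x0 r" "\<forall>\<^sub>F t in at t0. (u2 t, v2 t, a2 t) \<in> ball ?x0 r"
    "\<forall>\<^sub>F t in at t0. u1 t \<in> ball (u2 t0) r'"
    using r r'(1) by simp_all
  moreover have "\<forall>\<^sub>F t in at t0. t \<in> J" using J(1,2) by (rule eventually_at_in_open')
  ultimately
  have "\<forall>\<^sub>F t in at t0. t \<in> J \<and> (u1 t, v1 t, a2 t) \<in> ball ?x0 r \<and> (u2 t, v2 t, a2 t) \<in> ball ?x0 r \<and> u1 t \<in> ball (u2 t0) r'"
    by eventually_elim blast
  then obtain \<delta> where \<delta>: "\<delta> > 0" and near': "\<And>t. t \<noteq> t0 \<Longrightarrow> dist t t0 < \<delta> \<Longrightarrow>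
      t \<in> J \<and> (u1 t, v1 t, a2 t) \<in> ball ?x0 r \<and> (u2 t, v2 t, a2 t) \<in> ball ?x0 r \<and> u1 t \<in> ball (u2 t0) r'"
    unfolding eventually_at by auto
  have near: "t \<in> J \<and> (u1 t, v1 t, a2 t) \<in> ball ?x0 r \<and> (u2 t, v2 t, a2 t) \<in> ball ?x0 r \<and> u1 t \<in> ball (u2 t0) r'"
    if "t \<in> ball t0 \<delta>" for t
    using near'[of t] that J r r' by (cases "t = t0") (auto simp: init dist_commute)
  let ?w = "\<lambda>t. (u1 t - u2 t, v1 t - v2 t)" and ?w' = "\<lambda>t. (v1 t - v2 t, a1 t - a2 t)"
  have acc: "c * norm (a1 t - a2 t) \<le> L * norm (?w t)" if t: "t \<in> ball t0 \<delta>" for t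
  proof -
    let ?a = "a1 t - a2 t"
    let ?P1 = "spray_defect (u1 t, v1 t, a2 t)" and ?P2 = "spray_defect (u2 t, v2 t, a2 t)"
    have uS: "u1 t \<in> S" "t \<in> J" using near[OF t] J by auto
    have inn: "spray_defect (u, v, a) \<bullet> b = h u a b + christoffel h u v v b" if "b \<in> onb" for u v a b
    proof -
      have "spray_defect (u, v, a) \<bullet> b = (\<Sum>d\<in>onb. (h u a d + christoffel h u v v d) * (d \<bullet> b))"
        by (simp add: spray_defect_def inner_sum_left)
      also have "\<dots> = (\<Sum>d\<in>onb. if d = b then h u a d + christoffel h u v v d else 0)"
        by (rule sum.cong) (auto simp: inner_onb that)
      finally show ?thesis using that by simp
    qed
    have 1: "h (u1 t) ?a b = (?P2 - ?P1) \<bullet> b" if b: "b \<in> onb" for b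
    proof -
      have "h (u1 t) ?a b = h (u1 t) (a1 t) b - h (u1 t) (a2 t) b"
        by (rule linear_diff[OF h_linear1[OF uS(1)]])
      then show ?thesis using geo1[OF uS(2), of b] geo2[OF uS(2), of b]
        by (simp add: inner_diff_left inn[OF b])
    qed
    have "h (u1 t) ?a ?a = (\<Sum>b\<in>onb. (?a \<bullet> b) *\<^sub>R h (u1 t) ?a b)"
      by (rule linear_onb_expansion[OF h_linear2[OF uS(1)], symmetric])
    also have "\<dots> = (\<Sum>b\<in>onb. (?a \<bullet> b) *\<^sub>R ((?P2 - ?P1) \<bullet> b))" by (simp add: 1)
    also have "\<dots> = (?P2 - ?P1) \<bullet> ?a"
      by (rule linear_onb_expansion) (simp add: bounded_linear_inner_right bounded_linear.linear)
    also have "\<dots> \<le> norm (?P2 - ?P1) * norm ?a" by (rule norm_cauchy_schwarz)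
    also have "norm (?P2 - ?P1) \<le> L * norm ((u2 t, v2 t, a2 t) - (u1 t, v1 t, a2 t))"
      using near[OF t] by (intro lip) auto
    also have "norm ((u2 t, v2 t, a2 t) - (u1 t, v1 t, a2 t)) = norm (?w t)"
      by (simp add: norm_Pair norm_minus_commute)
    finally have "h (u1 t) ?a ?a \<le> L * norm (?w t) * norm ?a" by (simp add: mult_right_mono)
    moreover have "c * (norm ?a)\<^sup>2 \<le> h (u1 t) ?a ?a" using near[OF t] by (intro co) auto
    ultimately have le: "(c * norm ?a) * norm ?a \<le> (L * norm (?w t)) * norm ?a"
      by (simp add: power2_eq_square mult.assoc)
    show ?thesis
    proof (cases "?a = 0")
      case True
      have "0 \<le> L * norm (?w t)" using L by (intro mult_nonneg_nonneg) auto
      then show ?thesis by (simp only: True norm_zero mult_zero_right)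
    next
      case False
      then have "0 < norm ?a" by (simp only: zero_less_norm_iff not_False_eq_True)
      with le show ?thesis by (rule mult_right_le_imp_le)
    qed
  qed
  show ?thesis
  proof (rule that[OF \<delta>])
    fix t assume "\<bar>t - t0\<bar> < \<delta>"
    then have t: "t \<in> ball t0 \<delta>" by (simp add: dist_real_def abs_minus_commute)
    have "?w t = 0"
    proof (rule gronwall_zero[of "ball t0 \<delta>" t0 ?w ?w' "1 + L / c"])
      fix s assume s: "s \<in> ball t0 \<delta>"
      show "(?w has_vector_derivative ?w' s) (at s)"
        using near[OF s] by (intro has_vector_derivative_Pair has_vector_derivative_diff der) auto
      have "norm (?w' s) \<le> norm (v1 s - v2 s) + norm (a1 s - a2 s)"
        using norm_Pair_le by blast
      also have "norm (v1 s - v2 s) \<le> norm (?w s)" by (metis norm_snd_le snd_conv)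
      also have "norm (a1 s - a2 s) \<le> L / c * norm (?w s)"
        using acc[OF s] c by (simp add: field_simps)
      finally show "norm (?w' s) \<le> (1 + L / c) * norm (?w s)" by (simp add: algebra_simps)
    qed (use \<delta> t init in \<open>auto simp: zero_prod_def\<close>)
    then show "u1 t = u2 t" by (simp add: zero_prod_def)
  qed
qed

end

section \<open>Smooth maps between manifolds\<close>

abbreviation chart_inv :: "('p, 'e) chart \<Rightarrow> 'e \<Rightarrow> 'p" where
  "chart_inv C \<equiv> inv_into (fst C) (snd C)"

text \<open>Parameters range over an arbitrary normed space, so one notion covers curves,
  two-parameter variations and inverse charts, and it is stable under products in the group and
  under \<open>proj\<close>.\<close>

definition smooth_param ::
  "'p topology \<Rightarrow> ('p, 'e::real_normed_vector) chart set \<Rightarrow> 'a::real_normed_vector set \<Rightarrow> ('a \<Rightarrow> 'p) \<Rightarrow> bool" where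
  "smooth_param T \<A> S c \<longleftrightarrow> continuous_map (top_of_set S) T c \<and>
     (\<forall>C\<in>\<A>. smooth_on (S \<inter> c -` fst C) (snd C \<circ> c))"

lemma smooth_curve_iff: "smooth_curve T \<A> I c \<longleftrightarrow> smooth_param T \<A> I c"
  by (auto simp: smooth_curve_def smooth_param_def)

lemma smooth_param_chart:
  "smooth_param T \<A> S c \<Longrightarrow> C \<in> \<A> \<Longrightarrow> smooth_on (S \<inter> c -` fst C) (\<lambda>x. snd C (c x))"
  by (simp add: smooth_param_def o_def)

lemma smooth_param_in: "smooth_param T \<A> S c \<Longrightarrow> x \<in> S \<Longrightarrow> c x \<in> topspace T"
  by (auto simp: smooth_param_def continuous_map_def)

lemma continuous_map_open_preimage:
  assumes "continuous_map (top_of_set S) T c" "open S" "openin T W"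
  shows "open (S \<inter> c -` W)"
proof -
  have "openin (top_of_set S) {x \<in> S. c x \<in> W}"
    using assms unfolding continuous_map_def by simp
  then have "open {x \<in> S. c x \<in> W}" using assms(2) openin_open_eq by blast
  then show ?thesis by (simp add: vimage_def Int_def)
qed

lemma smooth_param_open_preimage:
  "smooth_param T \<A> S c \<Longrightarrow> open S \<Longrightarrow> openin T W \<Longrightarrow> open (S \<inter> c -` W)"
  unfolding smooth_param_def using continuous_map_open_preimage by blast

lemma smooth_param_subset: "smooth_param T \<A> S c \<Longrightarrow> R \<subseteq> S \<Longrightarrow> smooth_param T \<A> R c"
  unfolding smooth_param_def
  by (auto intro: smooth_on_subset continuous_map_from_subtopology_mono)

locale manifold =
  fixes T :: "'p topology" and \<A> :: "('p, 'e::{real_inner, heine_borel}) chart set"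
  assumes manifold: "smooth_manifold T \<A>"
begin

lemma chart: "C \<in> \<A> \<Longrightarrow> is_chart T C"
  using manifold by (auto simp: smooth_manifold_def)

lemma chart_open: "C \<in> \<A> \<Longrightarrow> openin T (fst C)"
  and chart_image_open: "C \<in> \<A> \<Longrightarrow> open (snd C ` fst C)"
  and chart_homeomorphic: "C \<in> \<A> \<Longrightarrow> homeomorphic_map (subtopology T (fst C)) (top_of_set (snd C ` fst C)) (snd C)"
  using chart[of C] by (auto simp: is_chart_def split: prod.splits)

lemma chart_topspace: "C \<in> \<A> \<Longrightarrow> topspace (subtopology T (fst C)) = fst C"
  using chart_open openin_subset by (metis topspace_subtopology_subset)

lemma chart_inj: "C \<in> \<A> \<Longrightarrow> inj_on (snd C) (fst C)"
  using chart_homeomorphic chart_topspace by (metis homeomorphic_imp_injective_map)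

lemma chart_inv_left: "C \<in> \<A> \<Longrightarrow> p \<in> fst C \<Longrightarrow> chart_inv C (snd C p) = p"
  using chart_inj by (simp add: inv_into_f_f)

lemma chart_inv_in: "v \<in> snd C ` fst C \<Longrightarrow> chart_inv C v \<in> fst C"
  and chart_inv_right: "v \<in> snd C ` fst C \<Longrightarrow> snd C (chart_inv C v) = v"
  by (simp_all add: inv_into_into f_inv_into_f)

lemma chart_image_open_subset:
  assumes "C \<in> \<A>" "openin T W" shows "open (snd C ` (W \<inter> fst C))"
proof -
  have "openin (subtopology T (fst C)) (W \<inter> fst C)" using assms by (auto simp: openin_subtopology)
  then have "openin (top_of_set (snd C ` fst C)) (snd C ` (W \<inter> fst C))"
    using chart_homeomorphic[OF assms(1)] homeomorphic_imp_open_map open_map_def by blast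
  then show ?thesis using openin_open_trans chart_image_open[OF assms(1)] by blast
qed

lemma chart_at: assumes "p \<in> topspace T" obtains C where "C \<in> \<A>" "p \<in> fst C"
proof -
  have "p \<in> (\<Union>C\<in>\<A>. fst C)" using manifold assms by (simp add: smooth_manifold_def)
  then show ?thesis using that by blast
qed

lemma transition_smooth:
  assumes "C \<in> \<A>" "D \<in> \<A>"
  shows "smooth_on (snd C ` (fst C \<inter> fst D)) (\<lambda>v. snd D (chart_inv C v))"
proof -
  have "compatible C D" using manifold assms by (simp add: smooth_manifold_def)
  then show ?thesis by (simp add: compatible_def smooth_in_charts_def local_rep_def o_def)
qed

abbreviation "smooth_near S c x \<equiv> \<exists>N C. open N \<and> x \<in> N \<and> N \<subseteq> S \<and> C \<in> \<A> \<and>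
  c ` N \<subseteq> fst C \<and> smooth_on N (\<lambda>y. snd C (c y))"

text \<open>One chart near each point suffices: continuity follows because a chart is injective and
  carries open sets to open sets, and smoothness in the remaining charts follows from the transition
  maps.\<close>

lemma smooth_paramI:
  assumes "open S"
    and loc: "\<And>x. x \<in> S \<Longrightarrow> smooth_near S c x"
  shows "smooth_param T \<A> S c"
proof -
  have open_pre: "open (S \<inter> c -` W)" if W: "openin T W" for W
  proof (subst open_subopen, intro ballI)
    fix x assume x: "x \<in> S \<inter> c -` W"
    then obtain N C where N: "open N" "x \<in> N" "N \<subseteq> S" "C \<in> \<A>" "c ` N \<subseteq> fst C" "smooth_on N (\<lambda>y. snd C (c y))"
      using loc[of x] by blast
    let ?M = "N \<inter> (\<lambda>y. snd C (c y)) -` (snd C ` (W \<inter> fst C))"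
    have "open ?M"
      by (rule continuous_open_preimage[OF smooth_on_continuous[OF N(6)] N(1) chart_image_open_subset[OF N(4) W]])
    moreover have "x \<in> ?M" using x N by auto
    moreover have "?M \<subseteq> S \<inter> c -` W"
    proof
      fix y assume y: "y \<in> ?M"
      then obtain q where q: "q \<in> W" "q \<in> fst C" "snd C (c y) = snd C q" by auto
      then have "c y = q" using chart_inj[OF N(4)] y N(5) by (auto dest: inj_onD)
      then show "y \<in> S \<inter> c -` W" using q y N(3) by auto
    qed
    ultimately show "\<exists>M. open M \<and> x \<in> M \<and> M \<subseteq> S \<inter> c -` W" by blast
  qed
  have inT: "c x \<in> topspace T" if "x \<in> S" for x
    using loc[OF that] chart_open openin_subset by blast
  have "continuous_map (top_of_set S) T c"
    unfolding continuous_map_def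
  proof (intro conjI allI impI)
    show "c \<in> topspace (top_of_set S) \<rightarrow> topspace T" using inT by auto
    fix W assume "openin T W"
    from open_pre[OF this] have "open {x \<in> S. c x \<in> W}" by (simp add: vimage_def Int_def)
    then show "openin (top_of_set S) {x \<in> topspace (top_of_set S). c x \<in> W}"
      using assms(1) by (simp add: openin_open_eq)
  qed
  moreover have "smooth_on (S \<inter> c -` fst D) (snd D \<circ> c)" if D: "D \<in> \<A>" for D
  proof (rule smooth_on_local)
    fix x assume x: "x \<in> S \<inter> c -` fst D"
    then obtain N C where N: "open N" "x \<in> N" "N \<subseteq> S" "C \<in> \<A>" "c ` N \<subseteq> fst C" "smooth_on N (\<lambda>y. snd C (c y))"
      using loc[of x] by blast
    let ?M = "N \<inter> (S \<inter> c -` fst D)"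
    have M: "open ?M" using N(1) open_pre[OF chart_open[OF D]] by blast
    have "smooth_on ?M (\<lambda>y. snd D (chart_inv C (snd C (c y))))"
      by (rule smooth_on_compose[OF M chart_image_open_subset[OF N(4) chart_open[OF D]]])
         (use transition_smooth[OF N(4) D] N(5) smooth_on_subset[OF N(6)] in \<open>auto simp: Int_commute\<close>)
    then have "smooth_on ?M (snd D \<circ> c)"
      by (rule smooth_on_cong[OF M, rotated]) (use N(5) chart_inv_left[OF N(4)] in auto)
    then show "\<exists>M. open M \<and> x \<in> M \<and> smooth_on M (snd D \<circ> c)" using M N x by blast
  qed
  ultimately show ?thesis by (simp add: smooth_param_def)
qed

lemma smooth_param_local:
  assumes "open S" and loc: "\<And>x. x \<in> S \<Longrightarrow> \<exists>N. open N \<and> x \<in> N \<and> N \<subseteq> S \<and> smooth_param T \<A> N c"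
  shows "smooth_param T \<A> S c"
proof (rule smooth_paramI[OF assms(1)])
  fix x assume x: "x \<in> S"
  then obtain N where N: "open N" "x \<in> N" "N \<subseteq> S" "smooth_param T \<A> N c" using loc by blast
  obtain C where C: "C \<in> \<A>" "c x \<in> fst C" using chart_at smooth_param_in N by metis
  show "smooth_near S c x"
    using smooth_param_open_preimage[OF N(4,1) chart_open[OF C(1)]] smooth_param_chart[OF N(4) C(1)] N C
    by (intro exI[of _ "N \<inter> c -` fst C"] exI[of _ C]) auto
qed

lemma smooth_param_cong:
  assumes "open S" "smooth_param T \<A> S c" "\<And>x. x \<in> S \<Longrightarrow> c x = d x"
  shows "smooth_param T \<A> S d"
proof (rule smooth_paramI[OF assms(1)])
  fix x assume x: "x \<in> S"
  obtain C where C: "C \<in> \<A>" "c x \<in> fst C" using chart_at smooth_param_in[OF assms(2) x] by metis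
  let ?N = "S \<inter> c -` fst C"
  have N: "open ?N" by (rule smooth_param_open_preimage[OF assms(2,1) chart_open[OF C(1)]])
  have "smooth_on ?N (\<lambda>y. snd C (d y))"
    by (rule smooth_on_cong[OF N _ smooth_param_chart[OF assms(2) C(1)]]) (simp add: assms(3))
  then show "smooth_near S d x"
    using N x C by (intro exI[of _ ?N] exI[of _ C]) (auto simp: assms(3)[symmetric])
qed

lemma smooth_param_compose:
  fixes f :: "'a::real_normed_vector \<Rightarrow> 'b::{real_inner,heine_borel}"
  assumes "open R" "open S" "smooth_param T \<A> S c" "smooth_on R f" "f ` R \<subseteq> S"
  shows "smooth_param T \<A> R (\<lambda>x. c (f x))"
proof (rule smooth_paramI[OF assms(1)])
  fix x assume x: "x \<in> R"
  then have fx: "f x \<in> S" using assms(5) by auto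
  obtain C where C: "C \<in> \<A>" "c (f x) \<in> fst C" using chart_at smooth_param_in[OF assms(3) fx] by metis
  let ?M = "S \<inter> c -` fst C"
  have M: "open ?M" by (rule smooth_param_open_preimage[OF assms(3,2) chart_open[OF C(1)]])
  let ?N = "R \<inter> f -` ?M"
  have N: "open ?N" by (rule continuous_open_preimage[OF smooth_on_continuous[OF assms(4)] assms(1) M])
  have "smooth_on ?N (\<lambda>y. snd C (c (f y)))"
    by (rule smooth_on_compose[OF N M smooth_param_chart[OF assms(3) C(1)] smooth_on_subset[OF assms(4)]]) auto
  then show "smooth_near R (\<lambda>x. c (f x)) x"
    using N x C fx by (intro exI[of _ ?N] exI[of _ C]) auto
qed

lemma smooth_param_const:
  assumes "p \<in> topspace T" "open S" shows "smooth_param T \<A> S (\<lambda>x. p)"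
proof (rule smooth_paramI[OF assms(2)])
  fix x assume "x \<in> S"
  moreover obtain C where "C \<in> \<A>" "p \<in> fst C" using chart_at assms by metis
  ultimately show "smooth_near S (\<lambda>x. p) x"
    using assms(2) by (intro exI[of _ S] exI[of _ C]) (auto simp: smooth_on_const)
qed

lemma smooth_param_chart_inv:
  assumes "C \<in> \<A>" shows "smooth_param T \<A> (snd C ` fst C) (chart_inv C)"
proof (rule smooth_paramI[OF chart_image_open[OF assms]])
  fix x assume x: "x \<in> snd C ` fst C"
  have "smooth_on (snd C ` fst C) (\<lambda>y. snd C (chart_inv C y))"
    by (rule smooth_on_cong[OF chart_image_open[OF assms] _ smooth_on_linear[OF bounded_linear_ident]])
       (simp add: chart_inv_right)
  then show "smooth_near (snd C ` fst C) (chart_inv C) x"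
    using x chart_image_open[OF assms] assms
    by (intro exI[of _ "snd C ` fst C"] exI[of _ C]) (auto simp: chart_inv_in)
qed

lemma smooth_param_derivative:
  assumes "open S" "smooth_param T \<A> S c" "x \<in> S" "C \<in> \<A>" "c x \<in> fst C"
  shows "((\<lambda>y. snd C (c y)) has_derivative fderiv (\<lambda>y. snd C (c y)) x) (at x)"
  using smooth_on_derivative[OF smooth_param_chart[OF assms(2,4)], of x] assms(3,5) by simp

lemma chain_rule:
  assumes "open S" "smooth_param T \<A> S c" "x \<in> S" "C \<in> \<A>" "c x \<in> fst C"
    and c': "((\<lambda>y. snd C (c y)) has_derivative c') (at x)"
    and F: "local_rep C D F differentiable (at (snd C (c x)))"
  shows "((\<lambda>y. snd D (F (c y))) has_derivative (\<lambda>v. differential C D F (c x) (c' v))) (at x)"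
proof -
  let ?N = "S \<inter> c -` fst C"
  have N: "open ?N" "x \<in> ?N" using smooth_param_open_preimage[OF assms(2,1) chart_open[OF assms(4)]] assms by auto
  have "(local_rep C D F has_derivative differential C D F (c x)) (at (snd C (c x)))"
    using F unfolding differential_def by (simp add: frechet_derivative_works)
  from diff_chain_at[OF c' this]
  have "((\<lambda>y. local_rep C D F (snd C (c y))) has_derivative (\<lambda>v. differential C D F (c x) (c' v))) (at x)"
    by (simp add: o_def)
  then show ?thesis
    by (rule has_derivative_transform_within_open[OF _ N])
       (use chart_inv_left[OF assms(4)] in \<open>auto simp: local_rep_def\<close>)
qed

lemma chain_rule_curve:
  assumes "open S" "smooth_param T \<A> S c" "t \<in> S" "C \<in> \<A>" "c t \<in> fst C"
    and c': "((\<lambda>y. snd C (c y)) has_vector_derivative c') (at t)"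
    and F: "local_rep C D F differentiable (at (snd C (c t)))"
  shows "((\<lambda>y. snd D (F (c y))) has_vector_derivative differential C D F (c t) c') (at t)"
proof -
  have "linear (differential C D F (c t))" unfolding differential_def
    using F frechet_derivative_works has_derivative_linear by blast
  then show ?thesis
    using chain_rule[OF assms(1-5) c'[unfolded has_vector_derivative_def] F]
    by (simp add: has_vector_derivative_def linear_scale)
qed

lemma smooth_map_smooth_param:
  assumes "manifold T' \<B>" "smooth_map T \<A> T' \<B> F" "open S" "smooth_param T \<A> S c"
  shows "smooth_param T' \<B> S (\<lambda>x. F (c x))"
proof -
  interpret N: manifold T' \<B> by fact
  have contF: "continuous_map T T' F" using assms(2) by (simp add: smooth_map_def)
  have cont: "continuous_map (top_of_set S) T' (\<lambda>x. F (c x))"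
    using continuous_map_compose[OF _ contF] assms(4) unfolding smooth_param_def o_def by blast
  show ?thesis
  proof (rule N.smooth_paramI[OF assms(3)])
    fix x assume x: "x \<in> S"
    obtain C where C: "C \<in> \<A>" "c x \<in> fst C" using chart_at smooth_param_in[OF assms(4) x] by metis
    have "F (c x) \<in> topspace T'" using contF smooth_param_in[OF assms(4) x] by (auto simp: continuous_map_def)
    then obtain D where D: "D \<in> \<B>" "F (c x) \<in> fst D" using N.chart_at by metis
    let ?N = "(S \<inter> c -` fst C) \<inter> (S \<inter> (\<lambda>x. F (c x)) -` fst D)"
    have oN: "open ?N"
      using smooth_param_open_preimage[OF assms(4,3) chart_open[OF C(1)]]
        continuous_map_open_preimage[OF cont assms(3) N.chart_open[OF D(1)]] by blast
    have op: "open (snd C ` (fst C \<inter> F -` fst D))"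
    proof -
      have "openin T (topspace T \<inter> F -` fst D)"
        using openin_continuous_map_preimage[OF contF N.chart_open[OF D(1)]] by (simp add: vimage_def Int_def)
      from chart_image_open_subset[OF C(1) this]
      have "open (snd C ` (topspace T \<inter> F -` fst D \<inter> fst C))" .
      moreover have "topspace T \<inter> F -` fst D \<inter> fst C = fst C \<inter> F -` fst D"
        using chart_open[OF C(1)] openin_subset by fastforce
      ultimately show ?thesis by simp
    qed
    have sm: "smooth_on (snd C ` (fst C \<inter> F -` fst D)) (local_rep C D F)"
      using assms(2) C D by (simp add: smooth_map_def smooth_in_charts_def)
    have "smooth_on ?N (\<lambda>y. local_rep C D F (snd C (c y)))"
      by (rule smooth_on_compose[OF oN op sm smooth_on_subset[OF smooth_param_chart[OF assms(4) C(1)]]]) auto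
    then have "smooth_on ?N (\<lambda>y. snd D (F (c y)))"
      by (rule smooth_on_cong[OF oN, rotated]) (use chart_inv_left[OF C(1)] in \<open>auto simp: local_rep_def\<close>)
    then show "N.smooth_near S (\<lambda>x. F (c x)) x"
      using oN x C D by (intro exI[of _ ?N] exI[of _ D]) auto
  qed
qed

lemma local_rep_smooth:
  assumes "manifold T' \<B>" "C \<in> \<A>" "D \<in> \<B>"
    and "smooth_param T' \<B> (snd C ` fst C) (\<lambda>v. F (chart_inv C v))"
  shows "open (snd C ` (fst C \<inter> F -` fst D))" "smooth_on (snd C ` (fst C \<inter> F -` fst D)) (local_rep C D F)"
proof -
  interpret N: manifold T' \<B> by fact
  have eq: "snd C ` fst C \<inter> (\<lambda>v. F (chart_inv C v)) -` fst D = snd C ` (fst C \<inter> F -` fst D)"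
    using chart_inv_left[OF assms(2)] by auto
  show "open (snd C ` (fst C \<inter> F -` fst D))"
    using smooth_param_open_preimage[OF assms(4) chart_image_open[OF assms(2)] N.chart_open[OF assms(3)]]
    by (simp only: eq)
  show "smooth_on (snd C ` (fst C \<inter> F -` fst D)) (local_rep C D F)"
    using smooth_param_chart[OF assms(4,3)] unfolding eq by (simp add: local_rep_def o_def)
qed

lemma local_rep_differentiable:
  assumes "manifold T' \<B>" "C \<in> \<A>" "D \<in> \<B>" "p \<in> fst C" "F p \<in> fst D"
    and "smooth_param T' \<B> (snd C ` fst C) (\<lambda>v. F (chart_inv C v))"
  shows "local_rep C D F differentiable (at (snd C p))"
  using smooth_on_derivative[OF local_rep_smooth(2)[OF assms(1-3,6)], of "snd C p"] assms(4,5)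
  by (auto simp: differentiable_def)

end

section \<open>Lie groups\<close>

locale lie = group G for G :: "'g monoid" (structure) +
  fixes T :: "'g topology" and \<A> :: "('g, 'e::{real_inner, heine_borel}) chart set"
  assumes lie_group: "lie_group G T \<A>"

sublocale lie \<subseteq> manifold T \<A>
  using lie_group by unfold_locales (simp add: lie_group_def)

context lie begin

lemma topspace_eq: "topspace T = carrier G"
  using lie_group by (simp add: lie_group_def)

lemma continuous_map_mult:
  assumes "continuous_map X T c" "continuous_map X T d"
  shows "continuous_map X T (\<lambda>x. c x \<otimes> d x)"
proof -
  have "continuous_map (prod_topology T T) T (\<lambda>(x, y). x \<otimes> y)"
    using lie_group by (simp add: lie_group_def)
  from continuous_map_compose[OF _ this, of X "\<lambda>x. (c x, d x)"] assms
  show ?thesis by (simp add: o_def continuous_map_pairedI)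
qed

lemma mult_smooth:
  "\<forall>C\<in>\<A>. \<forall>D\<in>\<A>. \<forall>K\<in>\<A>. smooth_on {(snd C a, snd D b) | a b. a \<in> fst C \<and> b \<in> fst D \<and> a \<otimes> b \<in> fst K}
     (\<lambda>(u, v). snd K (chart_inv C u \<otimes> chart_inv D v))"
  using lie_group by (simp add: lie_group_def case_prod_unfold)

lemma smooth_param_mult:
  assumes "open S" "smooth_param T \<A> S c" "smooth_param T \<A> S d"
  shows "smooth_param T \<A> S (\<lambda>x. c x \<otimes> d x)"
proof (rule smooth_paramI[OF assms(1)])
  fix x assume x: "x \<in> S"
  obtain C where C: "C \<in> \<A>" "c x \<in> fst C" using chart_at smooth_param_in[OF assms(2) x] by metis
  obtain D where D: "D \<in> \<A>" "d x \<in> fst D" using chart_at smooth_param_in[OF assms(3) x] by metis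
  have "c x \<otimes> d x \<in> topspace T"
    using smooth_param_in[OF assms(2) x] smooth_param_in[OF assms(3) x] by (simp add: topspace_eq)
  then obtain K where K: "K \<in> \<A>" "c x \<otimes> d x \<in> fst K" using chart_at by metis
  let ?W = "snd C ` fst C \<times> snd D ` fst D"
  have W: "open ?W" using chart_image_open C D by (simp add: open_Times)
  let ?m = "\<lambda>(u, v). chart_inv C u \<otimes> chart_inv D v"
  \<comment> \<open>\<open>lie_group\<close> states smoothness of the product in coordinates on a
    set not declared to be open. Continuity of the product shows that it is open, as the composition
    lemma requires.\<close>
  have "continuous_map (top_of_set ?W) T (\<lambda>w. chart_inv C (fst w) \<otimes> chart_inv D (snd w))"
  proof (rule continuous_map_mult)
    have f: "continuous_map (top_of_set ?W) (top_of_set (snd C ` fst C)) fst"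
      and s: "continuous_map (top_of_set ?W) (top_of_set (snd D ` fst D)) snd"
      by (auto intro!: continuous_intros)
    show "continuous_map (top_of_set ?W) T (\<lambda>w. chart_inv C (fst w))"
      using continuous_map_compose[OF f] smooth_param_chart_inv[OF C(1)] unfolding smooth_param_def o_def by blast
    show "continuous_map (top_of_set ?W) T (\<lambda>w. chart_inv D (snd w))"
      using continuous_map_compose[OF s] smooth_param_chart_inv[OF D(1)] unfolding smooth_param_def o_def by blast
  qed
  from continuous_map_open_preimage[OF this W chart_open[OF K(1)]]
  have O: "open (?W \<inter> (\<lambda>w. chart_inv C (fst w) \<otimes> chart_inv D (snd w)) -` fst K)" .
  have eq: "?W \<inter> (\<lambda>w. chart_inv C (fst w) \<otimes> chart_inv D (snd w)) -` fst K =
    {(snd C a, snd D b) | a b. a \<in> fst C \<and> b \<in> fst D \<and> a \<otimes> b \<in> fst K}" (is "?L = ?R")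
  proof (rule Set.set_eqI)
    fix w show "w \<in> ?L \<longleftrightarrow> w \<in> ?R"
      using chart_inv_left[OF C(1)] chart_inv_left[OF D(1)] by (cases w) fastforce
  qed
  have sm: "smooth_on ?R (\<lambda>(u, v). snd K (chart_inv C u \<otimes> chart_inv D v))"
    using mult_smooth C(1) D(1) K(1) by blast
  let ?N = "(S \<inter> c -` fst C) \<inter> (S \<inter> d -` fst D) \<inter> (S \<inter> (\<lambda>x. c x \<otimes> d x) -` fst K)"
  have "continuous_map (top_of_set S) T (\<lambda>x. c x \<otimes> d x)"
    using assms by (intro continuous_map_mult) (auto simp: smooth_param_def)
  from continuous_map_open_preimage[OF this assms(1) chart_open[OF K(1)]]
  have N: "open ?N"
    using smooth_param_open_preimage[OF assms(2,1) chart_open[OF C(1)]]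
      smooth_param_open_preimage[OF assms(3,1) chart_open[OF D(1)]] by blast
  have pair: "smooth_on ?N (\<lambda>y. (snd C (c y), snd D (d y)))"
    by (intro smooth_on_Pair N smooth_on_subset[OF smooth_param_chart[OF assms(2) C(1)]]
        smooth_on_subset[OF smooth_param_chart[OF assms(3) D(1)]]) auto
  have im: "(\<lambda>y. (snd C (c y), snd D (d y))) ` ?N \<subseteq> ?R" by auto
  have "smooth_on ?N (\<lambda>y. (\<lambda>(u, v). snd K (chart_inv C u \<otimes> chart_inv D v)) (snd C (c y), snd D (d y)))"
    by (rule smooth_on_compose[OF N O[unfolded eq] sm pair im])
  then have "smooth_on ?N (\<lambda>y. snd K (c y \<otimes> d y))"
    by (rule smooth_on_cong[OF N, rotated]) (use chart_inv_left[OF C(1)] chart_inv_left[OF D(1)] in auto)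
  then show "smooth_near S (\<lambda>x. c x \<otimes> d x) x"
    using N x C D K by (intro exI[of _ ?N] exI[of _ K]) auto
qed

lemma smooth_param_inverse:
  assumes "open S" "smooth_param T \<A> S c"
  shows "smooth_param T \<A> S (\<lambda>x. inv (c x))"
proof -
  have "smooth_map T \<A> T \<A> (\<lambda>x. inv x)" using lie_group by (simp add: lie_group_def)
  then show ?thesis using smooth_map_smooth_param[OF manifold_axioms _ assms] by blast
qed

lemma smooth_param_mult_const:
  assumes "open S" "smooth_param T \<A> S c" "a \<in> carrier G"
  shows "smooth_param T \<A> S (\<lambda>x. a \<otimes> c x)" "smooth_param T \<A> S (\<lambda>x. c x \<otimes> a)"
  using assms by (auto intro!: smooth_param_mult smooth_param_const simp: topspace_eq)

end

subsection \<open>One-parameter subgroups\<close>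

text \<open>A local homomorphism from the line extends by \<open>\<sigma> t = (\<sigma>\<^sub>0 (t / n)) ^ n\<close> for large \<open>n\<close>.\<close>

lemma (in group) extend_local_homomorphism:
  fixes \<sigma>0 :: "real \<Rightarrow> 'a" and \<delta> :: real
  assumes "\<delta> > 0" and carr: "\<And>t. \<bar>t\<bar> < \<delta> \<Longrightarrow> \<sigma>0 t \<in> carrier G"
    and hom: "\<And>s t. \<bar>s\<bar> < \<delta> \<Longrightarrow> \<bar>t\<bar> < \<delta> \<Longrightarrow> \<sigma>0 (s + t) = \<sigma>0 s \<otimes> \<sigma>0 t"
  obtains \<sigma> where "\<And>s t. \<sigma> (s + t) = \<sigma> s \<otimes> \<sigma> t" "\<And>t. \<sigma> t \<in> carrier G" "\<And>t. \<bar>t\<bar> < \<delta> \<Longrightarrow> \<sigma> t = \<sigma>0 t"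
proof -
  have zero: "\<sigma>0 0 = \<one>"
  proof -
    have "\<sigma>0 0 \<otimes> \<sigma>0 0 = \<sigma>0 0" using hom[of 0 0] assms(1) by simp
    then show ?thesis using carr[of 0] assms(1) by (metis abs_zero r_cancel_one)
  qed
  have pow: "\<sigma>0 (real m * x) = \<sigma>0 x [^] m" if "\<bar>real m * x\<bar> < \<delta>" for m x
    using that
  proof (induction m)
    case 0
    then show ?case by (simp add: zero)
  next
    case (Suc m)
    have le: "\<bar>real m * x\<bar> \<le> \<bar>real (Suc m) * x\<bar>" "\<bar>x\<bar> \<le> \<bar>real (Suc m) * x\<bar>"
    proof -
      have "\<bar>real (Suc m) * x\<bar> = real m * \<bar>x\<bar> + \<bar>x\<bar>" "\<bar>real m * x\<bar> = real m * \<bar>x\<bar>"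
        unfolding abs_mult by (simp_all add: distrib_right)
      then show "\<bar>real m * x\<bar> \<le> \<bar>real (Suc m) * x\<bar>" "\<bar>x\<bar> \<le> \<bar>real (Suc m) * x\<bar>" by simp_all
    qed
    then have lt: "\<bar>real m * x\<bar> < \<delta>" "\<bar>x\<bar> < \<delta>" using Suc.prems by linarith+
    have "\<sigma>0 (real (Suc m) * x) = \<sigma>0 (real m * x + x)" by (simp add: algebra_simps)
    then show ?case using hom[OF lt] Suc.IH[OF lt(1)] by simp
  qed
  \<comment> \<open>Enough steps to bring \<open>t / real (N t)\<close> into the given domain;
    \<open>Suc\<close> makes the estimate strict and the number positive for
    \<open>t = 0\<close>.\<close>
  define N where "N t = Suc (nat \<lceil>\<bar>t\<bar> / \<delta>\<rceil>)" for t
  define \<sigma> where "\<sigma> t = \<sigma>0 (t / real (N t)) [^] N t" for t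
  have N: "\<bar>t\<bar> < real (N t) * \<delta>" "N t > 0" for t
  proof -
    have "\<bar>t\<bar> / \<delta> \<le> real (nat \<lceil>\<bar>t\<bar> / \<delta>\<rceil>)" by (rule real_nat_ceiling_ge)
    then have "\<bar>t\<bar> / \<delta> < real (N t)" by (simp add: N_def)
    then show "\<bar>t\<bar> < real (N t) * \<delta>" using assms(1) by (simp add: field_simps)
  qed (simp add: N_def)
  have small: "\<bar>t / real n\<bar> < \<delta>" if "\<bar>t\<bar> < real n * \<delta>" for t n
  proof -
    have "n > 0" using that by (cases n) auto
    then show ?thesis using that by (simp add: field_simps)
  qed
  \<comment> \<open>Independence of the number of steps: both powers are powers of the value at the
    common refinement \<open>?x\<close>.\<close>
  have any: "\<sigma> t = \<sigma>0 (t / real n) [^] n" if n: "\<bar>t\<bar> < real n * \<delta>" for t n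
  proof -
    let ?M = "N t" and ?x = "t / (real n * real (N t))"
    have n0: "n > 0" using n by (cases n) auto
    have 1: "t / real ?M = real n * ?x" "t / real n = real ?M * ?x" using n0 N(2)[of t] by simp_all
    have c: "\<sigma>0 ?x \<in> carrier G"
    proof (rule carr)
      have "\<bar>?x\<bar> = \<bar>t / real n\<bar> / real ?M" by (simp only: abs_divide abs_mult abs_of_nat divide_divide_eq_left)
      also have "\<dots> \<le> \<bar>t / real n\<bar> / 1" using N(2)[of t] by (intro divide_left_mono) auto
      finally have "\<bar>?x\<bar> \<le> \<bar>t / real n\<bar>" by (simp only: div_by_1)
      then show "\<bar>?x\<bar> < \<delta>" by (rule le_less_trans[OF _ small[OF n]])
    qed
    have "\<sigma>0 (t / real ?M) = \<sigma>0 ?x [^] n" 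
      unfolding 1(1) by (rule pow, unfold 1(1)[symmetric], rule small[OF N(1)])
    moreover have "\<sigma>0 (t / real n) = \<sigma>0 ?x [^] ?M" 
      unfolding 1(2) by (rule pow, unfold 1(2)[symmetric], rule small[OF n])
    ultimately show ?thesis using c by (simp add: \<sigma>_def nat_pow_pow mult.commute)
  qed
  show ?thesis
  proof
    show carr_\<sigma>: "\<sigma> t \<in> carrier G" for t
      unfolding \<sigma>_def using carr[OF small[OF N(1)]] by simp
    show "\<sigma> t = \<sigma>0 t" if "\<bar>t\<bar> < \<delta>" for t
      using any[of t 1] carr[OF that] that by simp
    fix s t
    define n where "n = N (\<bar>s\<bar> + \<bar>t\<bar>)"
    have "\<bar>s\<bar> + \<bar>t\<bar> < real n * \<delta>" using N(1)[of "\<bar>s\<bar> + \<bar>t\<bar>"] by (simp add: n_def)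
    then have b: "\<bar>s\<bar> < real n * \<delta>" "\<bar>t\<bar> < real n * \<delta>" "\<bar>s + t\<bar> < real n * \<delta>" by linarith+
    let ?a = "\<sigma>0 (s / real n)" and ?b = "\<sigma>0 (t / real n)"
    \<comment> \<open>Addition of reals commutes, hence so do these two values, and the power of
      their product splits.\<close>
    have "\<sigma>0 (s / real n + t / real n) = ?a \<otimes> ?b" "\<sigma>0 (t / real n + s / real n) = ?b \<otimes> ?a"
      using small[OF b(1)] small[OF b(2)] by (auto intro: hom)
    then have ab: "\<sigma>0 ((s + t) / real n) = ?a \<otimes> ?b" "?a \<otimes> ?b = ?b \<otimes> ?a"
      by (simp_all add: add_divide_distrib add.commute)
    have "(?a \<otimes> ?b) [^] n = ?a [^] n \<otimes> ?b [^] n"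
      using carr[OF small[OF b(1)]] carr[OF small[OF b(2)]] ab(2) by (intro pow_mult_distrib)
    then show "\<sigma> (s + t) = \<sigma> s \<otimes> \<sigma> t"
      using any[OF b(1)] any[OF b(2)] any[OF b(3)] ab(1) by simp
  qed
qed

locale lie_chart = lie G T \<A> for G :: "'g monoid" (structure) and T :: "'g topology"
    and \<A> :: "('g, 'e::{real_inner, heine_borel}) chart set" +
  fixes E :: "('g, 'e) chart"
  assumes E: "E \<in> \<A>" and one_E: "\<one> \<in> fst E"
begin

abbreviation "\<phi> \<equiv> snd E"
abbreviation "\<iota> \<equiv> chart_inv E"
abbreviation "e\<^sub>0 \<equiv> snd E \<one>"
abbreviation "V \<equiv> snd E ` fst E"
abbreviation "bracket \<equiv> lie_bracket G E"

lemma open_V: "open V" using chart_image_open[OF E] .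
lemma e0_V: "e\<^sub>0 \<in> V" using one_E by blast
lemma \<iota>_e0: "\<iota> e\<^sub>0 = \<one>" using chart_inv_left[OF E one_E] .
lemma \<iota>_E: "v \<in> V \<Longrightarrow> \<iota> v \<in> fst E" by (rule chart_inv_in)
lemma \<phi>_\<iota>: "v \<in> V \<Longrightarrow> \<phi> (\<iota> v) = v" by (rule chart_inv_right)
lemma \<iota>_\<phi>: "a \<in> fst E \<Longrightarrow> \<iota> (\<phi> a) = a" using chart_inv_left[OF E] .
lemma E_carrier: "a \<in> fst E \<Longrightarrow> a \<in> carrier G"
  using chart_open[OF E] openin_subset topspace_eq by blast
lemma \<iota>_carrier: "v \<in> V \<Longrightarrow> \<iota> v \<in> carrier G" using \<iota>_E E_carrier by blast
lemma smooth_\<iota>: "smooth_param T \<A> V \<iota>" using smooth_param_chart_inv[OF E] .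

lemma smooth_\<iota>_fst: "smooth_param T \<A> (V \<times> V) (\<lambda>w. \<iota> (fst w))"
  and smooth_\<iota>_snd: "smooth_param T \<A> (V \<times> V) (\<lambda>w. \<iota> (snd w))"
  by (rule smooth_param_compose[OF _ open_V smooth_\<iota>];
      auto intro!: open_Times open_V smooth_on_linear bounded_linear_fst bounded_linear_snd)+

section \<open>Group law and left invariant fields in the chart around the identity\<close>

definition dom_mul :: "('e \<times> 'e) set" where
  "dom_mul = (V \<times> V) \<inter> (\<lambda>w. \<iota> (fst w) \<otimes> \<iota> (snd w)) -` fst E"

definition mul :: "'e \<times> 'e \<Rightarrow> 'e" where
  "mul w = \<phi> (\<iota> (fst w) \<otimes> \<iota> (snd w))"

lemma smooth_param_\<iota>_mult: "smooth_param T \<A> (V \<times> V) (\<lambda>w. \<iota> (fst w) \<otimes> \<iota> (snd w))"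
  by (intro smooth_param_mult smooth_\<iota>_fst smooth_\<iota>_snd open_Times open_V)

lemma open_dom_mul: "open dom_mul"
  unfolding dom_mul_def
  by (rule smooth_param_open_preimage[OF smooth_param_\<iota>_mult _ chart_open[OF E]]) (simp add: open_Times open_V)

lemma smooth_mul: "smooth_on dom_mul mul"
  unfolding dom_mul_def mul_def using smooth_param_chart[OF smooth_param_\<iota>_mult E] .

lemma dom_mul_right: "u \<in> V \<Longrightarrow> (u, e\<^sub>0) \<in> dom_mul" and mul_right: "u \<in> V \<Longrightarrow> mul (u, e\<^sub>0) = u"
  and mul_left: "u \<in> V \<Longrightarrow> mul (e\<^sub>0, u) = u"
  using e0_V \<iota>_E \<iota>_carrier \<phi>_\<iota> by (auto simp: dom_mul_def mul_def \<iota>_e0)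

lemma mul_V: "w \<in> dom_mul \<Longrightarrow> mul w \<in> V"
  and \<iota>_mul: "w \<in> dom_mul \<Longrightarrow> \<iota> (mul w) = \<iota> (fst w) \<otimes> \<iota> (snd w)"
  by (auto simp: dom_mul_def mul_def \<iota>_\<phi>)

text \<open>The left invariant vector field with value \<open>Z\<close> at the identity, in the
  coordinates of \<open>E\<close>.\<close>

definition left_field :: "'e \<Rightarrow> 'e \<Rightarrow> 'e" where
  "left_field Z u = fderiv mul (u, e\<^sub>0) (0, Z)"

lemma smooth_left_field: "smooth_on V (left_field Z)"
proof -
  have "smooth_on V (\<lambda>u. fderiv mul ((\<lambda>u. (u, e\<^sub>0)) u) ((\<lambda>u. (0, Z)) u))"
    by (rule smooth_on_frechet_derivative[OF open_V open_dom_mul smooth_mul])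
       (use dom_mul_right in \<open>auto intro!: smooth_on_Pair open_V smooth_on_const smooth_on_linear[OF bounded_linear_ident]\<close>)
  then show ?thesis by (simp add: left_field_def[abs_def])
qed

lemma mul_partial:
  assumes "(u, v) \<in> dom_mul" "(f has_derivative f') (at x)" "f x = v"
  shows "((\<lambda>y. mul (u, f y)) has_derivative (\<lambda>z. fderiv mul (u, v) (0, f' z))) (at x)"
proof -
  have "((\<lambda>y. (u, f y)) has_derivative (\<lambda>z. (0, f' z))) (at x)"
    using assms(2) by (auto intro!: derivative_eq_intros)
  from diff_chain_at[OF this, of mul] smooth_on_derivative[OF smooth_mul assms(1)] assms(3)
  show ?thesis by (simp add: o_def)
qed

lemma left_field_e0: "left_field Z e\<^sub>0 = Z"
proof -
  have "((\<lambda>y. mul (e\<^sub>0, y)) has_derivative (\<lambda>z. fderiv mul (e\<^sub>0, e\<^sub>0) (0, z))) (at e\<^sub>0)"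
    by (rule mul_partial[OF dom_mul_right[OF e0_V] has_derivative_ident]) simp
  moreover have "((\<lambda>y. mul (e\<^sub>0, y)) has_derivative (\<lambda>z. z)) (at e\<^sub>0)"
    by (rule has_derivative_transform_within_open[OF has_derivative_ident open_V e0_V]) (simp add: mul_left)
  ultimately show ?thesis using has_derivative_unique unfolding left_field_def by metis
qed

text \<open>Associativity, \<open>mul (u, mul (v, y)) = mul (mul (u, v), y)\<close>, differentiated
  in \<open>y\<close> at the identity.\<close>

lemma left_field_invariant:
  assumes uv: "(u, v) \<in> dom_mul"
  shows "fderiv mul (u, v) (0, left_field Z v) = left_field Z (mul (u, v))"
proof -
  have v: "v \<in> V" using uv by (auto simp: dom_mul_def)
  have 1: "((\<lambda>y. mul (v, y)) has_derivative (\<lambda>z. fderiv mul (v, e\<^sub>0) (0, z))) (at e\<^sub>0)"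
    by (rule mul_partial[OF dom_mul_right[OF v] has_derivative_ident]) simp
  have 2: "((\<lambda>y. mul (u, mul (v, y))) has_derivative
      (\<lambda>z. fderiv mul (u, v) (0, fderiv mul (v, e\<^sub>0) (0, z)))) (at e\<^sub>0)"
    by (rule mul_partial[OF uv 1 mul_right[OF v]])
  let ?N = "V \<inter> {y. (v, y) \<in> dom_mul}"
  have "open {y. (v, y) \<in> dom_mul}"
    using open_vimage[OF open_dom_mul, of "\<lambda>y. (v, y)"] by (simp add: vimage_def continuous_on_Pair)
  then have N: "open ?N" "e\<^sub>0 \<in> ?N" using open_V e0_V dom_mul_right[OF v] by auto
  have eq: "mul (u, mul (v, y)) = mul (mul (u, v), y)" if "y \<in> ?N" for y
  proof -
    have c: "\<iota> u \<in> carrier G" "\<iota> v \<in> carrier G" "\<iota> y \<in> carrier G"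
      using uv that \<iota>_carrier by (auto simp: dom_mul_def)
    have "mul (u, mul (v, y)) = \<phi> (\<iota> u \<otimes> (\<iota> v \<otimes> \<iota> y))"
      using that \<iota>_mul[of "(v, y)"] by (simp add: mul_def[of "(u, _)"])
    also have "\<dots> = \<phi> ((\<iota> u \<otimes> \<iota> v) \<otimes> \<iota> y)" using c by (simp add: m_assoc)
    also have "\<dots> = mul (mul (u, v), y)" using \<iota>_mul[OF uv] by (simp add: mul_def[of "(mul _, _)"])
    finally show ?thesis .
  qed
  have "((\<lambda>y. mul (mul (u, v), y)) has_derivative
      (\<lambda>z. fderiv mul (u, v) (0, fderiv mul (v, e\<^sub>0) (0, z)))) (at e\<^sub>0)"
    by (rule has_derivative_transform_within_open[OF 2 N eq])
  moreover have "((\<lambda>y. mul (mul (u, v), y)) has_derivative (\<lambda>z. fderiv mul (mul (u, v), e\<^sub>0) (0, z))) (at e\<^sub>0)"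
    by (rule mul_partial[OF dom_mul_right[OF mul_V[OF uv]] has_derivative_ident]) simp
  ultimately show ?thesis using has_derivative_unique unfolding left_field_def by metis
qed

text \<open>For fixed \<open>s\<close>, both \<open>t \<mapsto> mul (u s, u t)\<close> and
  \<open>t \<mapsto> u (s + t)\<close> solve the equation of the left invariant field with value
  \<open>u s\<close> at \<open>t = 0\<close>, so they coincide by
  \<open>gronwall_zero\<close>.\<close>

lemma local_one_parameter_group:
  obtains \<delta> u where "\<delta> > 0" "u 0 = e\<^sub>0" "\<And>t. \<bar>t\<bar> < \<delta> \<Longrightarrow> u t \<in> V"
    "\<And>t. \<bar>t\<bar> < \<delta> \<Longrightarrow> (u has_vector_derivative left_field Z (u t)) (at t)"
    "\<And>s t. \<bar>s\<bar> < \<delta> \<Longrightarrow> \<bar>t\<bar> < \<delta> \<Longrightarrow> (u s, u t) \<in> dom_mul \<and> mul (u s, u t) = u (s + t)"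
proof -
  obtain r L where r: "r > 0" "cball e\<^sub>0 r \<subseteq> V"
    and lip: "\<And>x y. x \<in> cball e\<^sub>0 r \<Longrightarrow> y \<in> cball e\<^sub>0 r \<Longrightarrow> norm (left_field Z x - left_field Z y) \<le> L * norm (x - y)"
    using smooth_on_Lipschitz[OF open_V smooth_left_field e0_V] by metis
  obtain \<epsilon> u where eps: "\<epsilon> > 0" and u0: "u 0 = e\<^sub>0"
    and u: "\<And>t. \<bar>t\<bar> < \<epsilon> \<Longrightarrow> u t \<in> V \<and> (u has_vector_derivative left_field Z (u t)) (at t)"
    using ode_exists[OF open_V smooth_left_field e0_V] by metis
  have "open (dom_mul \<inter> mul -` ball e\<^sub>0 r)"
    by (rule continuous_open_preimage[OF smooth_on_continuous[OF smooth_mul] open_dom_mul open_ball])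
  moreover have "(e\<^sub>0, e\<^sub>0) \<in> dom_mul \<inter> mul -` ball e\<^sub>0 r"
    using dom_mul_right[OF e0_V] mul_right[OF e0_V] r by simp
  ultimately obtain A B where AB: "open A" "open B" "(e\<^sub>0, e\<^sub>0) \<in> A \<times> B" "A \<times> B \<subseteq> dom_mul \<inter> mul -` ball e\<^sub>0 r"
    by (rule open_prod_elim)
  \<comment> \<open>Points of \<open>?Q\<close> lie in the ball on which the field is Lipschitz;
    products of two such points are defined and lie there too.\<close>
  let ?Q = "A \<inter> B \<inter> ball e\<^sub>0 r"
  have Q: "open ?Q" "u 0 \<in> ?Q" using AB r u0 by auto
  have "isCont u 0" using u[of 0] eps has_vector_derivative_continuous by fastforce
  then have "\<forall>\<^sub>F t in at 0. u t \<in> ?Q" using topological_tendstoD[OF _ Q] by (simp only: isCont_def)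
  then obtain \<delta>0 where d0: "\<delta>0 > 0" "\<And>t. t \<noteq> 0 \<Longrightarrow> dist t 0 < \<delta>0 \<Longrightarrow> u t \<in> ?Q"
    unfolding eventually_at by auto
  have uQ: "u t \<in> ?Q" if "\<bar>t\<bar> < \<delta>0" for t using d0(2)[of t] that Q(2) by (cases "t = 0") auto
  \<comment> \<open>Halved so that \<open>s + t\<close> stays where \<open>u\<close> solves the
    equation and takes values in \<open>?Q\<close>.\<close>
  define \<delta> where "\<delta> = min \<epsilon> \<delta>0 / 2"
  have d: "\<delta> > 0" "\<delta> < \<epsilon>" "\<delta> < \<delta>0" and d2: "2 * \<delta> \<le> \<epsilon>" "2 * \<delta> \<le> \<delta>0"
    using eps d0(1) by (auto simp: \<delta>_def min_def)
  have "(u s, u t) \<in> dom_mul \<and> mul (u s, u t) = u (s + t)" if st: "\<bar>s\<bar> < \<delta>" "\<bar>t\<bar> < \<delta>" for s t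
  proof -
    have dom: "(u s, u t) \<in> dom_mul" "mul (u s, u t) \<in> cball e\<^sub>0 r" if "\<bar>t\<bar> < \<delta>" for t
      using uQ[of s] uQ[of t] st(1) that d AB(4) by auto
    have us: "u s \<in> V" using u[of s] st d by auto
    have "mul (u s, u t) - u (s + t) = 0"
    proof (rule gronwall_zero[of "ball 0 \<delta>" 0 "\<lambda>t. mul (u s, u t) - u (s + t)"
          "\<lambda>t. left_field Z (mul (u s, u t)) - left_field Z (u (s + t))" L])
      fix t :: real assume "t \<in> ball 0 \<delta>"
      then have t: "\<bar>t\<bar> < \<delta>" by simp
      have stt: "\<bar>s + t\<bar> < \<epsilon>" "\<bar>s + t\<bar> < \<delta>0" using st(1) t d2 by linarith+
      have ut: "(u has_derivative (\<lambda>h. h *\<^sub>R left_field Z (u t))) (at t)"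
        using u[of t] t d by (simp add: has_vector_derivative_def)
      have lin: "linear (fderiv mul (u s, u t))"
        using has_derivative_linear[OF smooth_on_derivative[OF smooth_mul dom(1)[OF t]]] .
      have "fderiv mul (u s, u t) (0, h *\<^sub>R left_field Z (u t)) = h *\<^sub>R left_field Z (mul (u s, u t))" for h
        using linear_scale[OF lin, of h "(0, left_field Z (u t))"] left_field_invariant[OF dom(1)[OF t]] by simp
      then have "((\<lambda>t. mul (u s, u t)) has_vector_derivative left_field Z (mul (u s, u t))) (at t)"
        using mul_partial[OF dom(1)[OF t] ut refl] by (simp add: has_vector_derivative_def)
      moreover have "((\<lambda>t. u (s + t)) has_vector_derivative left_field Z (u (s + t))) (at t)"
      proof -
        have "((\<lambda>t. s + t) has_vector_derivative 1) (at t)" by (auto intro!: derivative_eq_intros)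
        from vector_diff_chain_at[OF this, of u] u[OF stt(1)] show ?thesis by (simp add: o_def)
      qed
      ultimately show "((\<lambda>t. mul (u s, u t) - u (s + t)) has_vector_derivative
          left_field Z (mul (u s, u t)) - left_field Z (u (s + t))) (at t)"
        by (rule has_vector_derivative_diff)
      show "norm (left_field Z (mul (u s, u t)) - left_field Z (u (s + t))) \<le> L * norm (mul (u s, u t) - u (s + t))"
        using dom(2)[OF t] uQ[OF stt(2)] by (intro lip) auto
    qed (use d st u0 mul_right[OF us] in auto)
    then show ?thesis using dom(1)[OF st(2)] by simp
  qed
  then show ?thesis using that[of \<delta> u] d u u0 by auto
qed

theorem one_parameter_subgroup_exists:
  obtains \<sigma> where "one_parameter_subgroup G T \<A> \<sigma>" "((\<lambda>t. \<phi> (\<sigma> t)) has_vector_derivative Z) (at 0)"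
proof -
  obtain \<delta> u where d: "\<delta> > 0" and u0: "u 0 = e\<^sub>0" and uV: "\<And>t. \<bar>t\<bar> < \<delta> \<Longrightarrow> u t \<in> V"
    and u': "\<And>t. \<bar>t\<bar> < \<delta> \<Longrightarrow> (u has_vector_derivative left_field Z (u t)) (at t)"
    and umul: "\<And>s t. \<bar>s\<bar> < \<delta> \<Longrightarrow> \<bar>t\<bar> < \<delta> \<Longrightarrow> (u s, u t) \<in> dom_mul \<and> mul (u s, u t) = u (s + t)"
    using local_one_parameter_group by metis
  define \<sigma>0 where "\<sigma>0 t = \<iota> (u t)" for t
  have "\<sigma>0 (s + t) = \<sigma>0 s \<otimes> \<sigma>0 t" if "\<bar>s\<bar> < \<delta>" "\<bar>t\<bar> < \<delta>" for s t
    using umul[OF that] \<iota>_mul[of "(u s, u t)"] by (simp add: \<sigma>0_def)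
  moreover have "\<sigma>0 t \<in> carrier G" if "\<bar>t\<bar> < \<delta>" for t
    using uV[OF that] \<iota>_carrier by (simp add: \<sigma>0_def)
  ultimately obtain \<sigma> where hom: "\<And>s t. \<sigma> (s + t) = \<sigma> s \<otimes> \<sigma> t" and carr: "\<And>t. \<sigma> t \<in> carrier G"
    and loc: "\<And>t. \<bar>t\<bar> < \<delta> \<Longrightarrow> \<sigma> t = \<sigma>0 t"
    using extend_local_homomorphism[OF d, of \<sigma>0] by metis
  let ?B = "ball (0::real) \<delta>"
  have "smooth_on ?B u"
    by (rule ode_solution_smooth[OF open_ball open_V smooth_left_field]) (use uV u' in auto)
  then have "smooth_param T \<A> ?B (\<lambda>t. \<iota> (u t))"
    by (rule smooth_param_compose[OF open_ball open_V smooth_\<iota>]) (use uV in auto)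
  then have sm0: "smooth_param T \<A> ?B \<sigma>"
    by (rule smooth_param_cong[OF open_ball]) (simp add: loc \<sigma>0_def)
  have "smooth_param T \<A> UNIV \<sigma>"
  proof (rule smooth_param_local[OF open_UNIV])
    \<comment> \<open>Near \<open>t0\<close> the curve is the left translate by
      \<open>\<sigma> t0\<close> of its smooth germ at 0.\<close>
    fix t0 :: real
    have "smooth_param T \<A> (ball t0 \<delta>) (\<lambda>t. \<sigma> (t + (- t0)))"
    proof (rule smooth_param_compose[OF open_ball open_ball sm0])
      show "smooth_on (ball t0 \<delta>) (\<lambda>t. t + - t0)"
        by (intro smooth_on_add open_ball smooth_on_linear bounded_linear_ident smooth_on_const)
    qed (auto simp: dist_real_def)
    then have "smooth_param T \<A> (ball t0 \<delta>) (\<lambda>t. \<sigma> t0 \<otimes> \<sigma> (t + (- t0)))"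
      by (intro smooth_param_mult_const open_ball carr)
    moreover have "\<sigma> t0 \<otimes> \<sigma> (t + (- t0)) = \<sigma> t" for t using hom[of t0 "t + (- t0)"] by simp
    ultimately show "\<exists>N. open N \<and> t0 \<in> N \<and> N \<subseteq> UNIV \<and> smooth_param T \<A> N \<sigma>"
      using d by (intro exI[of _ "ball t0 \<delta>"]) simp
  qed
  then have "one_parameter_subgroup G T \<A> \<sigma>"
    using hom by (simp add: one_parameter_subgroup_def smooth_curve_iff)
  moreover have "((\<lambda>t. \<phi> (\<sigma> t)) has_vector_derivative Z) (at 0)"
  proof (rule has_vector_derivative_transform_within_open[of u Z 0 ?B])
    show "(u has_vector_derivative Z) (at 0)" using u'[of 0] d u0 by (simp add: left_field_e0)
    show "u t = \<phi> (\<sigma> t)" if "t \<in> ?B" for t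
      using that loc[of t] \<phi>_\<iota>[OF uV, of t] by (simp add: \<sigma>0_def)
  qed (use d in auto)
  ultimately show ?thesis using that by blast
qed

lemma one_parameter_subgroupD:
  assumes "one_parameter_subgroup G T \<A> \<sigma>"
  shows "smooth_param T \<A> UNIV \<sigma>" "\<sigma> (s + t) = \<sigma> s \<otimes> \<sigma> t" "\<sigma> t \<in> carrier G" "\<sigma> 0 = \<one>"
    "\<sigma> (- t) = inv (\<sigma> t)"
proof -
  show sm: "smooth_param T \<A> UNIV \<sigma>" and hom: "\<sigma> (s + t) = \<sigma> s \<otimes> \<sigma> t" for s t
    using assms by (auto simp: one_parameter_subgroup_def smooth_curve_iff)
  show c: "\<sigma> t \<in> carrier G" for t using smooth_param_in[OF sm, of t] topspace_eq by auto
  show z: "\<sigma> 0 = \<one>" using hom[of 0 0] c[of 0] by (metis add_0 r_cancel_one)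
  have "\<sigma> (- t) \<otimes> \<sigma> t = \<one>" using hom[of "- t" t] z by simp
  then show "\<sigma> (- t) = inv (\<sigma> t)" using c inv_equality by metis
qed

end

subsection \<open>The adjoint representation and the Lie bracket\<close>

context lie_chart
begin

lemma \<phi>_\<iota>_derivative: "v \<in> V \<Longrightarrow> ((\<lambda>u. \<phi> (\<iota> u)) has_derivative (\<lambda>z. z)) (at v)"
  by (rule has_derivative_transform_within_open[OF has_derivative_ident open_V]) (simp_all add: \<phi>_\<iota>)

lemma smooth_param_conj:
  assumes "open S" "smooth_param T \<A> S c" "a \<in> carrier G"
  shows "smooth_param T \<A> S (\<lambda>x. a \<otimes> c x \<otimes> inv a)"
  using assms by (intro smooth_param_mult_const) auto

lemma conj_differentiable:
  assumes "a \<in> carrier G"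
  shows "local_rep E E (\<lambda>x. a \<otimes> x \<otimes> inv a) differentiable (at e\<^sub>0)"
  by (rule local_rep_differentiable[OF manifold_axioms E E one_E])
     (use assms one_E smooth_param_conj[OF open_V smooth_\<iota>] in auto)

lemma linear_Ad:
  assumes "a \<in> carrier G" shows "linear (Ad G E a)"
  unfolding Ad_def differential_def
  using conj_differentiable[OF assms] frechet_derivative_works has_derivative_linear by blast

lemma Ad_derivative:
  assumes "open S" "smooth_param T \<A> S c" "x \<in> S" "c x = \<one>" "a \<in> carrier G"
    and "((\<lambda>y. \<phi> (c y)) has_derivative c') (at x)"
  shows "((\<lambda>y. \<phi> (a \<otimes> c y \<otimes> inv a)) has_derivative (\<lambda>v. Ad G E a (c' v))) (at x)"
  using chain_rule[OF assms(1-3) E _ assms(6), of E "\<lambda>x. a \<otimes> x \<otimes> inv a"] conj_differentiable[OF assms(5)] one_E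
  by (simp add: assms(4) Ad_def)

lemma Ad_vector_derivative:
  assumes "open S" "smooth_param T \<A> S c" "x \<in> S" "c x = \<one>" "a \<in> carrier G"
    and "((\<lambda>y. \<phi> (c y)) has_vector_derivative c') (at x)"
  shows "((\<lambda>y. \<phi> (a \<otimes> c y \<otimes> inv a)) has_vector_derivative Ad G E a c') (at x)"
  using Ad_derivative[OF assms(1-5) assms(6)[unfolded has_vector_derivative_def]]
  by (simp add: has_vector_derivative_def linear_scale[OF linear_Ad[OF assms(5)]])

lemma Ad_mult:
  assumes "a \<in> carrier G" "b \<in> carrier G"
  shows "Ad G E (a \<otimes> b) X = Ad G E a (Ad G E b X)"
proof -
  have 1: "((\<lambda>v. \<phi> (b \<otimes> \<iota> v \<otimes> inv b)) has_derivative (\<lambda>v. Ad G E b v)) (at e\<^sub>0)"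
    by (rule Ad_derivative[OF open_V smooth_\<iota> e0_V \<iota>_e0 assms(2) \<phi>_\<iota>_derivative[OF e0_V]])
  have 2: "((\<lambda>v. \<phi> (a \<otimes> (b \<otimes> \<iota> v \<otimes> inv b) \<otimes> inv a)) has_derivative (\<lambda>v. Ad G E a (Ad G E b v))) (at e\<^sub>0)"
    by (rule Ad_derivative[OF open_V smooth_param_conj[OF open_V smooth_\<iota> assms(2)] e0_V _ assms(1) 1])
       (simp add: \<iota>_e0 assms)
  have 3: "((\<lambda>v. \<phi> ((a \<otimes> b) \<otimes> \<iota> v \<otimes> inv (a \<otimes> b))) has_derivative (\<lambda>v. Ad G E (a \<otimes> b) v)) (at e\<^sub>0)"
    by (rule Ad_derivative[OF open_V smooth_\<iota> e0_V \<iota>_e0 _ \<phi>_\<iota>_derivative[OF e0_V]]) (simp add: assms)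
  have "((\<lambda>v. \<phi> (a \<otimes> (b \<otimes> \<iota> v \<otimes> inv b) \<otimes> inv a)) has_derivative (\<lambda>v. Ad G E (a \<otimes> b) v)) (at e\<^sub>0)"
    by (rule has_derivative_transform_within_open[OF 3 open_V e0_V])
       (use assms \<iota>_carrier in \<open>simp add: inv_mult_group m_assoc\<close>)
  from has_derivative_unique[OF this 2] show ?thesis by metis
qed

lemma Ad_one: "Ad G E \<one> X = X"
proof -
  have "((\<lambda>v. \<phi> (\<one> \<otimes> \<iota> v \<otimes> inv \<one>)) has_derivative (\<lambda>v. Ad G E \<one> v)) (at e\<^sub>0)"
    by (rule Ad_derivative[OF open_V smooth_\<iota> e0_V \<iota>_e0 one_closed \<phi>_\<iota>_derivative[OF e0_V]])
  moreover have "((\<lambda>v. \<phi> (\<one> \<otimes> \<iota> v \<otimes> inv \<one>)) has_derivative (\<lambda>v. v)) (at e\<^sub>0)"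
    by (rule has_derivative_transform_within_open[OF \<phi>_\<iota>_derivative[OF e0_V] open_V e0_V])
       (use \<iota>_carrier in simp)
  ultimately show ?thesis using has_derivative_unique by metis
qed

text \<open>\<open>Ad\<close> at \<open>\<iota> u\<close> is the partial derivative, in the second
  variable at the identity, of the jointly smooth conjugation map. Thus it can be differentiated in
  \<open>u\<close>, which is what the definition of the bracket asks for.\<close>

lemma smooth_Ad: "smooth_on V (\<lambda>u. Ad G E (\<iota> u) Y)"
proof -
  let ?c = "\<lambda>w. \<iota> (fst w) \<otimes> \<iota> (snd w) \<otimes> inv (\<iota> (fst w))"
  let ?k = "\<lambda>w. \<phi> (?c w)"
  have VV: "open (V \<times> V)" by (simp add: open_Times open_V)
  have sm: "smooth_param T \<A> (V \<times> V) ?c"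
    by (intro smooth_param_mult smooth_param_inverse smooth_\<iota>_fst smooth_\<iota>_snd VV)
  let ?O = "(V \<times> V) \<inter> ?c -` fst E"
  have O: "open ?O" by (rule smooth_param_open_preimage[OF sm VV chart_open[OF E]])
  have k: "smooth_on ?O ?k" by (rule smooth_param_chart[OF sm E])
  have inO: "(u, e\<^sub>0) \<in> ?O" if "u \<in> V" for u using that e0_V one_E \<iota>_carrier by (simp add: \<iota>_e0)
  have 1: "smooth_on V (\<lambda>u. fderiv ?k (u, e\<^sub>0) (0, Y))"
    by (rule smooth_on_frechet_derivative[OF open_V O k, where p = "\<lambda>u. (u, e\<^sub>0)" and v = "\<lambda>u. (0, Y)"])
       (use inO in \<open>auto intro!: smooth_on_Pair open_V smooth_on_const smooth_on_linear[OF bounded_linear_ident]\<close>)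
  have 2: "fderiv ?k (u, e\<^sub>0) (0, Y) = Ad G E (\<iota> u) Y" if u: "u \<in> V" for u
  proof -
    have "((\<lambda>v. (u, v)) has_derivative (\<lambda>v. (0, v))) (at e\<^sub>0)"
      by (auto intro!: derivative_eq_intros)
    from diff_chain_at[OF this smooth_on_derivative[OF k inO[OF u]]]
    have a: "((\<lambda>v. \<phi> (\<iota> u \<otimes> \<iota> v \<otimes> inv (\<iota> u))) has_derivative (\<lambda>v. fderiv ?k (u, e\<^sub>0) (0, v))) (at e\<^sub>0)"
      by (simp add: o_def)
    have b: "((\<lambda>v. \<phi> (\<iota> u \<otimes> \<iota> v \<otimes> inv (\<iota> u))) has_derivative (\<lambda>v. Ad G E (\<iota> u) v)) (at e\<^sub>0)"
      by (rule Ad_derivative[OF open_V smooth_\<iota> e0_V \<iota>_e0 \<iota>_carrier[OF u] \<phi>_\<iota>_derivative[OF e0_V]])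
    show ?thesis by (rule fun_cong[OF has_derivative_unique[OF a b], of Y])
  qed
  show ?thesis by (rule smooth_on_cong[where f = "\<lambda>u. fderiv ?k (u, e\<^sub>0) (0, Y)", OF open_V 2 1])
qed

lemma Ad_\<iota>_derivative: "((\<lambda>u. Ad G E (\<iota> u) Y) has_derivative (\<lambda>X. bracket X Y)) (at e\<^sub>0)"
proof -
  have "(\<lambda>X. bracket X Y) = fderiv (\<lambda>u. Ad G E (\<iota> u) Y) e\<^sub>0"
    by (simp add: lie_bracket_def differential_def local_rep_def o_def fun_eq_iff)
  then show ?thesis using smooth_on_derivative[OF smooth_Ad e0_V, of Y] by simp
qed

lemma linear_bracket_left: "linear (\<lambda>X. bracket X Y)"
  using has_derivative_linear[OF Ad_\<iota>_derivative] .

lemma bracket_add_right: "bracket X (Y + Z) = bracket X Y + bracket X Z"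
proof -
  have "((\<lambda>u. Ad G E (\<iota> u) Y + Ad G E (\<iota> u) Z) has_derivative (\<lambda>X. bracket X Y + bracket X Z)) (at e\<^sub>0)"
    by (intro has_derivative_add Ad_\<iota>_derivative)
  then have "((\<lambda>u. Ad G E (\<iota> u) (Y + Z)) has_derivative (\<lambda>X. bracket X Y + bracket X Z)) (at e\<^sub>0)"
    by (rule has_derivative_transform_within_open[OF _ open_V e0_V])
       (simp add: linear_add[OF linear_Ad[OF \<iota>_carrier]])
  from has_derivative_unique[OF this Ad_\<iota>_derivative] show ?thesis by metis
qed

lemma bracket_scale_right: "bracket X (r *\<^sub>R Y) = r *\<^sub>R bracket X Y"
proof -
  have "((\<lambda>u. r *\<^sub>R Ad G E (\<iota> u) Y) has_derivative (\<lambda>X. r *\<^sub>R bracket X Y)) (at e\<^sub>0)"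
    by (intro has_derivative_scaleR_right Ad_\<iota>_derivative)
  then have "((\<lambda>u. Ad G E (\<iota> u) (r *\<^sub>R Y)) has_derivative (\<lambda>X. r *\<^sub>R bracket X Y)) (at e\<^sub>0)"
    by (rule has_derivative_transform_within_open[OF _ open_V e0_V])
       (simp add: linear_scale[OF linear_Ad[OF \<iota>_carrier]])
  from has_derivative_unique[OF this Ad_\<iota>_derivative] show ?thesis by metis
qed

lemma linear_bracket_right: "linear (bracket X)"
  by (rule linearI) (rule bracket_add_right bracket_scale_right)+

lemma Ad_one_parameter_derivative:
  assumes \<sigma>: "one_parameter_subgroup G T \<A> \<sigma>" "((\<lambda>t. \<phi> (\<sigma> t)) has_vector_derivative Z) (at 0)"
  shows "((\<lambda>t. Ad G E (\<sigma> t) Y) has_vector_derivative bracket Z Y) (at 0)"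
proof -
  note \<sigma>D = one_parameter_subgroupD[OF \<sigma>(1)]
  have N: "open (UNIV \<inter> \<sigma> -` fst E)" "0 \<in> UNIV \<inter> \<sigma> -` fst E"
    using smooth_param_open_preimage[OF \<sigma>D(1) open_UNIV chart_open[OF E]] one_E \<sigma>D(4) by auto
  have "((\<lambda>t. Ad G E (\<iota> (\<phi> (\<sigma> t))) Y) has_vector_derivative bracket Z Y) (at 0)"
    using vector_derivative_diff_chain_within[OF \<sigma>(2), of "\<lambda>u. Ad G E (\<iota> u) Y" "\<lambda>X. bracket X Y"]
      has_derivative_at_withinI[OF Ad_\<iota>_derivative] by (simp add: o_def \<sigma>D(4))
  then show ?thesis
    by (rule has_vector_derivative_transform_within_open[OF _ N]) (simp add: \<iota>_\<phi>)
qed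

text \<open>The one-parameter subgroup with velocity \<open>X\<close> commutes with itself, so its
  adjoint action fixes \<open>X\<close>; differentiating this constant curve gives the
  bracket.\<close>

lemma bracket_self: "bracket X X = 0"
proof -
  obtain \<sigma> where \<sigma>: "one_parameter_subgroup G T \<A> \<sigma>" "((\<lambda>t. \<phi> (\<sigma> t)) has_vector_derivative X) (at 0)"
    using one_parameter_subgroup_exists by metis
  note \<sigma>D = one_parameter_subgroupD[OF \<sigma>(1)]
  have "Ad G E (\<sigma> t) X = X" for t
  proof -
    have "\<sigma> t \<otimes> \<sigma> s \<otimes> inv (\<sigma> t) = \<sigma> s" for s
      using \<sigma>D(2)[of t s] \<sigma>D(2)[of "t + s" "- t"] \<sigma>D(5)[of t] by simp
    then have "((\<lambda>s. \<phi> (\<sigma> s)) has_vector_derivative Ad G E (\<sigma> t) X) (at 0)"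
      using Ad_vector_derivative[OF open_UNIV \<sigma>D(1) UNIV_I \<sigma>D(4) \<sigma>D(3)[of t] \<sigma>(2)] by simp
    then show ?thesis using vector_derivative_unique_at[OF _ \<sigma>(2)] by blast
  qed
  then have "((\<lambda>t. X) has_vector_derivative bracket X X) (at 0)"
    using Ad_one_parameter_derivative[OF \<sigma>, of X] by simp
  then show ?thesis using vector_derivative_unique_at[OF _ has_vector_derivative_const] by blast
qed

lemma bracket_antisym: "bracket X Y = - bracket Y X"
proof -
  have "0 = bracket (X + Y) (X + Y)" by (simp add: bracket_self)
  also have "\<dots> = bracket X (X + Y) + bracket Y (X + Y)"
    by (rule linear_add[OF linear_bracket_left])
  also have "\<dots> = bracket X Y + bracket Y X"
    by (simp add: bracket_add_right bracket_self)
  finally show ?thesis by (simp add: eq_neg_iff_add_eq_0)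
qed

text \<open>By the homomorphism property the derivative at time \<open>s\<close> is
  \<open>Ad G E (\<sigma> s)\<close> applied to the derivative at time 0, which is
  \<open>bracket Z Q\<close>.\<close>

lemma Ad_fixed:
  assumes \<sigma>: "one_parameter_subgroup G T \<A> \<sigma>" "((\<lambda>t. \<phi> (\<sigma> t)) has_vector_derivative Z) (at 0)"
    and "bracket Z Q = 0"
  shows "Ad G E (\<sigma> t) Q = Q"
proof -
  note \<sigma>D = one_parameter_subgroupD[OF \<sigma>(1)]
  have "((\<lambda>t. Ad G E (\<sigma> t) Q) has_derivative (\<lambda>h. 0)) (at s)" for s
  proof -
    have 1: "((\<lambda>t. Ad G E (\<sigma> t) Q) has_derivative (\<lambda>h. 0)) (at 0)"
      using Ad_one_parameter_derivative[OF \<sigma>, of Q] assms(3) by (simp add: has_vector_derivative_def)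
    have lin: "bounded_linear (Ad G E (\<sigma> s))" using linear_bounded_linear linear_Ad \<sigma>D(3) by blast
    have "((\<lambda>t. Ad G E (\<sigma> s) (Ad G E (\<sigma> t) Q)) has_derivative (\<lambda>h. Ad G E (\<sigma> s) 0)) (at 0)"
      using bounded_linear.has_derivative[OF lin 1] .
    then have 2: "((\<lambda>t. Ad G E (\<sigma> (s + t)) Q) has_derivative (\<lambda>h. 0)) (at (s - s))"
      using \<sigma>D(2,3) by (simp add: Ad_mult linear_simps(3)[OF lin])
    have "((\<lambda>t. t - s) has_derivative (\<lambda>h. h)) (at s)" by (auto intro!: derivative_eq_intros)
    from diff_chain_at[OF this 2] show ?thesis by (simp add: o_def)
  qed
  then have "Ad G E (\<sigma> t) Q = Ad G E (\<sigma> 0) Q"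
    by (intro has_derivative_zero_unique[of UNIV]) auto
  then show ?thesis by (simp add: \<sigma>D(4) Ad_one)
qed

end

section \<open>Uniqueness of geodesics\<close>

context manifold
begin

lemma local_metric_chart:
  assumes "riemannian_metric \<A> g" "C \<in> \<A>"
  shows "local_metric (snd C ` fst C) (g C)"
  using assms chart_image_open[OF assms(2)] by unfold_locales (auto simp: riemannian_metric_def)

lemma geodesic_unique_germ:
  assumes g: "riemannian_metric \<A> g" and I: "open I" "t \<in> I"
    and geo: "geodesic_on T \<A> g I c1" "geodesic_on T \<A> g I c2"
    and C: "C \<in> \<A>" "c1 t \<in> fst C" and eq: "c1 t = c2 t"
    and vel: "vector_derivative (\<lambda>s. snd C (c1 s)) (at t) = vector_derivative (\<lambda>s. snd C (c2 s)) (at t)"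
  shows "\<forall>\<^sub>F s in nhds t. c1 s = c2 s"
proof -
  interpret local_metric "snd C ` fst C" "g C" using local_metric_chart[OF g C(1)] .
  have sp: "smooth_param T \<A> I c1" "smooth_param T \<A> I c2"
    using geo by (auto simp: geodesic_on_def smooth_curve_iff)
  let ?J = "(I \<inter> c1 -` fst C) \<inter> (I \<inter> c2 -` fst C)"
  have J: "open ?J" "t \<in> ?J"
    using smooth_param_open_preimage[OF sp(1) I(1) chart_open[OF C(1)]]
      smooth_param_open_preimage[OF sp(2) I(1) chart_open[OF C(1)]] I C eq by auto
  define u1 where "u1 s = snd C (c1 s)" for s
  define u2 where "u2 s = snd C (c2 s)" for s
  have sm: "smooth_on ?J u1" "smooth_on ?J u2"
    unfolding u1_def u2_def
    by (auto intro: smooth_on_subset[OF smooth_param_chart[OF sp(1) C(1)]] smooth_on_subset[OF smooth_param_chart[OF sp(2) C(1)]])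
  define v1 where "v1 s = vector_derivative u1 (at s)" for s
  define v2 where "v2 s = vector_derivative u2 (at s)" for s
  define a1 where "a1 s = vector_derivative v1 (at s)" for s
  define a2 where "a2 s = vector_derivative v2 (at s)" for s
  have smv: "smooth_on ?J v1" "smooth_on ?J v2"
    unfolding v1_def v2_def by (rule smooth_on_vector_derivative_smooth[OF J(1)]; rule sm)+
  have sma: "smooth_on ?J a2"
    unfolding a2_def by (rule smooth_on_vector_derivative_smooth[OF J(1) smv(2)])
  obtain \<delta> where d: "\<delta> > 0" "\<And>s. \<bar>s - t\<bar> < \<delta> \<Longrightarrow> u1 s = u2 s"
  proof (rule geodesic_unique_local[of ?J t u1 u2 v1 a1 v2 a2])
    show "u1 ` ?J \<subseteq> snd C ` fst C" "u2 ` ?J \<subseteq> snd C ` fst C" by (auto simp: u1_def u2_def)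
    fix s assume s: "s \<in> ?J"
    show "(u1 has_vector_derivative v1 s) (at s)" "(u2 has_vector_derivative v2 s) (at s)"
      "(v1 has_vector_derivative a1 s) (at s)" "(v2 has_vector_derivative a2 s) (at s)"
      using smooth_on_vector_derivative[OF sm(1) s] smooth_on_vector_derivative[OF sm(2) s]
        smooth_on_vector_derivative[OF smv(1) s] smooth_on_vector_derivative[OF smv(2) s]
      by (simp_all only: v1_def v2_def a1_def a2_def)
    fix w
    show "g C (u1 s) (a1 s) w + christoffel (g C) (u1 s) (v1 s) (v1 s) w = 0"
      using geo(1) s C(1) unfolding geodesic_on_def Let_def o_def a1_def v1_def[abs_def] u1_def[abs_def] by blast
    show "g C (u2 s) (a2 s) w + christoffel (g C) (u2 s) (v2 s) (v2 s) w = 0"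
      using geo(2) s C(1) unfolding geodesic_on_def Let_def o_def a2_def v2_def[abs_def] u2_def[abs_def] by blast
  next
    show "isCont a2 t" using smooth_on_continuous[OF sma] continuous_on_eq_continuous_at J by blast
    show "u1 t = u2 t" by (simp add: u1_def u2_def eq)
    show "v1 t = v2 t" using vel by (simp add: u1_def[abs_def] u2_def[abs_def] v1_def v2_def)
  qed (use J that in auto)
  have "open (?J \<inter> ball t \<delta>)" "t \<in> ?J \<inter> ball t \<delta>" using J d by auto
  moreover have "c1 s = c2 s" if "s \<in> ?J \<inter> ball t \<delta>" for s
  proof -
    have "u1 s = u2 s" using that by (intro d(2)) (auto simp: dist_real_def)
    then show ?thesis using that chart_inj[OF C(1)] unfolding u1_def u2_def by (auto dest: inj_onD)
  qed
  ultimately show ?thesis unfolding eventually_nhds by blast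
qed

text \<open>Connectedness of \<open>I\<close>: the times with locally equal curves form an open set.
  It is also closed in \<open>I\<close>, since values agree in the limit by the Hausdorff property
  and velocities by continuity in a chart, so that local uniqueness applies at the limit.\<close>

lemma geodesic_unique:
  assumes g: "riemannian_metric \<A> g" and I: "open I" "is_interval I" "t0 \<in> I"
    and geo: "geodesic_on T \<A> g I c1" "geodesic_on T \<A> g I c2"
    and C: "C \<in> \<A>" "c1 t0 \<in> fst C" "c1 t0 = c2 t0"
      "vector_derivative (\<lambda>s. snd C (c1 s)) (at t0) = vector_derivative (\<lambda>s. snd C (c2 s)) (at t0)"
    and t: "t \<in> I"
  shows "c1 t = c2 t"
proof -
  have sp: "smooth_param T \<A> I c1" "smooth_param T \<A> I c2"
    using geo by (auto simp: geodesic_on_def smooth_curve_iff)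
  \<comment> \<open>Equality of germs rather than of values: this is an open condition and includes
    equality of velocities.\<close>
  define P where "P t \<longleftrightarrow> (\<forall>\<^sub>F s in nhds t. c1 s = c2 s)" for t
  have Popen: "\<forall>\<^sub>F s in nhds t. P s" if "P t" for t
    using that unfolding P_def by (simp add: eventually_eventually)
  have P_closed: "P t" if t: "t \<in> I" and acc: "\<And>N. open N \<Longrightarrow> t \<in> N \<Longrightarrow> \<exists>s\<in>N. s \<in> I \<and> P s" for t
  proof -
    have P_eq: "c1 s = c2 s" if "P s" for s using that eventually_nhds_x_imp_x unfolding P_def by fast
    have eq: "c1 t = c2 t"
    proof (rule ccontr)
      assume "c1 t \<noteq> c2 t"
      moreover have "Hausdorff_space T" using manifold by (simp add: smooth_manifold_def)
      ultimately obtain W1 W2 where W: "openin T W1" "openin T W2" "c1 t \<in> W1" "c2 t \<in> W2" "disjnt W1 W2"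
        using smooth_param_in[OF sp(1) t] smooth_param_in[OF sp(2) t] unfolding Hausdorff_space_def by metis
      have "open ((I \<inter> c1 -` W1) \<inter> (I \<inter> c2 -` W2))"
        using smooth_param_open_preimage[OF sp(1) I(1) W(1)] smooth_param_open_preimage[OF sp(2) I(1) W(2)] by blast
      then obtain s where "c1 s \<in> W1" "c2 s \<in> W2" "P s" using acc W t by blast
      then show False using P_eq W(5) by (auto simp: disjnt_def)
    qed
    obtain C where C: "C \<in> \<A>" "c1 t \<in> fst C" using chart_at smooth_param_in[OF sp(1) t] by metis
    let ?J = "(I \<inter> c1 -` fst C) \<inter> (I \<inter> c2 -` fst C)"
    have J: "open ?J" "t \<in> ?J"
      using smooth_param_open_preimage[OF sp(1) I(1) chart_open[OF C(1)]]
        smooth_param_open_preimage[OF sp(2) I(1) chart_open[OF C(1)]] t C eq by auto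
    let ?v1 = "\<lambda>t. vector_derivative (\<lambda>s. snd C (c1 s)) (at t)"
      and ?v2 = "\<lambda>t. vector_derivative (\<lambda>s. snd C (c2 s)) (at t)"
    have "smooth_on ?J (\<lambda>s. snd C (c1 s))" "smooth_on ?J (\<lambda>s. snd C (c2 s))"
      by (auto intro: smooth_on_subset[OF smooth_param_chart[OF sp(1) C(1)]] smooth_on_subset[OF smooth_param_chart[OF sp(2) C(1)]])
    then have "smooth_on ?J ?v1" "smooth_on ?J ?v2" by (auto intro: smooth_on_vector_derivative_smooth[OF J(1)])
    then have "continuous_on ?J (\<lambda>t. ?v1 t - ?v2 t)"
      by (intro continuous_on_diff smooth_on_continuous)
    then have oN: "open (?J \<inter> (\<lambda>t. ?v1 t - ?v2 t) -` (- {0}))"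
      by (rule continuous_open_preimage[OF _ J(1)]) auto
    have "?v1 t = ?v2 t"
    proof (rule ccontr)
      assume "?v1 t \<noteq> ?v2 t"
      then have "t \<in> ?J \<inter> (\<lambda>t. ?v1 t - ?v2 t) -` (- {0})" using J(2) by simp
      from acc[OF oN this] obtain s where "s \<in> ?J \<inter> (\<lambda>t. ?v1 t - ?v2 t) -` (- {0})" and Ps: "P s" by blast
      then have ne: "?v1 s \<noteq> ?v2 s" by simp
      have "\<forall>\<^sub>F r in nhds s. snd C (c1 r) = snd C (c2 r)"
        using Ps unfolding P_def by (rule eventually_mono) simp
      then have "?v1 s = ?v2 s" by (intro vector_derivative_cong_eq) auto
      with ne show False by simp
    qed
    then show ?thesis
      unfolding P_def by (rule geodesic_unique_germ[OF g I(1) t geo C eq])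
  qed
  have "P t0" unfolding P_def by (rule geodesic_unique_germ[OF g I(1,3) geo C])
  have "P t"
  proof (rule ccontr)
    assume nP: "\<not> P t"
    define A where "A = {t. P t}"
    \<comment> \<open>The largest open set in which no point of \<open>I\<close> satisfies
      \<open>P\<close>; \<open>P_closed\<close> makes \<open>A\<close> and \<open>B\<close> cover
      \<open>I\<close>.\<close>
    define B where "B = \<Union>{N. open N \<and> (\<forall>s\<in>N. s \<in> I \<longrightarrow> \<not> P s)}"
    have inB: "s \<in> B" if s: "s \<in> I" "\<not> P s" for s
    proof (rule ccontr)
      assume "s \<notin> B"
      then have "\<exists>r\<in>N. r \<in> I \<and> P r" if "open N" "s \<in> N" for N using that unfolding B_def by blast
      with P_closed[OF s(1)] s(2) show False by blast
    qed
    have A: "open A"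
    proof (subst open_subopen, intro ballI)
      fix t assume "t \<in> A"
      then have "\<forall>\<^sub>F s in nhds t. P s" using Popen by (simp add: A_def)
      then show "\<exists>N. open N \<and> t \<in> N \<and> N \<subseteq> A" unfolding eventually_nhds A_def by blast
    qed
    have B: "open B" unfolding B_def by (rule open_Union) simp
    have AB: "A \<inter> B \<inter> I = {}" by (auto simp: A_def B_def)
    have I_sub: "I \<subseteq> A \<union> B" using inB by (auto simp: A_def)
    have "connected I" using I(2) is_interval_connected by blast
    from connectedD[OF this A B AB I_sub] have "A \<inter> I = {} \<or> B \<inter> I = {}" .
    moreover have "t0 \<in> A \<inter> I" using \<open>P t0\<close> I by (simp add: A_def)
    moreover have "t \<in> B \<inter> I" using inB[OF t nP] t by simp
    ultimately show False by blast
  qed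
  then show ?thesis unfolding P_def using eventually_nhds_x_imp_x by fast
qed

end

section \<open>The coset manifold\<close>

locale coset = lie_chart G T \<A> E for G :: "'g monoid" (structure) and T :: "'g topology"
    and \<A> :: "('g, 'e::{real_inner, heine_borel}) chart set" and E :: "('g, 'e) chart" +
  fixes H :: "'g set" and TM :: "'g set topology" and \<B> :: "('g set, 'f::{real_inner, heine_borel}) chart set"
  assumes H: "subgroup H G" and coset_manifold: "coset_manifold G T \<A> H TM \<B>"

sublocale coset \<subseteq> M: manifold TM \<B>
  using coset_manifold by unfold_locales (simp add: coset_manifold_def)

context coset
begin

abbreviation proj :: "'g \<Rightarrow> 'g set" where "proj a \<equiv> a <# H"

lemma H_carrier: "H \<subseteq> carrier G" using H subgroup.subset by blast

lemma l_coset_proj: "a \<in> carrier G \<Longrightarrow> b \<in> carrier G \<Longrightarrow> a <# (proj b) = proj (a \<otimes> b)"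
  using H_carrier by (rule lcos_m_assoc)

lemma proj_one: "proj \<one> = H" using H_carrier by (rule lcos_mult_one)

lemma proj_eq_H: "a \<in> carrier G \<Longrightarrow> proj a = H \<longleftrightarrow> a \<in> H"
  using lcos_self[OF _ H] coset_join3[OF _ H] by blast

lemma topspace_TM: "topspace TM = proj ` carrier G"
  using coset_manifold by (auto simp: coset_manifold_def LCOSETS_def)

lemma smooth_param_proj: "open S \<Longrightarrow> smooth_param T \<A> S c \<Longrightarrow> smooth_param TM \<B> S (\<lambda>x. proj (c x))"
  using smooth_map_smooth_param[OF M.manifold_axioms, of proj] coset_manifold
  by (simp add: coset_manifold_def)

lemma proj_differentiable:
  assumes "C \<in> \<A>" "D \<in> \<B>" "a \<in> fst C" "proj a \<in> fst D"
  shows "local_rep C D proj differentiable (at (snd C a))"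
  by (rule local_rep_differentiable[where F = proj, OF M.manifold_axioms assms])
     (rule smooth_param_proj[OF chart_image_open[OF assms(1)] smooth_param_chart_inv[OF assms(1)]])

text \<open>Translating a coset after \<open>proj\<close> is the same as \<open>proj\<close> after
  left multiplication in the group, which is smooth. As \<open>proj\<close> is a submersion,
  differentiability descends to the quotient.\<close>

lemma translation_differentiable:
  assumes "k \<in> carrier G" "a \<in> carrier G" "D \<in> \<B>" "D' \<in> \<B>" "proj a \<in> fst D" "proj (k \<otimes> a) \<in> fst D'"
  shows "local_rep D D' (\<lambda>p. k <# p) differentiable (at (snd D (proj a)))"
proof -
  obtain C where C: "C \<in> \<A>" "a \<in> fst C" using chart_at topspace_eq assms(2) by metis
  let ?W = "snd C ` fst C"
  have W: "open ?W" using chart_image_open[OF C(1)] .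
  have sp: "smooth_param TM \<B> ?W (\<lambda>v. proj (chart_inv C v))"
    by (rule smooth_param_proj[OF W smooth_param_chart_inv[OF C(1)]])
  let ?S = "snd C ` (fst C \<inter> proj -` fst D)" and ?r = "local_rep C D proj"
  have S: "open ?S" "smooth_on ?S ?r"
    using local_rep_smooth[OF M.manifold_axioms C(1) assms(3) sp] .
  have aS: "snd C a \<in> ?S" using C assms by auto
  have carr: "chart_inv C v \<in> carrier G" if "v \<in> ?W" for v
    using smooth_param_in[OF smooth_param_chart_inv[OF C(1)] that] topspace_eq by simp
  have surj: "surj (fderiv ?r (snd C a))"
    using coset_manifold C assms(3,5) unfolding coset_manifold_def differential_def by blast
  have "smooth_param TM \<B> ?W (\<lambda>v. proj (k \<otimes> chart_inv C v))"
    by (intro smooth_param_proj W smooth_param_mult_const smooth_param_chart_inv C assms)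
  from M.smooth_param_derivative[OF W this _ assms(4), of "snd C a"]
  have "(\<lambda>v. snd D' (proj (k \<otimes> chart_inv C v))) differentiable (at (snd C a))"
    using C assms(6) chart_inv_left[OF C] by (auto simp: differentiable_def)
  then obtain f' where "((\<lambda>v. snd D' (proj (k \<otimes> chart_inv C v))) has_derivative f') (at (snd C a))"
    by (auto simp: differentiable_def)
  then have "((\<lambda>v. local_rep D D' (\<lambda>p. k <# p) (?r v)) has_derivative f') (at (snd C a))"
  proof (rule has_derivative_transform_within_open[OF _ S(1) aS])
    fix v assume "v \<in> ?S"
    then obtain q where q: "v = snd C q" "q \<in> fst C" "proj q \<in> fst D" by auto
    have "q \<in> carrier G" using carr[of v] q chart_inv_left[OF C(1) q(2)] by auto
    then show "snd D' (proj (k \<otimes> chart_inv C v)) = local_rep D D' (\<lambda>p. k <# p) (?r v)"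
      using chart_inv_left[OF C(1) q(2)] M.chart_inv_left[OF assms(3) q(3)] l_coset_proj[OF assms(1)]
      by (simp add: local_rep_def q(1))
  qed
  then have "(\<lambda>v. local_rep D D' (\<lambda>p. k <# p) (?r v)) differentiable (at (snd C a))"
    by (auto simp: differentiable_def)
  from differentiable_descent[OF S aS surj this] show ?thesis
    using chart_inv_left[OF C] by (simp add: local_rep_def o_def)
qed

section \<open>Tangent vectors of the quotient as translates from the base point\<close>

definition base :: "('g set, 'f) chart" where
  "base = (SOME D. D \<in> \<B> \<and> H \<in> fst D)"

lemma base: "base \<in> \<B>" "H \<in> fst base"
proof -
  have "H \<in> topspace TM" using proj_one by (auto simp: topspace_TM)
  then have "\<exists>D. D \<in> \<B> \<and> H \<in> fst D" using M.chart_at by metis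
  from someI_ex[OF this] show "base \<in> \<B>" "H \<in> fst base" by (simp_all add: base_def)
qed

definition dproj :: "'e \<Rightarrow> 'f" where "dproj = differential E base proj \<one>"

text \<open>Tangent vectors at \<open>proj k\<close> are written as translates \<open>push k D (dproj X)\<close> of tangent vectors
  at the base point.\<close>

definition push :: "'g \<Rightarrow> ('g set, 'f) chart \<Rightarrow> 'f \<Rightarrow> 'f" where
  "push k D = differential base D (\<lambda>p. k <# p) H"

lemma dproj_differentiable: "local_rep E base proj differentiable (at e\<^sub>0)"
  by (rule proj_differentiable[OF E base(1) one_E]) (simp add: proj_one base)

lemma linear_dproj: "linear dproj"
  unfolding dproj_def differential_def
  using dproj_differentiable frechet_derivative_works has_derivative_linear by blast

lemma push_differentiable:
  assumes "k \<in> carrier G" "D \<in> \<B>" "proj k \<in> fst D"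
  shows "local_rep base D (\<lambda>p. k <# p) differentiable (at (snd base H))"
  using translation_differentiable[OF assms(1) one_closed base(1) assms(2)] assms base(2)
  by (simp add: proj_one)

lemma linear_push:
  assumes "k \<in> carrier G" "D \<in> \<B>" "proj k \<in> fst D" shows "linear (push k D)"
  unfolding push_def differential_def
  using push_differentiable[OF assms] frechet_derivative_works has_derivative_linear by blast

lemma push_derivative:
  assumes "open S" "smooth_param T \<A> S c" "x \<in> S" "c x = \<one>" "k \<in> carrier G" "D \<in> \<B>" "proj k \<in> fst D"
    and "((\<lambda>y. \<phi> (c y)) has_derivative c') (at x)"
  shows "((\<lambda>y. snd D (proj (k \<otimes> c y))) has_derivative (\<lambda>v. push k D (dproj (c' v)))) (at x)"
proof -
  have 1: "((\<lambda>y. snd base (proj (c y))) has_derivative (\<lambda>v. dproj (c' v))) (at x)"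
    using chain_rule[OF assms(1-3) E _ assms(8), of base proj] dproj_differentiable one_E
    by (simp add: assms(4) dproj_def)
  have "((\<lambda>y. snd D (k <# proj (c y))) has_derivative (\<lambda>v. push k D (dproj (c' v)))) (at x)"
    using M.chain_rule[OF assms(1) smooth_param_proj[OF assms(1,2)] assms(3) base(1) _ 1, of D "\<lambda>p. k <# p"]
      push_differentiable[OF assms(5-7)] base(2) by (simp add: assms(4) proj_one push_def)
  then show ?thesis
    by (rule has_derivative_transform_within_open[OF _ assms(1,3)])
       (use smooth_param_in[OF assms(2)] topspace_eq assms(5) in \<open>simp add: l_coset_proj\<close>)
qed

lemma push_vector_derivative:
  assumes "open S" "smooth_param T \<A> S c" "x \<in> S" "c x = \<one>" "k \<in> carrier G" "D \<in> \<B>" "proj k \<in> fst D"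
    and "((\<lambda>y. \<phi> (c y)) has_vector_derivative c') (at x)"
  shows "((\<lambda>y. snd D (proj (k \<otimes> c y))) has_vector_derivative push k D (dproj c')) (at x)"
  using push_derivative[OF assms(1-7) assms(8)[unfolded has_vector_derivative_def]]
  by (simp add: has_vector_derivative_def linear_scale[OF linear_dproj] linear_scale[OF linear_push[OF assms(5-7)]])

text \<open>Writing points near \<open>k\<close> as \<open>k\<close> times
  \<open>inv k \<otimes> chart_inv C v\<close> factors the differential of \<open>proj\<close> at
  \<open>k\<close> through \<open>dproj\<close> and \<open>push k D\<close>, and this differential
  is surjective.\<close>

lemma push_surj:
  assumes "k \<in> carrier G" "D \<in> \<B>" "proj k \<in> fst D"
  obtains X where "push k D (dproj X) = w"
proof -
  obtain C where C: "C \<in> \<A>" "k \<in> fst C" using chart_at topspace_eq assms(1) by metis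
  let ?W = "snd C ` fst C"
  have W: "open ?W" using chart_image_open[OF C(1)] .
  have kW: "snd C k \<in> ?W" using C by auto
  let ?c = "\<lambda>v. inv k \<otimes> chart_inv C v"
  have sp: "smooth_param T \<A> ?W ?c"
    using assms(1) by (intro smooth_param_mult_const W smooth_param_chart_inv C) auto
  have c1: "?c (snd C k) = \<one>" using chart_inv_left[OF C] assms(1) by simp
  have "((\<lambda>y. \<phi> (?c y)) has_derivative fderiv (\<lambda>y. \<phi> (?c y)) (snd C k)) (at (snd C k))"
    using smooth_param_derivative[OF W sp kW E] c1 one_E by simp
  from push_derivative[where x = "snd C k", OF W sp kW c1 assms this]
  obtain f where f: "((\<lambda>y. snd D (proj (k \<otimes> ?c y))) has_derivative (\<lambda>v. push k D (dproj (f v)))) (at (snd C k))"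
    by blast
  have "(local_rep C D proj has_derivative (\<lambda>v. push k D (dproj (f v)))) (at (snd C k))"
  proof (rule has_derivative_transform_within_open[OF f W kW])
    fix v assume "v \<in> ?W"
    then have "chart_inv C v \<in> carrier G"
      using smooth_param_in[OF smooth_param_chart_inv[OF C(1)]] topspace_eq by blast
    then have "k \<otimes> ?c v = chart_inv C v" using assms(1) by (simp add: m_assoc[symmetric])
    then show "snd D (proj (k \<otimes> ?c v)) = local_rep C D proj v" by (simp add: local_rep_def)
  qed
  then have "differential C D proj k = (\<lambda>v. push k D (dproj (f v)))"
    unfolding differential_def using frechet_derivative_at by metis
  moreover have "surj (differential C D proj k)"
    using coset_manifold C assms(2,3) unfolding coset_manifold_def by blast
  ultimately obtain v where "push k D (dproj (f v)) = w" by (metis surjD)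
  then show ?thesis using that by blast
qed

text \<open>Since \<open>\<sigma> (t + s) = \<sigma> t \<otimes> \<sigma> s\<close>, the motion near
  time \<open>t\<close> is the motion near time 0 translated by
  \<open>a \<otimes> \<sigma> t\<close>.\<close>

lemma orbit_derivative:
  assumes \<sigma>: "one_parameter_subgroup G T \<A> \<sigma>" "((\<lambda>t. \<phi> (\<sigma> t)) has_vector_derivative Z) (at 0)"
    and a: "a \<in> carrier G" "D \<in> \<B>" "proj (a \<otimes> \<sigma> t) \<in> fst D"
  shows "((\<lambda>s. snd D (proj (a \<otimes> \<sigma> s))) has_vector_derivative push (a \<otimes> \<sigma> t) D (dproj Z)) (at t)"
proof -
  note \<sigma>D = one_parameter_subgroupD[OF \<sigma>(1)]
  have "((\<lambda>s. snd D (proj ((a \<otimes> \<sigma> t) \<otimes> \<sigma> s))) has_vector_derivative push (a \<otimes> \<sigma> t) D (dproj Z)) (at 0)"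
    by (rule push_vector_derivative[OF open_UNIV \<sigma>D(1) UNIV_I \<sigma>D(4) _ a(2,3) \<sigma>(2)]) (simp add: a \<sigma>D(3))
  then have "((\<lambda>s. snd D (proj (a \<otimes> \<sigma> (t + s)))) has_vector_derivative push (a \<otimes> \<sigma> t) D (dproj Z)) (at (t - t))"
    using a \<sigma>D(2,3) by (simp add: m_assoc)
  moreover have "((\<lambda>s. s - t) has_vector_derivative 1) (at t)" by (auto intro!: derivative_eq_intros)
  ultimately show ?thesis
    using vector_diff_chain_at[of "\<lambda>s. s - t" 1 t "\<lambda>s. snd D (proj (a \<otimes> \<sigma> (t + s)))"] by (simp add: o_def)
qed

text \<open>The isotropy subalgebra is the kernel of the differential of the projection; no closed
  subgroup theorem is needed since the smooth structure of the quotient is given.\<close>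

lemma lie_algebra_of_H: "lie_algebra_of G T \<A> E H = {X. dproj X = 0}"
proof (intro Set.set_eqI iffI)
  fix X assume "X \<in> lie_algebra_of G T \<A> E H"
  then obtain \<sigma> where \<sigma>: "one_parameter_subgroup G T \<A> \<sigma>" "range \<sigma> \<subseteq> H" "((\<lambda>t. \<phi> (\<sigma> t)) has_vector_derivative X) (at 0)"
    by (auto simp: lie_algebra_of_def o_def)
  note \<sigma>D = one_parameter_subgroupD[OF \<sigma>(1)]
  have "((\<lambda>t. snd base (proj (\<sigma> t))) has_vector_derivative dproj X) (at 0)"
    using chain_rule_curve[OF open_UNIV \<sigma>D(1) UNIV_I E _ \<sigma>(3), of base proj] dproj_differentiable one_E
    by (simp add: \<sigma>D(4) dproj_def)
  moreover have "proj (\<sigma> t) = H" for t using \<sigma>(2) proj_eq_H[OF \<sigma>D(3)] by blast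
  ultimately have "((\<lambda>t. snd base H) has_vector_derivative dproj X) (at 0)" by simp
  then show "X \<in> {X. dproj X = 0}"
    using vector_derivative_unique_at[OF _ has_vector_derivative_const] by blast
next
  fix X assume X: "X \<in> {X. dproj X = 0}"
  obtain \<sigma> where \<sigma>: "one_parameter_subgroup G T \<A> \<sigma>" "((\<lambda>t. \<phi> (\<sigma> t)) has_vector_derivative X) (at 0)"
    using one_parameter_subgroup_exists by metis
  note \<sigma>D = one_parameter_subgroupD[OF \<sigma>(1)]
  have sp: "smooth_param TM \<B> UNIV (\<lambda>t. proj (\<sigma> t))" by (rule smooth_param_proj[OF open_UNIV \<sigma>D(1)])
  \<comment> \<open>In every chart the projected curve has zero velocity at all times, so it is
    locally constant; connectedness of the line then keeps it at the base point.\<close>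
  have loc: "\<forall>\<^sub>F s in at t. proj (\<sigma> t) = proj (\<sigma> s)" for t
  proof -
    obtain D where D: "D \<in> \<B>" "proj (\<sigma> t) \<in> fst D" by (rule M.chart_at[OF smooth_param_in[OF sp UNIV_I]])
    have "open (UNIV \<inter> (\<lambda>t. proj (\<sigma> t)) -` fst D)" "t \<in> UNIV \<inter> (\<lambda>t. proj (\<sigma> t)) -` fst D"
      using smooth_param_open_preimage[OF sp open_UNIV M.chart_open[OF D(1)]] D(2) by auto
    then obtain r where r: "r > 0" "ball t r \<subseteq> UNIV \<inter> (\<lambda>t. proj (\<sigma> t)) -` fst D"
      by (rule openE)
    have "((\<lambda>s. snd D (proj (\<sigma> s))) has_derivative (\<lambda>h. 0)) (at s within ball t r)" if s: "s \<in> ball t r" for s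
    proof -
      have in1: "proj (\<sigma> s) \<in> fst D" using r s by auto
      have "((\<lambda>s. snd D (proj (\<one> \<otimes> \<sigma> s))) has_vector_derivative push (\<one> \<otimes> \<sigma> s) D (dproj X)) (at s)"
        by (rule orbit_derivative[OF \<sigma> one_closed D(1)]) (simp add: \<sigma>D(3) in1)
      then have "((\<lambda>s. snd D (proj (\<sigma> s))) has_vector_derivative 0) (at s)"
        using X linear_0[OF linear_push[OF \<sigma>D(3) D(1) in1]] by (simp add: \<sigma>D(3))
      then have d0: "((\<lambda>s. snd D (proj (\<sigma> s))) has_derivative (\<lambda>h. 0)) (at s)"
        by (simp add: has_vector_derivative_def)
      show ?thesis by (rule has_derivative_at_withinI[OF d0])
    qed
    note zero = this
    have "snd D (proj (\<sigma> s)) = snd D (proj (\<sigma> t))" if "s \<in> ball t r" for s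
      by (rule has_derivative_zero_unique[OF convex_ball zero that]) (simp_all add: r(1))
    then have "proj (\<sigma> t) = proj (\<sigma> s)" if "s \<in> ball t r" for s
      using that r(2) D(2) inj_onD[OF M.chart_inj[OF D(1)], of "proj (\<sigma> s)" "proj (\<sigma> t)"] by auto
    then show ?thesis
      using eventually_at_in_open'[of "ball t r" t] r(1) by (auto elim: eventually_mono)
  qed
  have "\<sigma> t \<in> H" for t
  proof -
    have "proj (\<sigma> 0) = proj (\<sigma> t)"
      by (rule connected_local_const[OF connected_UNIV]) (use loc in auto)
    then show ?thesis using proj_eq_H[OF \<sigma>D(3)] \<sigma>D(4) proj_one by metis
  qed
  then show "X \<in> lie_algebra_of G T \<A> E H" using \<sigma> by (auto simp: lie_algebra_of_def o_def)
qed

end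

subsection \<open>Homogeneous geodesics\<close>

context coset
begin

lemma push_isometry:
  assumes "preserves_metric \<B> g (\<lambda>p. k <# p)" "k \<in> carrier G" "D \<in> \<B>" "proj k \<in> fst D"
  shows "g D (snd D (proj k)) (push k D v) (push k D w) = g base (snd base H) v w"
proof -
  have "k <# H = proj k" by simp
  then show ?thesis using assms base unfolding preserves_metric_def push_def by metis
qed

text \<open>Conservation of the momenta \<open>Y \<mapsto> g(\<gamma>', Y\<^sup>*)\<close> along an orbit \<open>\<gamma>\<close>, for all fundamental fields
  \<open>Y\<^sup>*\<close>, makes the orbit a geodesic, because these fields span every tangent space.\<close>

lemma orbit_geodesic:
  assumes g: "riemannian_metric \<B> g" and inv: "\<forall>a\<in>carrier G. preserves_metric \<B> g (\<lambda>p. a <# p)"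
    and \<sigma>: "one_parameter_subgroup G T \<A> \<sigma>" "((\<lambda>t. \<phi> (\<sigma> t)) has_vector_derivative Z) (at 0)"
    and a: "a \<in> carrier G"
    and momentum: "\<And>Y t. g base (snd base H) (dproj Z) (dproj (Ad G E (inv (a \<otimes> \<sigma> t)) Y)) = K Y"
  shows "geodesic_on TM \<B> g UNIV (\<lambda>t. proj (a \<otimes> \<sigma> t))"
proof -
  note \<sigma>D = one_parameter_subgroupD[OF \<sigma>(1)]
  have k_carr: "a \<otimes> \<sigma> t \<in> carrier G" for t using a \<sigma>D(3) by simp
  have sp: "smooth_param TM \<B> UNIV (\<lambda>t. proj (a \<otimes> \<sigma> t))"
    by (intro smooth_param_proj smooth_param_mult_const open_UNIV \<sigma>D(1) a)
  have eq: "g D (u t) (vector_derivative (\<lambda>s. vector_derivative u (at s)) (at t)) w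
      + christoffel (g D) (u t) (vector_derivative u (at t)) (vector_derivative u (at t)) w = 0"
    if D: "D \<in> \<B>" "proj (a \<otimes> \<sigma> t) \<in> fst D" and u: "u = (\<lambda>t. snd D (proj (a \<otimes> \<sigma> t)))" for D t w u
  proof -
    interpret local_metric "snd D ` fst D" "g D" using M.local_metric_chart[OF g D(1)] .
    obtain X where X: "push (a \<otimes> \<sigma> t) D (dproj X) = w" using push_surj[OF k_carr D] by blast
    \<comment> \<open>The fundamental field of this \<open>Y\<close> takes the prescribed value
      \<open>w\<close> at the point of time \<open>t\<close>: the conjugation by
      \<open>a \<otimes> \<sigma> t\<close> undoes the factor
      \<open>Ad G E (inv (a \<otimes> \<sigma> t))\<close> in \<open>Us\<close>.\<close>
    define Y where "Y = Ad G E (a \<otimes> \<sigma> t) X"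
    define B where "B = {s::real. e\<^sub>0 + s *\<^sub>R Y \<in> V}"
    have "open B" unfolding B_def
      by (rule open_vimage[OF open_V, unfolded vimage_def]) (intro continuous_intros)
    have B0: "0 \<in> B" using e0_V by (simp add: B_def)
    \<comment> \<open>A curve through the identity with velocity \<open>Y\<close>; the straight line
      in the chart serves, since the variation field is only evaluated at
      \<open>s = 0\<close>.\<close>
    define \<alpha> where "\<alpha> s = \<iota> (e\<^sub>0 + s *\<^sub>R Y)" for s
    have sm\<alpha>: "smooth_param T \<A> B \<alpha>"
      unfolding \<alpha>_def
    proof (rule smooth_param_compose[OF \<open>open B\<close> open_V smooth_\<iota>])
      show "smooth_on B (\<lambda>s. e\<^sub>0 + s *\<^sub>R Y)"
        by (intro smooth_on_add \<open>open B\<close> smooth_on_const smooth_on_linear bounded_linear_scaleR_left)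
    qed (auto simp: B_def)
    have \<alpha>0: "\<alpha> 0 = \<one>" by (simp add: \<alpha>_def \<iota>_e0)
    have \<alpha>_carr: "\<alpha> s \<in> carrier G" if "s \<in> B" for s
      using smooth_param_in[OF sm\<alpha> that] topspace_eq by simp
    have \<alpha>': "((\<lambda>s. \<phi> (\<alpha> s)) has_vector_derivative Y) (at 0)"
    proof (rule has_vector_derivative_transform_within_open[OF _ \<open>open B\<close> B0])
      show "((\<lambda>s. e\<^sub>0 + s *\<^sub>R Y) has_vector_derivative Y) (at 0)"
        by (auto intro!: derivative_eq_intros)
      show "e\<^sub>0 + s *\<^sub>R Y = \<phi> (\<alpha> s)" if "s \<in> B" for s
        using that by (simp add: \<alpha>_def \<phi>_\<iota> B_def)
    qed
    \<comment> \<open>The orbit moved by the left translations \<open>\<alpha> s\<close>. Each of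
      them is an isometry, so the energy does not depend on \<open>s\<close>, and the variation
      field at \<open>s = 0\<close> is the fundamental field of \<open>Y\<close>.\<close>
    define c where "c w = proj (\<alpha> (fst w) \<otimes> (a \<otimes> \<sigma> (snd w)))" for w :: "real \<times> real"
    have BU: "open (B \<times> (UNIV :: real set))" using \<open>open B\<close> by (simp add: open_Times)
    have smc: "smooth_param TM \<B> (B \<times> UNIV) c"
      unfolding c_def
      by (intro smooth_param_proj BU smooth_param_mult smooth_param_const
          smooth_param_compose[OF BU \<open>open B\<close> sm\<alpha>] smooth_param_compose[OF BU open_UNIV \<sigma>D(1)])
         (auto intro!: smooth_on_linear bounded_linear_fst bounded_linear_snd simp: topspace_eq a)
    define N where "N = (B \<times> UNIV) \<inter> c -` fst D"
    have N: "open N" unfolding N_def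
      by (rule smooth_param_open_preimage[OF smc BU M.chart_open[OF D(1)]])
    define U where "U w = snd D (c w)" for w
    have smU: "smooth_on N U" unfolding N_def U_def by (rule smooth_param_chart[OF smc D(1)])
    have US: "U ` N \<subseteq> snd D ` fst D" by (auto simp: U_def N_def)
    have c0: "c (0, t) = proj (a \<otimes> \<sigma> t)" for t using k_carr by (simp add: c_def \<alpha>0)
    have tN: "(0, t) \<in> N" using D B0 by (simp add: N_def c0)
    have assoc: "\<alpha> s \<otimes> (a \<otimes> \<sigma> t) = (\<alpha> s \<otimes> a) \<otimes> \<sigma> t" if "s \<in> B" for s t
      using \<alpha>_carr[OF that] a \<sigma>D(3) by (simp add: m_assoc)
    have Ut: "fderiv U (s, t) (0, 1) = push (\<alpha> s \<otimes> (a \<otimes> \<sigma> t)) D (dproj Z)"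
      if st: "(s, t) \<in> N" for s t
    proof -
      have s: "s \<in> B" "proj ((\<alpha> s \<otimes> a) \<otimes> \<sigma> t) \<in> fst D" using st assoc by (auto simp: N_def c_def)
      have "((\<lambda>t. U (s, t)) has_vector_derivative push (\<alpha> s \<otimes> (a \<otimes> \<sigma> t)) D (dproj Z)) (at t)"
        using orbit_derivative[OF \<sigma> _ D(1) s(2)] \<alpha>_carr[OF s(1)] a assoc[OF s(1)]
        by (simp add: U_def c_def)
      from vector_derivative_unique_at[OF partial_derivatives(2)[OF smU st] this] show ?thesis .
    qed
    have Us: "fderiv U (0, t) (1, 0) = push (a \<otimes> \<sigma> t) D (dproj (Ad G E (inv (a \<otimes> \<sigma> t)) Y))"
      if st: "(0, t) \<in> N" for t
    proof -
      let ?k = "a \<otimes> \<sigma> t"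
      have Dk: "proj ?k \<in> fst D" using st by (simp add: N_def c0)
      let ?c = "\<lambda>s. inv ?k \<otimes> \<alpha> s \<otimes> inv (inv ?k)"
      have spc: "smooth_param T \<A> B ?c" by (rule smooth_param_conj[OF \<open>open B\<close> sm\<alpha>]) (simp add: k_carr)
      have d: "((\<lambda>s. \<phi> (?c s)) has_vector_derivative Ad G E (inv ?k) Y) (at 0)"
        by (rule Ad_vector_derivative[OF \<open>open B\<close> sm\<alpha> B0 \<alpha>0 _ \<alpha>']) (simp add: k_carr)
      have "((\<lambda>s. snd D (proj (?k \<otimes> ?c s))) has_vector_derivative push ?k D (dproj (Ad G E (inv ?k) Y))) (at 0)"
        by (rule push_vector_derivative[OF \<open>open B\<close> spc B0 _ k_carr D(1) Dk d])
           (simp add: \<alpha>0 k_carr del: inv_inv)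
      then have "((\<lambda>s. U (s, t)) has_vector_derivative push ?k D (dproj (Ad G E (inv ?k) Y))) (at 0)"
      proof (rule has_vector_derivative_transform_within_open[OF _ \<open>open B\<close> B0])
        fix s assume "s \<in> B"
        then have "?k \<otimes> ?c s = \<alpha> s \<otimes> ?k"
          using k_carr[of t] \<alpha>_carr[of s] by (simp add: m_assoc[symmetric] del: inv_mult_group)
        then show "snd D (proj (?k \<otimes> ?c s)) = U (s, t)" by (simp add: U_def c_def)
      qed
      from vector_derivative_unique_at[OF partial_derivatives(1)[OF smU st] this] show ?thesis .
    qed
    let ?Ut = "\<lambda>p. fderiv U p (0, 1)" and ?Us = "\<lambda>p. fderiv U p (1, 0)"
    have noe: "g D (U (0, t)) (fderiv ?Ut (0, t) (0, 1)) (?Us (0, t))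
      + christoffel (g D) (U (0, t)) (?Ut (0, t)) (?Ut (0, t)) (?Us (0, t)) = 0"
    proof (rule noether[OF N smU US tN])
      fix s assume st: "(s, t) \<in> N"
      then have s: "s \<in> B" "proj (\<alpha> s \<otimes> (a \<otimes> \<sigma> t)) \<in> fst D" by (auto simp: N_def c_def)
      have k: "\<alpha> s \<otimes> (a \<otimes> \<sigma> t) \<in> carrier G" using \<alpha>_carr[OF s(1)] k_carr by simp
      show "g D (U (s, t)) (?Ut (s, t)) (?Ut (s, t)) = g base (snd base H) (dproj Z) (dproj Z)"
        unfolding Ut[OF st] using push_isometry[OF _ k D(1) s(2)] inv k by (simp add: U_def c_def)
    next
      fix t assume st: "(0, t) \<in> N"
      have k: "proj (a \<otimes> \<sigma> t) \<in> fst D" using st by (simp add: N_def c0)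
      show "g D (U (0, t)) (?Ut (0, t)) (?Us (0, t)) = K Y"
      proof -
        have pm: "preserves_metric \<B> g (\<lambda>p. (a \<otimes> \<sigma> t) <# p)" using inv k_carr by blast
        show ?thesis
          unfolding Ut[OF st] Us[OF st] U_def c0 \<alpha>0 l_one[OF k_carr] push_isometry[OF pm k_carr D(1) k]
          by (rule momentum)
      qed
    qed
    have "Ad G E (inv (a \<otimes> \<sigma> t)) Y = X"
      unfolding Y_def using k_carr[of t] by (simp add: Ad_mult[symmetric] Ad_one del: inv_mult_group)
    then have Us_w: "?Us (0, t) = w" using Us[OF tN] X by simp
    have uU: "u = (\<lambda>t. U (0, t))" by (simp add: u U_def c0)
    have u': "vector_derivative u (at s) = ?Ut (0, s)" if "(0, s) \<in> N" for s
      unfolding uU by (rule vector_derivative_at[OF partial_derivatives(2)[OF smU that]])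
    have J: "open {s. (0, s) \<in> N}" by (rule open_vimage[OF N, unfolded vimage_def]) (intro continuous_intros)
    have "((\<lambda>s. ?Ut (0, s)) has_vector_derivative fderiv ?Ut (0, t) (0, 1)) (at t)"
      by (rule partial_derivatives(2)[OF smooth_on_directional_derivative[OF N smU] tN])
    then have "((\<lambda>s. vector_derivative u (at s)) has_vector_derivative fderiv ?Ut (0, t) (0, 1)) (at t)"
      by (rule has_vector_derivative_transform_within_open[OF _ J]) (use tN u' in auto)
    then have "vector_derivative (\<lambda>s. vector_derivative u (at s)) (at t) = fderiv ?Ut (0, t) (0, 1)"
      by (rule vector_derivative_at)
    then show ?thesis using noe u'[OF tN] Us_w by (simp add: uU)
  qed
  show ?thesis
    unfolding geodesic_on_def smooth_curve_iff Let_def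
  proof (intro conjI ballI impI allI sp)
    fix D t w assume "D \<in> \<B>" "proj (a \<otimes> \<sigma> t) \<in> fst D"
    from eq[OF this, of "snd D \<circ> (\<lambda>t. proj (a \<otimes> \<sigma> t))" w]
    show "g D ((snd D \<circ> (\<lambda>t. proj (a \<otimes> \<sigma> t))) t)
        (vector_derivative (\<lambda>s. vector_derivative (snd D \<circ> (\<lambda>t. proj (a \<otimes> \<sigma> t))) (at s)) (at t)) w +
       christoffel (g D) ((snd D \<circ> (\<lambda>t. proj (a \<otimes> \<sigma> t))) t)
        (vector_derivative (snd D \<circ> (\<lambda>t. proj (a \<otimes> \<sigma> t))) (at t))
        (vector_derivative (snd D \<circ> (\<lambda>t. proj (a \<otimes> \<sigma> t))) (at t)) w = 0"
      by (simp add: o_def)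
  qed
qed

end

lemma geodesic_on_subset:
  assumes "geodesic_on T \<A> g I c" "J \<subseteq> I" shows "geodesic_on T \<A> g J c"
  using assms smooth_param_subset[of T \<A> I c J]
  unfolding geodesic_on_def smooth_curve_iff by blast

text \<open>A Gram-Schmidt step per generator: the new generator \<open>f\<close> is replaced by its
  component \<open>q\<close> orthogonal to the span so far. Orthogonality refers to
  \<open>b\<close>, which may differ from the ambient inner product; the result provides the
  decomposition of the Lie algebra into \<open>\<hh>\<close> and \<open>\<mm>\<close>.\<close>

lemma inner_product_projection:
  assumes b: "is_inner_product b" and "finite F"
  shows "\<exists>y\<in>span F. \<forall>z\<in>span F. b z (x - y) = 0"
  using assms(2)
proof (induction F arbitrary: x)
  have l: "linear (\<lambda>u. b u v)" and r: "linear (b u)" for u v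
    using b by (auto simp: is_inner_product_def bilinear_def)
  note bl = linear_add[OF l] linear_add[OF r] linear_diff[OF l] linear_diff[OF r]
    linear_scale[OF l] linear_scale[OF r] linear_0[OF l] linear_0[OF r]
  {
    case empty
    show ?case by (simp add: bl)
  next
    case (insert f F)
    obtain y where y: "y \<in> span F" "\<And>z. z \<in> span F \<Longrightarrow> b z (x - y) = 0" using insert.IH by blast
    obtain p where p: "p \<in> span F" "\<And>z. z \<in> span F \<Longrightarrow> b z (f - p) = 0" using insert.IH by blast
    show ?case
    proof (cases "f = p")
      case True
      then have "span (insert f F) = span F" using p(1) by (simp add: span_redundant)
      then show ?thesis using y by auto
    next
      case False
      define q where "q = f - p"
      have "q \<noteq> 0" using False by (simp add: q_def)
      then have "b q q > 0" using b unfolding is_inner_product_def by blast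
      then have q: "b q q \<noteq> 0" by simp
      define s where "s = b q (x - y) / b q q"
      have in_span: "y + s *\<^sub>R q \<in> span (insert f F)"
        unfolding q_def using y(1) p(1) span_mono[of F "insert f F"]
        by (intro span_add span_scale span_diff) (auto intro: span_base)
      moreover have "b z (x - (y + s *\<^sub>R q)) = 0" if z: "z \<in> span (insert f F)" for z
      proof -
        obtain k where k: "z - k *\<^sub>R f \<in> span F" using z span_breakdown_eq by blast
        define z1 where "z1 = (z - k *\<^sub>R f) + k *\<^sub>R p"
        have z1: "z1 \<in> span F" unfolding z1_def using k p(1) by (intro span_add span_scale)
        have "z = z1 + k *\<^sub>R q" by (simp add: z1_def q_def algebra_simps)
        moreover have "b z1 (x - y) = 0" "b z1 q = 0" using y(2) p(2) z1 by (simp_all add: q_def)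
        moreover have "b q (x - y) - s * b q q = 0" using q by (simp add: s_def)
        moreover have "x - (y + s *\<^sub>R q) = (x - y) - s *\<^sub>R q" by simp
        ultimately show ?thesis by (simp only: bl) (simp add: bl(1,2,5,6) algebra_simps)
      qed
      ultimately show ?thesis by blast
    qed
  }
qed

lemma subspace_orth_decomposition:
  fixes S :: "'e::{real_inner,heine_borel} set"
  assumes b: "is_inner_product b" and S: "subspace S"
  obtains W where "W \<in> S" "x - W \<in> orth_complement b S"
proof -
  obtain F where F: "F \<subseteq> S" "independent F" "S \<subseteq> span F" using basis_exists[of S] by metis
  have "F \<subseteq> span onb"
  proof
    fix z
    have "(\<Sum>b\<in>onb. (z \<bullet> b) *\<^sub>R b) \<in> span onb" by (intro span_sum span_scale span_base)
    then show "z \<in> span onb" by (simp only: onb_expansion)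
  qed
  then have "finite F" using independent_span_bound[OF finite_onb F(2)] by blast
  moreover have "span F = S" using F S by (metis span_minimal subset_antisym)
  ultimately obtain W where "W \<in> S" "\<And>z. z \<in> S \<Longrightarrow> b z (x - W) = 0"
    using inner_product_projection[OF b, of F x] by auto
  then show ?thesis using that by (auto simp: orth_complement_def)
qed

section \<open>From commuting vectors to homogeneous geodesics\<close>

context coset
begin

text \<open>A sufficient form of the geodesic lemma: the general criterion only asks for
  \<open>[X + W, A X] \<in> \<hh>\<close>.\<close>

lemma GO_metric_criterion:
  assumes b: "Ad_invariant_metric G E b"
    and \<hh>: "\<hh> = lie_algebra_of G T \<A> E H" and \<mm>: "\<mm> = orth_complement b \<hh>"
    and A: "A ` \<mm> \<subseteq> \<mm>" and g: "invariant_metric_of G E b H \<mm> A \<B> g"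
    and geodesic_vector: "\<And>X. X \<in> \<mm> \<Longrightarrow> \<exists>W\<in>\<hh>. bracket (X + W) (A X) = 0"
  shows "GO_metric G T \<A> TM \<B> g"
proof -
  have ip: "is_inner_product b"
    and b_Ad: "\<And>a X Y. a \<in> carrier G \<Longrightarrow> b (Ad G E a X) (Ad G E a Y) = b X Y"
    using b by (auto simp: Ad_invariant_metric_def)
  have b_lin: "linear (b X)" for X using ip by (auto simp: is_inner_product_def bilinear_def)
  have b_sym: "b X Y = b Y X" for X Y using ip by (simp add: is_inner_product_def)
  have riem: "riemannian_metric \<B> g" and inv: "\<forall>a\<in>carrier G. preserves_metric \<B> g (\<lambda>p. a <# p)"
    and g_base: "\<And>X Y. X \<in> \<mm> \<Longrightarrow> Y \<in> \<mm> \<Longrightarrow> g base (snd base H) (dproj X) (dproj Y) = b (A X) Y"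
    using g base unfolding invariant_metric_of_def Let_def dproj_def by auto
  have ker: "\<hh> = {X. dproj X = 0}" using \<hh> lie_algebra_of_H by simp
  have "subspace \<hh>" unfolding ker by (rule linear_subspace_kernel[OF linear_dproj])
  then have decomp: "\<exists>W\<in>\<hh>. Z - W \<in> \<mm>" for Z
    using subspace_orth_decomposition[OF ip, of \<hh> Z] \<mm> by blast
  have dproj_mod: "dproj (Z - W) = dproj Z" if "W \<in> \<hh>" for Z W
    using that by (simp add: ker linear_diff[OF linear_dproj])
  \<comment> \<open>The second argument may leave \<open>\<mm>\<close>, as it does under
    \<open>Ad\<close> in the momentum: its part in \<open>\<hh>\<close> is killed by
    \<open>dproj\<close> on the left and is \<open>b\<close>-orthogonal to \<open>A X\<close> on the
    right.\<close>
  have g_base': "g base (snd base H) (dproj X) (dproj Y) = b (A X) Y" if X: "X \<in> \<mm>" for X Y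
  proof -
    obtain W where W: "W \<in> \<hh>" "Y - W \<in> \<mm>" using decomp by blast
    have "A X \<in> \<mm>" using A X by blast
    then have "b W (A X) = 0" using W(1) \<mm> by (simp add: orth_complement_def)
    then have "b (A X) (Y - W) = b (A X) Y" using b_sym[of W "A X"] by (simp add: linear_diff[OF b_lin])
    then show ?thesis using g_base[OF X W(2)] dproj_mod[OF W(1), of Y] by simp
  qed
  show ?thesis
    unfolding GO_metric_def
  proof (intro allI impI)
    fix I c assume "open I \<and> is_interval I \<and> geodesic_on TM \<B> g I c"
    then have I: "open I" "is_interval I" and geo: "geodesic_on TM \<B> g I c" by auto
    show "\<exists>\<sigma>. one_parameter_subgroup G T \<A> \<sigma> \<and> (\<exists>p\<in>topspace TM. \<forall>t\<in>I. c t = \<sigma> t <# p)"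
    proof (cases "I = {}")
      case True
      obtain \<sigma> where "one_parameter_subgroup G T \<A> \<sigma>" by (rule one_parameter_subgroup_exists)
      moreover have "proj \<one> \<in> topspace TM" by (simp add: topspace_TM)
      ultimately show ?thesis using True by blast
    next
      case False
      then obtain t0 where t0: "t0 \<in> I" by blast
      have "smooth_param TM \<B> I c" using geo by (simp add: geodesic_on_def smooth_curve_iff)
      from smooth_param_in[OF this t0] obtain a where a: "a \<in> carrier G" "c t0 = proj a"
        by (auto simp: topspace_TM)
      have "proj a \<in> topspace TM" using a(1) by (simp add: topspace_TM)
      then obtain D where D: "D \<in> \<B>" "proj a \<in> fst D" by (rule M.chart_at)
      obtain Z0 where Z0: "push a D (dproj Z0) = vector_derivative (\<lambda>s. snd D (c s)) (at t0)"
        using push_surj[OF a(1) D] by metis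
      \<comment> \<open>The lift of the initial velocity is moved into \<open>\<mm>\<close>; a
        change by an element of \<open>\<hh>\<close> is invisible to \<open>dproj\<close>. The same
        reason lets \<open>W\<close> be added below without changing the velocity.\<close>
      obtain W0 where W0: "W0 \<in> \<hh>" "Z0 - W0 \<in> \<mm>" using decomp by blast
      define X where "X = Z0 - W0"
      have X: "X \<in> \<mm>" "dproj X = dproj Z0" using W0 dproj_mod by (simp_all add: X_def)
      obtain W where W: "W \<in> \<hh>" "bracket (X + W) (A X) = 0" using geodesic_vector[OF X(1)] by blast
      define Z where "Z = X + W"
      have dZ: "dproj Z = dproj X" using W(1) by (simp add: Z_def ker linear_add[OF linear_dproj])
      obtain \<sigma> where \<sigma>: "one_parameter_subgroup G T \<A> \<sigma>" "((\<lambda>t. \<phi> (\<sigma> t)) has_vector_derivative Z) (at 0)"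
        using one_parameter_subgroup_exists by metis
      note \<sigma>D = one_parameter_subgroupD[OF \<sigma>(1)]
      \<comment> \<open>Shifts time so that the orbit passes through \<open>proj a\<close> at
        \<open>t0\<close> instead of 0.\<close>
      define a' where "a' = a \<otimes> \<sigma> (- t0)"
      have a': "a' \<in> carrier G" using a \<sigma>D(3) by (simp add: a'_def)
      have a'_t0: "a' \<otimes> \<sigma> t0 = a"
        using a(1) \<sigma>D(3) \<sigma>D(5)[of t0] by (simp add: a'_def m_assoc)
      have momentum: "g base (snd base H) (dproj Z) (dproj (Ad G E (inv (a' \<otimes> \<sigma> t)) Y)) = b (Ad G E a' (A X)) Y" for Y t
      proof -
        let ?k = "a' \<otimes> \<sigma> t"
        have k: "?k \<in> carrier G" using a' \<sigma>D(3) by simp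
        have "g base (snd base H) (dproj Z) (dproj (Ad G E (inv ?k) Y)) = b (A X) (Ad G E (inv ?k) Y)"
          unfolding dZ by (rule g_base'[OF X(1)])
        also have "\<dots> = b (Ad G E ?k (A X)) (Ad G E ?k (Ad G E (inv ?k) Y))" using b_Ad[OF k] by simp
        also have "Ad G E ?k (Ad G E (inv ?k) Y) = Y"
          unfolding Ad_mult[OF k inv_closed[OF k], symmetric] r_inv[OF k] by (rule Ad_one)
        also have "Ad G E ?k (A X) = Ad G E a' (A X)"
          using Ad_fixed[OF \<sigma>, of "A X"] W(2) by (simp add: Ad_mult[OF a' \<sigma>D(3)] Z_def)
        finally show ?thesis .
      qed
      define \<gamma> where "\<gamma> t = proj (a' \<otimes> \<sigma> t)" for t
      have "geodesic_on TM \<B> g UNIV \<gamma>"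
        unfolding \<gamma>_def by (rule orbit_geodesic[OF riem inv \<sigma> a' momentum])
      then have geo_\<gamma>: "geodesic_on TM \<B> g I \<gamma>" by (rule geodesic_on_subset) simp
      have "((\<lambda>s. snd D (\<gamma> s)) has_vector_derivative push (a' \<otimes> \<sigma> t0) D (dproj Z)) (at t0)"
        unfolding \<gamma>_def by (rule orbit_derivative[OF \<sigma> a' D(1)]) (simp add: a'_t0 D)
      then have vel: "vector_derivative (\<lambda>s. snd D (c s)) (at t0) = vector_derivative (\<lambda>s. snd D (\<gamma> s)) (at t0)"
        using vector_derivative_at a'_t0 dZ X(2) Z0 by metis
      have c\<gamma>: "c t = \<gamma> t" if "t \<in> I" for t
        using M.geodesic_unique[OF riem I t0 geo geo_\<gamma> D(1) _ _ vel that] D(2) a(2) a'_t0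
        by (simp add: \<gamma>_def)
      \<comment> \<open>\<open>GO_metric\<close> asks for an orbit of a subgroup acting from the
        left. Conjugation by \<open>a'\<close> turns \<open>proj (a' \<otimes> \<sigma> t)\<close>
        into the orbit of \<open>proj a'\<close> under \<open>\<tau>\<close>.\<close>
      define \<tau> where "\<tau> t = a' \<otimes> \<sigma> t \<otimes> inv a'" for t
      have "one_parameter_subgroup G T \<A> \<tau>"
        unfolding one_parameter_subgroup_def smooth_curve_iff
      proof (intro conjI allI)
        show "smooth_param T \<A> UNIV \<tau>"
          unfolding \<tau>_def by (rule smooth_param_conj[OF open_UNIV \<sigma>D(1) a'])
        fix s t
        have "inv a' \<otimes> (a' \<otimes> y) = y" if "y \<in> carrier G" for y
          using a' that by (simp add: m_assoc[symmetric])
        then show "\<tau> (s + t) = \<tau> s \<otimes> \<tau> t" using a' \<sigma>D(3) by (simp add: \<tau>_def \<sigma>D(2) m_assoc)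
      qed
      moreover have "c t = \<tau> t <# proj a'" if "t \<in> I" for t
      proof -
        have "\<tau> t <# proj a' = proj (\<tau> t \<otimes> a')"
          using a' \<sigma>D(3) by (intro l_coset_proj) (auto simp: \<tau>_def)
        also have "\<tau> t \<otimes> a' = a' \<otimes> \<sigma> t" using a' \<sigma>D(3) by (simp add: \<tau>_def m_assoc)
        finally show ?thesis using c\<gamma>[OF that] by (simp add: \<gamma>_def)
      qed
      moreover have "proj a' \<in> topspace TM" using a' by (simp add: topspace_TM)
      ultimately show ?thesis by blast
    qed
  qed
qed

end

section \<open>Algebra of the bracket relations\<close>

context lie_chart
begin

lemma bracket_sum:
  "bracket (\<Sum>i\<in>I. f i) (\<Sum>j\<in>J. h j) = (\<Sum>i\<in>I. \<Sum>j\<in>J. bracket (f i) (h j))"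
  using linear_sum[OF linear_bracket_left, of f I] linear_sum[OF linear_bracket_right, of _ h J]
  by (simp add: sum.swap[of _ J I])

lemma eigen_bracket:
  "bracket (\<Sum>i\<in>I. f i) (\<Sum>j\<in>I. x j *\<^sub>R f j) = (\<Sum>(i, j)\<in>I \<times> I. x j *\<^sub>R bracket (f i) (f j))"
  by (simp add: bracket_sum bracket_scale_right sum.cartesian_product)

text \<open>Diagonal brackets vanish, and by antisymmetry the pairs \<open>(i, j)\<close> and
  \<open>(j, i)\<close> contribute \<open>(x j - x i)\<close> times the bracket of
  \<open>f i\<close> and \<open>f j\<close>. If all these brackets vanish, \<open>W = 0\<close>
  works. Otherwise only the pair (1, 2) remains, and a suitable \<open>W\<close>, which annihilates
  every component except \<open>f 2\<close>, compensates it.\<close>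

lemma exists_geodesic_vector:
  fixes m :: "nat \<Rightarrow> 'e set" and x :: "nat \<Rightarrow> real"
  assumes b: "is_inner_product b" and "0 \<in> \<hh>"
    and sub: "\<forall>i\<in>{1..k}. subspace (m i)"
    and f: "\<forall>i\<in>{1..k}. f i \<in> m i"
    and pos: "\<And>i. i \<in> {1..k} \<Longrightarrow> f i \<noteq> 0 \<Longrightarrow> x i > 0"
    and br: "(\<forall>i\<in>{1..k}. \<forall>j\<in>{1..k}. i < j \<longrightarrow> (\<forall>X\<in>m i. \<forall>Y\<in>m j. bracket X Y = 0)) \<or>
      (2 \<le> k \<and>
       (\<forall>i\<in>{1..k}. \<forall>j\<in>{1..k}. i < j \<and> (i, j) \<noteq> (1, 2) \<longrightarrow> (\<forall>X\<in>m i. \<forall>Y\<in>m j. bracket X Y = 0)) \<and>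
       (\<forall>X\<in>m 1. \<forall>Y\<in>m 2. \<exists>W\<in>\<hh>. bracket W Y = bracket X Y \<and>
          (\<forall>i\<in>{1..k} - {2}. \<forall>Z\<in>m i. bracket W Z = 0)))"
  shows "\<exists>W\<in>\<hh>. bracket ((\<Sum>i=1..k. f i) + W) (\<Sum>i=1..k. x i *\<^sub>R f i) = 0"
  using br
proof (elim disjE conjE)
  assume br: "\<forall>i\<in>{1..k}. \<forall>j\<in>{1..k}. i < j \<longrightarrow> (\<forall>X\<in>m i. \<forall>Y\<in>m j. bracket X Y = 0)"
  have "bracket (f i) (f j) = 0" if "i \<in> {1..k}" "j \<in> {1..k}" for i j
  proof (cases i j rule: linorder_cases)
    case less
    then show ?thesis using br f that by blast
  next
    case equal
    then show ?thesis by (simp add: bracket_self)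
  next
    case greater
    then have "bracket (f j) (f i) = 0" using br f that by blast
    then show ?thesis using bracket_antisym[of "f i" "f j"] by simp
  qed
  then have "bracket (\<Sum>i=1..k. f i) (\<Sum>i=1..k. x i *\<^sub>R f i) = 0"
    unfolding eigen_bracket by (intro sum.neutral) auto
  then show ?thesis using assms(2) by (intro bexI[of _ 0]) simp_all
next
  assume k: "2 \<le> k"
    and br: "\<forall>i\<in>{1..k}. \<forall>j\<in>{1..k}. i < j \<and> (i, j) \<noteq> (1, 2) \<longrightarrow> (\<forall>X\<in>m i. \<forall>Y\<in>m j. bracket X Y = 0)"
    and ex: "\<forall>X\<in>m 1. \<forall>Y\<in>m 2. \<exists>W\<in>\<hh>. bracket W Y = bracket X Y \<and>
          (\<forall>i\<in>{1..k} - {2}. \<forall>Z\<in>m i. bracket W Z = 0)"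
  let ?B = "bracket (f 1) (f 2)"
  have zero: "bracket (f i) (f j) = 0"
    if "i \<in> {1..k}" "j \<in> {1..k}" "(i, j) \<noteq> (1, 2)" "(i, j) \<noteq> (2, 1)" for i j
  proof (cases i j rule: linorder_cases)
    case less
    then show ?thesis using br f that by blast
  next
    case equal
    then show ?thesis by (simp add: bracket_self)
  next
    case greater
    then have "bracket (f j) (f i) = 0" using br f that by blast
    then show ?thesis using bracket_antisym[of "f i" "f j"] by simp
  qed
  have "bracket (\<Sum>i=1..k. f i) (\<Sum>i=1..k. x i *\<^sub>R f i) =
      (\<Sum>(i, j)\<in>{(1, 2), (2, 1)}. x j *\<^sub>R bracket (f i) (f j))"
    unfolding eigen_bracket
  proof (rule sum.mono_neutral_right)
    show "\<forall>p\<in>{1..k} \<times> {1..k} - {(1, 2), (2, 1)}. (case p of (i, j) \<Rightarrow> x j *\<^sub>R bracket (f i) (f j)) = 0"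
    proof
      fix p assume "p \<in> {1..k} \<times> {1..k} - {(1, 2), (2, 1)}"
      then have "bracket (f (fst p)) (f (snd p)) = 0" by (intro zero) auto
      then show "(case p of (i, j) \<Rightarrow> x j *\<^sub>R bracket (f i) (f j)) = 0" by (simp add: case_prod_unfold)
    qed
  qed (use k in auto)
  then have XAX: "bracket (\<Sum>i=1..k. f i) (\<Sum>i=1..k. x i *\<^sub>R f i) = (x 2 - x 1) *\<^sub>R ?B"
    using bracket_antisym[of "f 2" "f 1"] by (simp add: algebra_simps)
  show ?thesis
  proof (cases "f 2 = 0")
    \<comment> \<open>Positivity of \<open>x 2\<close> is known only for nonzero \<open>f 2\<close>,
      and the factor in the other case divides by \<open>x 2\<close>. For \<open>f 2 = 0\<close>
      there is nothing to correct.\<close>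
    case True
    then have "?B = 0" using linear_0[OF linear_bracket_right] by simp
    then show ?thesis using XAX assms(2) by (intro bexI[of _ 0]) simp_all
  next
    case False
    have in_k: "1 \<in> {1..k}" "2 \<in> {1..k}" using k by auto
    have x2: "x 2 > 0" using pos[OF in_k(2) False] .
    \<comment> \<open>The factor making the correction term \<open>[W, A X] = c x\<^sub>2 [X\<^sub>1, X\<^sub>2]\<close> cancel \<open>(x\<^sub>2 - x\<^sub>1) [X\<^sub>1, X\<^sub>2]\<close>.\<close>
    define c where "c = (x 1 - x 2) / x 2"
    have "c *\<^sub>R f 1 \<in> m 1" using sub f in_k by (auto intro: subspace_scale)
    moreover have "f 2 \<in> m 2" using f in_k by blast
    \<comment> \<open>The factor \<open>c\<close> is absorbed into the element of
      \<open>m 1\<close>, so that \<open>W\<close> itself need not be rescaled inside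
      \<open>\<hh>\<close>.\<close>
    ultimately obtain W where W: "W \<in> \<hh>" "bracket W (f 2) = bracket (c *\<^sub>R f 1) (f 2)"
      "\<And>i Z. i \<in> {1..k} - {2} \<Longrightarrow> Z \<in> m i \<Longrightarrow> bracket W Z = 0"
      using ex by blast
    have "bracket W (\<Sum>i=1..k. x i *\<^sub>R f i) = (\<Sum>i=1..k. x i *\<^sub>R bracket W (f i))"
      by (simp add: linear_sum[OF linear_bracket_right] bracket_scale_right)
    also have "\<dots> = (\<Sum>i\<in>{2}. x i *\<^sub>R bracket W (f i))"
      by (rule sum.mono_neutral_right) (use in_k W(3) f in auto)
    also have "\<dots> = (x 2 * c) *\<^sub>R ?B"
      using W(2) linear_scale[OF linear_bracket_left, of c "f 1" "f 2"] by simp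
    also have "x 2 * c = x 1 - x 2" using x2 by (simp add: c_def)
    finally have "bracket ((\<Sum>i=1..k. f i) + W) (\<Sum>i=1..k. x i *\<^sub>R f i) = 0"
      using XAX linear_add[OF linear_bracket_left] by (simp add: scaleR_left.diff)
    then show ?thesis using W(1) by blast
  qed
qed

end

text \<open>A partial sum is a full sum padded with zeros. Partial sums occur because
  \<open>A\<close> is linear on \<open>\<mm>\<close> only, so its value on a sum is computed by
  induction over the index set with membership in \<open>\<mm>\<close> at every stage.\<close>

lemma direct_sum_decomp_sum_mem:
  assumes "direct_sum_decomp k M U" "I \<subseteq> {1..k}" "\<And>i. i \<in> I \<Longrightarrow> f i \<in> M i"
  shows "(\<Sum>i\<in>I. f i) \<in> U"
proof -
  let ?f = "\<lambda>i. if i \<in> I then f i else 0"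
  have "\<forall>i\<in>{1..k}. ?f i \<in> M i"
    using assms by (auto simp: direct_sum_decomp_def subspace_0)
  then have "(\<Sum>i=1..k. ?f i) \<in> U" using assms(1) unfolding direct_sum_decomp_def by blast
  moreover have "(\<Sum>i=1..k. ?f i) = (\<Sum>i\<in>I. f i)"
    using assms(2) by (simp add: sum.If_cases Int_absorb1)
  ultimately show ?thesis by simp
qed

theorem lemma4:
  fixes G :: "'g monoid"
    and T :: "'g topology"
    and \<A> :: "('g, 'e::{real_inner, heine_borel}) chart set"
    and E :: "('g, 'e) chart"
    and H :: "'g set"
    and TM :: "'g set topology"
    and \<B> :: "('g set, 'f::{real_inner, heine_borel}) chart set"
    and b :: "'e \<Rightarrow> 'e \<Rightarrow> real"
    and \<hh> \<mm> :: "'e set"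
    and k :: nat
    and \<mm>' :: "nat \<Rightarrow> 'e set"
    and x :: "nat \<Rightarrow> real"
    and A :: "'e \<Rightarrow> 'e"
    and g :: "('g set, 'f) metric_expr"
  assumes "lie_group G T \<A>" and "compact_space T" and "connected_space T"
    and "subgroup H G" and "closedin T H"
    and "coset_manifold G T \<A> H TM \<B>"
    and "E \<in> \<A>" and "\<one>\<^bsub>G\<^esub> \<in> fst E"
    and "Ad_invariant_metric G E b"
    and "\<hh> = lie_algebra_of G T \<A> E H"
    and "\<mm> = orth_complement b \<hh>"
    and "1 \<le> k"
    and "direct_sum_decomp k \<mm>' \<mm>"
    and "\<forall>i\<in>{1..k}. \<forall>a\<in>H. Ad G E a ` \<mm>' i \<subseteq> \<mm>' i"
    and "(\<forall>i\<in>{1..k}. \<forall>j\<in>{1..k}. i < j \<longrightarrow>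
            (\<forall>X\<in>\<mm>' i. \<forall>Y\<in>\<mm>' j. lie_bracket G E X Y = 0))
         \<or>
         (2 \<le> k \<and>
          (\<forall>i\<in>{1..k}. \<forall>j\<in>{1..k}. i < j \<and> (i, j) \<noteq> (1, 2) \<longrightarrow>
            (\<forall>X\<in>\<mm>' i. \<forall>Y\<in>\<mm>' j. lie_bracket G E X Y = 0)) \<and>
          (\<forall>X\<in>\<mm>' 1. \<forall>Y\<in>\<mm>' 2. lie_bracket G E X Y \<in> \<mm>' 2) \<and>
          (\<forall>X\<in>\<mm>' 1. \<forall>Y\<in>\<mm>' 2. \<exists>W\<in>\<hh>.
             lie_bracket G E W Y = lie_bracket G E X Y \<and>
             (\<forall>i\<in>{1..k} - {2}. \<forall>Z\<in>\<mm>' i. lie_bracket G E W Z = 0)))"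
    and "metric_endomorphism G E b H \<mm> A"
    and "\<forall>i\<in>{1..k}. \<forall>X\<in>\<mm>' i. A X = x i *\<^sub>R X"
    and "invariant_metric_of G E b H \<mm> A \<B> g"
  shows "GO_metric G T \<A> TM \<B> g"
proof -
  interpret group G using assms(1) by (simp add: lie_group_def)
  interpret coset G T \<A> E H TM \<B>
    by (intro coset.intro coset_axioms.intro lie_chart.intro lie_chart_axioms.intro lie.intro
        lie_axioms.intro group_axioms assms)
  have b: "is_inner_product b" using assms(9) by (simp add: Ad_invariant_metric_def)
  have A_in: "A ` \<mm> \<subseteq> \<mm>" and A_add: "\<And>X Y. X \<in> \<mm> \<Longrightarrow> Y \<in> \<mm> \<Longrightarrow> A (X + Y) = A X + A Y"
    and A_scale: "\<And>X r. X \<in> \<mm> \<Longrightarrow> A (r *\<^sub>R X) = r *\<^sub>R A X"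
    and A_pos: "\<And>X. X \<in> \<mm> \<Longrightarrow> X \<noteq> 0 \<Longrightarrow> b (A X) X > 0"
    using assms(16) by (auto simp: metric_endomorphism_def)
  note mem = direct_sum_decomp_sum_mem[OF assms(13)]
  have sub: "\<forall>i\<in>{1..k}. subspace (\<mm>' i)" using assms(13) by (simp add: direct_sum_decomp_def)
  have zero_m: "0 \<in> \<mm>" using mem[of "{}"] by simp
  have A_sum: "A (\<Sum>i\<in>I. f i) = (\<Sum>i\<in>I. x i *\<^sub>R f i)"
    if "I \<subseteq> {1..k}" and f: "\<forall>i\<in>{1..k}. f i \<in> \<mm>' i" for I f
    using finite_subset[OF that(1) finite_atLeastAtMost] that(1)
  proof (induction I rule: finite_induct)
    case empty
    then show ?case using A_scale[OF zero_m, of 0] by simp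
  next
    case (insert i I)
    then have "i \<in> {1..k}" and I: "I \<subseteq> {1..k}" by auto
    then have fi: "f i \<in> \<mm>' i" "f i \<in> \<mm>" using f mem[of "{i}" f] by auto
    have "(\<Sum>i\<in>I. f i) \<in> \<mm>" using f I by (intro mem) auto
    then show ?case using A_add[OF fi(2)] insert.IH[OF I] insert.hyps assms(17) \<open>i \<in> {1..k}\<close> fi(1) by simp
  qed
  have "\<exists>W\<in>\<hh>. lie_bracket G E (X + W) (A X) = 0" if X: "X \<in> \<mm>" for X
  proof -
    obtain f where f: "\<forall>i\<in>{1..k}. f i \<in> \<mm>' i" "X = (\<Sum>i=1..k. f i)"
      using assms(13) X unfolding direct_sum_decomp_def by blast
    \<comment> \<open>Positive definiteness of \<open>A\<close>, tested on the component
      \<open>f i\<close>, forces its eigenvalue to be positive; where the component is zero the test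
      says nothing about \<open>x i\<close>.\<close>
    have pos: "x i > 0" if i: "i \<in> {1..k}" "f i \<noteq> 0" for i
    proof -
      have "f i \<in> \<mm>" using mem[of "{i}" f] i f by simp
      then have "b (x i *\<^sub>R f i) (f i) > 0" using A_pos[of "f i"] i f(1) assms(17) by simp
      moreover have "b (x i *\<^sub>R f i) (f i) = x i * b (f i) (f i)"
        using b by (simp add: is_inner_product_def bilinear_def linear_scale)
      moreover have "b (f i) (f i) > 0" using b i by (simp add: is_inner_product_def)
      ultimately show ?thesis by (simp add: zero_less_mult_iff)
    qed
    have "0 \<in> \<hh>" using lie_algebra_of_H linear_0[OF linear_dproj] assms(10) by simp
    then have "\<exists>W\<in>\<hh>. lie_bracket G E ((\<Sum>i=1..k. f i) + W) (\<Sum>i=1..k. x i *\<^sub>R f i) = 0"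
      by (rule exists_geodesic_vector[OF b _ sub f(1) pos]) (use assms(15) in blast)+
    then show ?thesis using A_sum[OF subset_refl f(1)] f(2) by simp
  qed
  then show ?thesis
    by (rule GO_metric_criterion[OF assms(9,10,11) A_in assms(18)])
qed

end
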